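(* For all $\delta>0$ and $\xi>0$ there exist $\varepsilon=\varepsilon(\delta)>0$ and $C=C(\delta,\xi)>0$ such that if $p=p(n)\ge C(\log n/n)^{1/2}$, then a.a.s. $G(n,p)$ has the following property. For every subgraph $G$ of $G(n,p)$ and every triple $(V_1,V_2,V_3)$ of pairwise disjoint vertex sets with $|V_1|=|V_2|=|V_3|\ge \xi n$ which is $(\delta,\varepsilon,p)$-strong-super-regular in $G$, there is a collection of vertex-disjoint triangles of $G$, each having one vertex in each of $V_1,V_2,V_3$, that covers all vertices of $V_1\cup V_2\cup V_3$.
   Context: $G(n,p)$ is the binomial random graph on $n$ vertices; a.a.s. means with probability tending to $1$ as $n\to\infty$. All notions below are taken in the graph $G$. For disjoint vertex sets $X,Y$, $e(X,Y)$ is the number of edges with one endpoint in $X$ and one in $Y$, and $d(X,Y)=e(X,Y)/(|X||Y|)$. We write $x=(1\pm a)y$ for $x\in[(1-a)y,(1+a)y]$. A pair $(X,Y)$ of disjoint sets is $(\varepsilon,p)$-regular if $|d(X,Y)-d(X',Y')|\le\varepsilon p$ for all $X'\subset X$, $Y'\subset Y$ with $|X'|\ge\varepsilon|X|$, $|Y'|\ge\varepsilon|Y|$. For a triple $(V_1,V_2,V_3)$ of pairwise disjoint sets write $d(V_i,V_j)=d_{ij}p$. For $\{i,j,k\}=\{1,2,3\}$, a vertex $v\in V_i$ is $\varepsilon$-typical if, with $N_j=N(v)\cap V_j$ and $N_k=N(v)\cap V_k$: $|N_j|=(1\pm\varepsilon)d_{ij}p|V_j|$, $|N_k|=(1\pm\varepsilon)d_{ik}p|V_k|$,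 and there exist $N_j'\subset N_j$, $N_k'\subset N_k$ with $|N_j'|\ge(1-\varepsilon)|N_j|$, $|N_k'|\ge(1-\varepsilon)|N_k|$ such that $(N_j',N_k')$ is $(\varepsilon,p)$-regular with density $(1\pm\varepsilon)d_{jk}p$. The triple is $(\delta,\varepsilon,p)$-super-regular if each pair $(V_i,V_j)$ is $(\varepsilon,p)$-regular with density at least $\delta p$ and every vertex of every $V_i$ is $\varepsilon$-typical. An edge $uw$ with $u\in V_j$, $w\in V_k$ is $\varepsilon$-good if $u$ and $w$ have at least $(1-\varepsilon)d_{ij}d_{ik}p^2|V_i|$ common neighbours in $V_i$. A vertex $v\in V_i$ is $\varepsilon$-good if it is $\varepsilon$-typical and at most $\varepsilon d_{12}d_{13}d_{23}p^3|V_j||V_k|$ edges between $N(v)\cap V_j$ and $N(v)\cap V_k$ are not $\varepsilon$-good. The triple is $(\delta,\varepsilon,p)$-strong-super-regular if it is $(\delta,\varepsilon,p)$-super-regular and every vertex of every $V_i$ is $\varepsilon$-good. *)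

theory Defs
  imports Complex_Main
begin

definition all_edges :: "nat \<Rightarrow> nat set set" where
  "all_edges n = {{u, v} | u v. u < n \<and> v < n \<and> u \<noteq> v}"

definition adj :: "nat set set \<Rightarrow> nat \<Rightarrow> nat \<Rightarrow> bool" where
  "adj G u v \<longleftrightarrow> u \<noteq> v \<and> {u, v} \<in> G"

definition nbhd :: "nat set set \<Rightarrow> nat \<Rightarrow> nat set" where
  "nbhd G v = {u. adj G v u}"

definition prob_Gnp :: "nat \<Rightarrow> real \<Rightarrow> (nat set set \<Rightarrow> bool) \<Rightarrow> real" where
  "prob_Gnp n p P = (\<Sum>E \<in> Pow (all_edges n).
      (if P E then p ^ card E * (1 - p) ^ (card (all_edges n) - card E) else 0))"

definition aas :: "(nat \<Rightarrow> real) \<Rightarrow> (nat \<Rightarrow> real \<Rightarrow> nat set set \<Rightarrow> bool) \<Rightarrow> bool" where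
  "aas p P \<longleftrightarrow> ((\<lambda>n. prob_Gnp n (p n) (P n (p n))) \<longlonglongrightarrow> 1)"

definition e_count :: "nat set set \<Rightarrow> nat set \<Rightarrow> nat set \<Rightarrow> nat" where
  "e_count G X Y = card {(x, y). x \<in> X \<and> y \<in> Y \<and> adj G x y}"

definition dens :: "nat set set \<Rightarrow> nat set \<Rightarrow> nat set \<Rightarrow> real" where
  "dens G X Y = real (e_count G X Y) / (real (card X) * real (card Y))"

definition approx_eq :: "real \<Rightarrow> real \<Rightarrow> real \<Rightarrow> bool" where
  "approx_eq x a y \<longleftrightarrow> (1 - a) * y \<le> x \<and> x \<le> (1 + a) * y"

definition regular_pair :: "nat set set \<Rightarrow> real \<Rightarrow> real \<Rightarrow> nat set \<Rightarrow> nat set \<Rightarrow> bool" where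
  "regular_pair G eps p X Y \<longleftrightarrow>
     (\<forall>X' Y'. X' \<subseteq> X \<and> Y' \<subseteq> Y \<and> real (card X') \<ge> eps * real (card X)
        \<and> real (card Y') \<ge> eps * real (card Y)
        \<longrightarrow> \<bar>dens G X Y - dens G X' Y'\<bar> \<le> eps * p)"

text \<open>v in Vi is eps-typical w.r.t. the triple, where the other two parts are Vj, Vk.
  Note d_ij p |V_j| = dens G Vi Vj * |V_j| and d_jk p = dens G Vj Vk.\<close>
definition typical :: "nat set set \<Rightarrow> real \<Rightarrow> real \<Rightarrow> nat set \<Rightarrow> nat set \<Rightarrow> nat set \<Rightarrow> nat \<Rightarrow> bool" where
  "typical G eps p Vi Vj Vk v \<longleftrightarrow>
     (let Nj = nbhd G v \<inter> Vj; Nk = nbhd G v \<inter> Vk in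
       approx_eq (real (card Nj)) eps (dens G Vi Vj * real (card Vj)) \<and>
       approx_eq (real (card Nk)) eps (dens G Vi Vk * real (card Vk)) \<and>
       (\<exists>Nj' Nk'. Nj' \<subseteq> Nj \<and> Nk' \<subseteq> Nk \<and>
          real (card Nj') \<ge> (1 - eps) * real (card Nj) \<and>
          real (card Nk') \<ge> (1 - eps) * real (card Nk) \<and>
          regular_pair G eps p Nj' Nk' \<and>
          approx_eq (dens G Nj' Nk') eps (dens G Vj Vk)))"

definition super_regular :: "nat set set \<Rightarrow> real \<Rightarrow> real \<Rightarrow> real \<Rightarrow> nat set \<Rightarrow> nat set \<Rightarrow> nat set \<Rightarrow> bool" where
  "super_regular G \<delta> eps p V1 V2 V3 \<longleftrightarrow>
     regular_pair G eps p V1 V2 \<and> dens G V1 V2 \<ge> \<delta> * p \<and>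
     regular_pair G eps p V1 V3 \<and> dens G V1 V3 \<ge> \<delta> * p \<and>
     regular_pair G eps p V2 V3 \<and> dens G V2 V3 \<ge> \<delta> * p \<and>
     (\<forall>v \<in> V1. typical G eps p V1 V2 V3 v) \<and>
     (\<forall>v \<in> V2. typical G eps p V2 V1 V3 v) \<and>
     (\<forall>v \<in> V3. typical G eps p V3 V1 V2 v)"

definition good_edge :: "nat set set \<Rightarrow> real \<Rightarrow> nat set \<Rightarrow> nat set \<Rightarrow> nat set \<Rightarrow> nat \<Rightarrow> nat \<Rightarrow> bool" where
  "good_edge G eps Vi Vj Vk u w \<longleftrightarrow>
     real (card (nbhd G u \<inter> nbhd G w \<inter> Vi)) \<ge>
       (1 - eps) * dens G Vi Vj * dens G Vi Vk * real (card Vi)"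

definition good_vertex :: "nat set set \<Rightarrow> real \<Rightarrow> real \<Rightarrow> nat set \<Rightarrow> nat set \<Rightarrow> nat set \<Rightarrow> nat \<Rightarrow> bool" where
  "good_vertex G eps p Vi Vj Vk v \<longleftrightarrow>
     typical G eps p Vi Vj Vk v \<and>
     real (card {(u, w). u \<in> nbhd G v \<inter> Vj \<and> w \<in> nbhd G v \<inter> Vk \<and> adj G u w
                         \<and> \<not> good_edge G eps Vi Vj Vk u w})
       \<le> eps * dens G Vi Vj * dens G Vi Vk * dens G Vj Vk * real (card Vj) * real (card Vk)"

definition strong_super_regular :: "nat set set \<Rightarrow> real \<Rightarrow> real \<Rightarrow> real \<Rightarrow> nat set \<Rightarrow> nat set \<Rightarrow> nat set \<Rightarrow> bool" where
  "strong_super_regular G \<delta> eps p V1 V2 V3 \<longleftrightarrow>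
     super_regular G \<delta> eps p V1 V2 V3 \<and>
     (\<forall>v \<in> V1. good_vertex G eps p V1 V2 V3 v) \<and>
     (\<forall>v \<in> V2. good_vertex G eps p V2 V1 V3 v) \<and>
     (\<forall>v \<in> V3. good_vertex G eps p V3 V1 V2 v)"

definition tri_verts :: "nat \<times> nat \<times> nat \<Rightarrow> nat set" where
  "tri_verts t = (case t of (a, b, c) \<Rightarrow> {a, b, c})"

definition triangle_factor :: "nat set set \<Rightarrow> nat set \<Rightarrow> nat set \<Rightarrow> nat set \<Rightarrow> (nat \<times> nat \<times> nat) set \<Rightarrow> bool" where
  "triangle_factor G V1 V2 V3 T \<longleftrightarrow>
     (\<forall>(a, b, c) \<in> T. a \<in> V1 \<and> b \<in> V2 \<and> c \<in> V3 \<and> adj G a b \<and> adj G b c \<and> adj G a c) \<and>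
     (\<forall>t \<in> T. \<forall>t' \<in> T. t \<noteq> t' \<longrightarrow> tri_verts t \<inter> tri_verts t' = {}) \<and>
     V1 \<union> V2 \<union> V3 \<subseteq> \<Union> (tri_verts ` T)"

definition tri_property :: "real \<Rightarrow> real \<Rightarrow> real \<Rightarrow> nat \<Rightarrow> real \<Rightarrow> nat set set \<Rightarrow> bool" where
  "tri_property \<xi> \<delta> eps n p H \<longleftrightarrow>
     (\<forall>G V1 V2 V3. G \<subseteq> H \<and> V1 \<subseteq> {..<n} \<and> V2 \<subseteq> {..<n} \<and> V3 \<subseteq> {..<n} \<and>
        V1 \<inter> V2 = {} \<and> V1 \<inter> V3 = {} \<and> V2 \<inter> V3 = {} \<and>
        card V1 = card V2 \<and> card V2 = card V3 \<and> real (card V1) \<ge> \<xi> * real n \<and>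
        strong_super_regular G \<delta> eps p V1 V2 V3
        \<longrightarrow> (\<exists>T. triangle_factor G V1 V2 V3 T))"

end

theory Submission
  imports Defs "HOL-Library.Disjoint_Sets"
begin

text \<open>Let \<open>m\<close> be the common size of the three parts, and let \<open>H\<close> consist of the edges between \<open>V2\<close> and \<open>V3\<close>
  that are \<open>1/2\<close>-good. A perfect matching \<open>M\<close> of \<open>H\<close> yields a triangle factor as soon as the bipartite graph
  between \<open>V1\<close> and \<open>M\<close>, in which a vertex is joined to the edges in its neighbourhood, satisfies Hall's condition.
  If every vertex of \<open>V1\<close> sees order \<open>p\<^sup>2 m\<close> edges of \<open>M\<close>, then small sets expand, because \<open>G(n,p)\<close> has
  no small vertex set and small matching spanning too many triangles. Sets of linear size have
  almost all of \<open>M\<close> in their neighbourhood if, for every linear set \<open>S \<subseteq> V1\<close>, few edges of \<open>M\<close> are without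
  a common neighbour in \<open>S\<close>; regularity says that such edges are rare in \<open>H\<close>, and there are only \<open>2\<^sup>m\<close> sets \<open>S\<close>, so
  a matching taken from random subgraphs of \<open>H\<close> of constant average degree has this property.\<close>

subsection \<open>Binomial random subsets of a finite set\<close>

text \<open>A vertex of V1 meets order p^2 m edges of M, and the union bound over all m such
  vertices asks for p^2 m to be a large multiple of log n; this is the origin of the condition on p.
  The union over the 2^m sets S is harsher: each may fail with probability at most about exp(-2m).
  Independently sampled edges achieve this when \<epsilon> is exponentially small in 1/\<gamma>, so
  edges of H are sampled, the sample is completed by Hall-type arguments, and the few edges added
  are all counted as bad. One sampling density does not suffice: for every v to keep its share of
  edges, most sampled edges should be isolated, whereas leaving few vertices uncovered takes a large
  constant degree. Strong regularity is used to count the edges of H inside N(v). Super-regularity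
  bounds the number of non-good edges only by order \<epsilon> p m^2 in total, while N(v) spans
  merely order p^3 m^2 edges, so those edges could fill it. The restriction to 1/2-good edges in
  turn supplies expansion from M towards V1.\<close>

definition bexp :: "real \<Rightarrow> 'a set \<Rightarrow> ('a set \<Rightarrow> real) \<Rightarrow> real" where
  "bexp q E f = (\<Sum>F\<in>Pow E. q ^ card F * (1 - q) ^ (card E - card F) * f F)"

text \<open>Finite weighted sums replace a measure space. \<open>prob_Gnp\<close> is the instance
  with \<open>all_edges n\<close>, and the same estimates serve random subsets of \<open>H\<close>
  and random vertex sets.\<close>

definition bprob :: "real \<Rightarrow> 'a set \<Rightarrow> ('a set \<Rightarrow> bool) \<Rightarrow> real" where
  "bprob q E P = bexp q E (\<lambda>F. of_bool (P F))"

lemma bexp_empty [simp]: "bexp q {} f = f {}"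
  by (simp add: bexp_def)

lemma bexp_cong:
  assumes "\<And>F. F \<subseteq> E \<Longrightarrow> f F = g F"
  shows "bexp q E f = bexp q E g"
  unfolding bexp_def by (rule sum.cong) (auto simp: assms)

lemma bexp_add: "bexp q E (\<lambda>F. f F + g F) = bexp q E f + bexp q E g"
  by (simp add: bexp_def algebra_simps sum.distrib)

lemma bexp_cmult: "bexp q E (\<lambda>F. c * f F) = c * bexp q E f"
  unfolding bexp_def sum_distrib_left by (rule sum.cong) (auto simp: mult_ac)

lemma bexp_cmult_right: "bexp q E (\<lambda>F. f F * c) = bexp q E f * c"
  using bexp_cmult[of q E c f] by (simp add: mult.commute)

lemma bexp_sum: "bexp q E (\<lambda>F. \<Sum>i\<in>I. f i F) = (\<Sum>i\<in>I. bexp q E (f i))"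
  unfolding bexp_def sum_distrib_left by (rule sum.swap)

lemma bexp_mono:
  assumes "0 \<le> q" "q \<le> 1" "\<And>F. F \<subseteq> E \<Longrightarrow> f F \<le> g F"
  shows "bexp q E f \<le> bexp q E g"
  unfolding bexp_def using assms by (intro sum_mono mult_left_mono) auto

text \<open>Conditioning on whether e is chosen; this recursion drives the inductions on the ground
  set.\<close>

lemma bexp_insert:
  assumes "finite E" "e \<notin> E"
  shows "bexp q (insert e E) f = (1 - q) * bexp q E f + q * bexp q E (\<lambda>F. f (insert e F))"
proof -
  have inj: "inj_on (insert e) (Pow E)"
    using assms(2) by (auto intro!: inj_onI)
  have disj: "Pow E \<inter> insert e ` Pow E = {}"
    using assms(2) by auto
  have fin: "finite F" "e \<notin> F" "card F \<le> card E" if "F \<in> Pow E" for F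
    using that assms by (auto intro: finite_subset card_mono)
  have "bexp q (insert e E) f
      = (\<Sum>F\<in>Pow E. q ^ card F * (1 - q) ^ (card (insert e E) - card F) * f F)
      + (\<Sum>F\<in>insert e ` Pow E. q ^ card F * (1 - q) ^ (card (insert e E) - card F) * f F)"
    unfolding bexp_def Pow_insert using disj assms(1) by (subst sum.union_disjoint) auto
  also have "(\<Sum>F\<in>insert e ` Pow E. q ^ card F * (1 - q) ^ (card (insert e E) - card F) * f F)
      = (\<Sum>F\<in>Pow E. q * (q ^ card F * (1 - q) ^ (card E - card F) * f (insert e F)))"
    using fin assms by (subst sum.reindex[OF inj]) (auto intro!: sum.cong)
  also have "(\<Sum>F\<in>Pow E. q ^ card F * (1 - q) ^ (card (insert e E) - card F) * f F)
      = (\<Sum>F\<in>Pow E. (1 - q) * (q ^ card F * (1 - q) ^ (card E - card F) * f F))"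
    using fin assms by (intro sum.cong refl) (auto simp: Suc_diff_le)
  finally show ?thesis
    by (simp add: bexp_def sum_distrib_left)
qed

lemma bexp_const [simp]: "finite E \<Longrightarrow> bexp q E (\<lambda>_. c) = c"
  by (induction E rule: finite_induct) (auto simp: bexp_insert algebra_simps)

lemma bexp_Un:
  assumes "finite A" "finite B" "A \<inter> B = {}"
  shows "bexp q (A \<union> B) f = bexp q A (\<lambda>F. bexp q B (\<lambda>F'. f (F \<union> F')))"
  using assms(1,3)
proof (induction A arbitrary: f rule: finite_induct)
  case (insert x A)
  then have "bexp q (insert x (A \<union> B)) f
     = (1 - q) * bexp q (A \<union> B) f + q * bexp q (A \<union> B) (\<lambda>F. f (insert x F))"
    using assms(2) by (intro bexp_insert) auto
  then show ?case
    using insert by (simp add: bexp_insert)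
qed simp

text \<open>Independence of the traces of F on two disjoint sets.\<close>

lemma bexp_mult:
  assumes "finite A" "finite B" "A \<inter> B = {}"
  shows "bexp q (A \<union> B) (\<lambda>F. f (F \<inter> A) * g (F \<inter> B)) = bexp q A f * bexp q B g"
proof -
  have "(F \<union> F') \<inter> A = F \<and> (F \<union> F') \<inter> B = F'" if "F \<subseteq> A" "F' \<subseteq> B" for F F'
    using that assms(3) by blast
  then have "bexp q (A \<union> B) (\<lambda>F. f (F \<inter> A) * g (F \<inter> B))
      = bexp q A (\<lambda>F. bexp q B (\<lambda>F'. f F * g F'))"
    unfolding bexp_Un[OF assms] by (intro bexp_cong) auto
  then show ?thesis
    by (simp add: bexp_cmult bexp_cmult_right)
qed

lemma bexp_marginal:
  assumes "finite E" "A \<subseteq> E"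
  shows "bexp q E (\<lambda>F. f (F \<inter> A)) = bexp q A f"
proof -
  have "bexp q (A \<union> (E - A)) (\<lambda>F. f (F \<inter> A) * (\<lambda>_. 1) (F \<inter> (E - A)))
      = bexp q A f * bexp q (E - A) (\<lambda>_. 1)"
    using assms by (intro bexp_mult) (auto intro: finite_subset)
  moreover have "A \<union> (E - A) = E"
    using assms by auto
  ultimately show ?thesis
    using assms by simp
qed

text \<open>Independence for a whole family of disjoint blocks: \<open>bexp_mult\<close> peels off
  one block at a time, and elements of E outside all blocks are integrated out by
  \<open>bexp_marginal\<close>.\<close>

lemma bexp_prod:
  assumes "finite E" "finite I" "disjoint_family_on B I" "(\<Union>i\<in>I. B i) \<subseteq> E"
  shows "bexp q E (\<lambda>F. \<Prod>i\<in>I. g i (F \<inter> B i)) = (\<Prod>i\<in>I. bexp q (B i) (g i))"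
proof -
  let ?U = "\<lambda>I. \<Union>i\<in>I. B i"
  have fin: "finite (?U I)" "\<And>i. i \<in> I \<Longrightarrow> finite (B i)"
    using assms by (auto intro: finite_subset)
  have "bexp q (?U I) (\<lambda>F. \<Prod>i\<in>I. g i (F \<inter> B i)) = (\<Prod>i\<in>I. bexp q (B i) (g i))"
    using assms(2,3) fin(2)
  proof (induction I rule: finite_induct)
    case (insert j I)
    have disj: "B j \<inter> ?U I = {}"
      using insert.prems(1) insert.hyps(2) by (fastforce simp: disjoint_family_on_def)
    have fin: "finite (?U I)" "finite (B j)"
      using insert by auto
    have *: "(\<Prod>i\<in>I. g i (F \<inter> ?U I \<inter> B i)) = (\<Prod>i\<in>I. g i (F \<inter> B i))" for F
    proof (rule prod.cong[OF refl])
      fix i assume "i \<in> I"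
      then have "F \<inter> ?U I \<inter> B i = F \<inter> B i" by blast
      then show "g i (F \<inter> ?U I \<inter> B i) = g i (F \<inter> B i)" by simp
    qed
    have "bexp q (?U (insert j I)) (\<lambda>F. \<Prod>i\<in>insert j I. g i (F \<inter> B i))
        = bexp q (B j \<union> ?U I) (\<lambda>F. g j (F \<inter> B j) * (\<lambda>F'. \<Prod>i\<in>I. g i (F' \<inter> B i)) (F \<inter> ?U I))"
      using insert.hyps by (simp add: *)
    also have "\<dots> = bexp q (B j) (g j) * bexp q (?U I) (\<lambda>F'. \<Prod>i\<in>I. g i (F' \<inter> B i))"
      using fin disj by (intro bexp_mult) auto
    also have "\<dots> = bexp q (B j) (g j) * (\<Prod>i\<in>I. bexp q (B i) (g i))"
      using insert by (simp add: disjoint_family_on_def)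
    finally show ?case
      using insert.hyps by simp
  qed simp
  moreover have "(\<Prod>i\<in>I. g i (F \<inter> ?U I \<inter> B i)) = (\<Prod>i\<in>I. g i (F \<inter> B i))" for F
  proof (rule prod.cong[OF refl])
    fix i assume "i \<in> I"
    then have "F \<inter> ?U I \<inter> B i = F \<inter> B i" by blast
    then show "g i (F \<inter> ?U I \<inter> B i) = g i (F \<inter> B i)" by simp
  qed
  ultimately show ?thesis
    using bexp_marginal[OF assms(1,4), of q "\<lambda>F. \<Prod>i\<in>I. g i (F \<inter> B i)"] by simp
qed

text \<open>The generating function of the binomial distribution. The value x = 0 is meaningful as
  well and yields the probability of avoiding A.\<close>

lemma bexp_power_card:
  assumes "finite E" "A \<subseteq> E"
  shows "bexp q E (\<lambda>F. x ^ card (F \<inter> A)) = (1 + (x - 1) * q) ^ card A"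
proof -
  have "finite A"
    using assms by (auto intro: finite_subset)
  then have "bexp q A (\<lambda>F. x ^ card F) = (1 + (x - 1) * q) ^ card A"
  proof (induction A rule: finite_induct)
    case (insert a A)
    have "bexp q A (\<lambda>F. x ^ card (insert a F)) = bexp q A (\<lambda>F. x * x ^ card F)"
      using insert.hyps by (intro bexp_cong) (auto simp: card_insert_if finite_subset)
    then show ?case
      using insert by (simp add: bexp_insert bexp_cmult algebra_simps)
  qed simp
  then show ?thesis
    using bexp_marginal[OF assms, of q "\<lambda>F. x ^ card F"] by simp
qed

lemma bexp_power_card_le:
  assumes "finite E" "A \<subseteq> E" "0 \<le> q" "q \<le> 1" "0 \<le> x"
  shows "bexp q E (\<lambda>F. x ^ card (F \<inter> A)) \<le> exp ((x - 1) * (q * card A))"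
proof -
  \<comment> \<open>Taking powers in 1 + y \<le> exp y requires the base to be nonnegative.\<close>
  have "q * (x - 1) \<ge> q * (-1)"
    using assms by (intro mult_left_mono) auto
  then have "0 \<le> 1 + (x - 1) * q"
    using assms by (simp add: mult.commute)
  then have "(1 + (x - 1) * q) ^ card A \<le> exp ((x - 1) * q) ^ card A"
    by (intro power_mono) auto
  then show ?thesis
    using assms by (simp add: bexp_power_card exp_of_nat_mult[symmetric] mult_ac)
qed

section \<open>Probabilities: union bounds and exponential tail estimates\<close>

lemma bprob_nonneg: "0 \<le> q \<Longrightarrow> q \<le> 1 \<Longrightarrow> 0 \<le> bprob q E P"
  unfolding bprob_def bexp_def by (intro sum_nonneg) auto

lemma bprob_mono:
  assumes "0 \<le> q" "q \<le> 1" "\<And>F. F \<subseteq> E \<Longrightarrow> P F \<Longrightarrow> Q F"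
  shows "bprob q E P \<le> bprob q E Q"
  unfolding bprob_def using assms by (intro bexp_mono) auto

lemma bprob_disj:
  assumes "0 \<le> q" "q \<le> 1"
  shows "bprob q E (\<lambda>F. P F \<or> Q F) \<le> bprob q E P + bprob q E Q"
  unfolding bprob_def bexp_add[symmetric] using assms by (intro bexp_mono) auto

lemma bprob_not:
  assumes "finite E"
  shows "bprob q E (\<lambda>F. \<not> P F) = 1 - bprob q E P"
proof -
  have "bprob q E (\<lambda>F. \<not> P F) + bprob q E P = bexp q E (\<lambda>_. 1)"
    unfolding bprob_def bexp_add[symmetric] by (intro bexp_cong) auto
  then show ?thesis
    using assms by simp
qed

lemma bprob_ex_le:
  assumes "0 \<le> q" "q \<le> 1" "finite I"
  shows "bprob q E (\<lambda>F. \<exists>i\<in>I. P i F) \<le> (\<Sum>i\<in>I. bprob q E (P i))"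
  unfolding bprob_def bexp_sum[symmetric]
proof (rule bexp_mono[OF assms(1,2)])
  fix F
  show "of_bool (\<exists>i\<in>I. P i F) \<le> (\<Sum>i\<in>I. of_bool (P i F) :: real)"
  proof (cases "\<exists>i\<in>I. P i F")
    case True
    then obtain i where "i \<in> I" "P i F" by blast
    then show ?thesis
      using member_le_sum[of i I "\<lambda>i. of_bool (P i F) :: real"] assms(3) by auto
  qed (auto intro: sum_nonneg)
qed

lemma bprob_ex_le_card:
  fixes b :: real
  assumes "0 \<le> q" "q \<le> 1" "finite I" "\<And>i. i \<in> I \<Longrightarrow> bprob q E (P i) \<le> b"
  shows "bprob q E (\<lambda>F. \<exists>i\<in>I. P i F) \<le> card I * b"
  using bprob_ex_le[OF assms(1-3), of E P] sum_bounded_above[of I "\<lambda>i. bprob q E (P i)" b] assms(4)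
  by (auto intro: order_trans)

lemma bprob_less_1_obtains:
  assumes "finite E" "bprob q E P < 1"
  obtains F where "F \<subseteq> E" "\<not> P F"
proof (cases "\<exists>F\<subseteq>E. \<not> P F")
  case False
  then have "bprob q E P = bexp q E (\<lambda>_. 1)"
    unfolding bprob_def by (intro bexp_cong) auto
  then show ?thesis
    using assms by simp
qed (use that in blast)

lemma bprob_markov:
  assumes "0 \<le> q" "q \<le> 1" "0 < c" "\<And>F. F \<subseteq> E \<Longrightarrow> P F \<Longrightarrow> c \<le> f F" "\<And>F. F \<subseteq> E \<Longrightarrow> 0 \<le> f F"
  shows "bprob q E P \<le> bexp q E f / c"
proof -
  have "bprob q E P \<le> bexp q E (\<lambda>F. f F * (1 / c))"
    unfolding bprob_def using assms by (intro bexp_mono) (auto simp: field_simps)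
  then show ?thesis
    unfolding bexp_cmult_right by simp
qed

text \<open>Markov's inequality for \<open>exp s ^ card (F \<inter> A)\<close>. The exponent s stays
  free because \<open>bprob_bad_sets\<close> needs a large one to outweigh 2^m sets;
  \<open>bprob_ge\<close> is the case s = 1.\<close>

lemma bprob_ge_exp:
  assumes "finite E" "A \<subseteq> E" "0 \<le> q" "q \<le> 1" "0 \<le> s"
  shows "bprob q E (\<lambda>F. t \<le> real (card (F \<inter> A))) \<le> exp ((exp s - 1) * (q * card A) - s * t)"
proof -
  have "bprob q E (\<lambda>F. t \<le> real (card (F \<inter> A)))
      \<le> bexp q E (\<lambda>F. exp s ^ card (F \<inter> A)) / exp (s * t)"
    using assms
    by (intro bprob_markov) (auto simp: exp_of_nat_mult[symmetric] mult.commute intro!: mult_left_mono)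
  also have "\<dots> \<le> exp ((exp s - 1) * (q * card A)) / exp (s * t)"
    using assms by (intro divide_right_mono bexp_power_card_le) auto
  finally show ?thesis
    by (simp add: exp_diff)
qed

lemma bprob_ge:
  assumes "finite E" "A \<subseteq> E" "0 \<le> q" "q \<le> 1"
  shows "bprob q E (\<lambda>F. t \<le> real (card (F \<inter> A))) \<le> exp (2 * (q * card A) - t)"
proof -
  have "(exp 1 - 1) * (q * card A) \<le> 2 * (q * card A)"
    using exp_le assms by (intro mult_right_mono) auto
  then show ?thesis
    using order_trans[OF bprob_ge_exp[OF assms, of 1 t]] by simp
qed

text \<open>Markov's inequality with base exp (-1) \<le> 1/2: the exponent is at most minus half of
  the mean, and the deviation returns a quarter of the mean.\<close>

lemma bprob_le_quarter:
  assumes "finite E" "A \<subseteq> E" "0 \<le> q" "q \<le> 1"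
  shows "bprob q E (\<lambda>F. real (card (F \<inter> A)) \<le> q * card A / 4) \<le> exp (- (q * card A / 4))"
proof -
  let ?t = "q * card A / 4"
  have "(1::real) + 1 \<le> exp 1"
    by (rule exp_ge_add_one_self)
  then have half: "exp (-1) \<le> (1/2 :: real)"
    by (simp add: exp_minus field_simps)
  have "bprob q E (\<lambda>F. real (card (F \<inter> A)) \<le> ?t)
      \<le> bexp q E (\<lambda>F. exp (-1) ^ card (F \<inter> A)) / exp (- ?t)"
    using assms by (intro bprob_markov) (auto simp: exp_of_nat_mult[symmetric])
  also have "\<dots> \<le> exp ((exp (-1) - 1) * (q * card A)) / exp (- ?t)"
    using assms by (intro divide_right_mono bexp_power_card_le) auto
  also have "\<dots> = exp ((exp (-1) - 1) * (q * card A) + ?t)"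
    by (simp only: exp_diff[symmetric]) simp
  also have "\<dots> \<le> exp (- (1/2) * (q * card A) + ?t)"
  proof -
    have "(exp (-1) - 1) * (q * card A) \<le> - (1/2) * (q * card A)"
      using half assms by (intro mult_right_mono) auto
    then show ?thesis by simp
  qed
  finally show ?thesis
    by simp
qed

text \<open>Disjoint blocks are contained in F independently, each with probability q^b, so the
  usual exponential moment works for counting them. It is applied to single edges and to pairs of
  edges forming a path.\<close>

lemma bprob_blocks_ge:
  assumes "finite E" "0 \<le> q" "q \<le> 1" "finite I" "disjoint_family_on B I"
    and "\<And>i. i \<in> I \<Longrightarrow> B i \<subseteq> E" "\<And>i. i \<in> I \<Longrightarrow> card (B i) = b"
  shows "bprob q E (\<lambda>F. t \<le> real (card {i\<in>I. B i \<subseteq> F})) \<le> exp (2 * q ^ b * card I - t)"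
proof -
  \<comment> \<open>Evaluated at \<open>F \<inter> B i\<close>, the indicator says that the whole
    block lies in F, yet it depends only on the trace of F on that block.\<close>
  let ?g = "\<lambda>i F. 1 + (exp 1 - 1) * of_bool (F = B i) :: real"
  have prod_eq: "exp (real (card {i\<in>I. B i \<subseteq> F})) = (\<Prod>i\<in>I. ?g i (F \<inter> B i))" for F
  proof -
    have "(\<Prod>i\<in>I. ?g i (F \<inter> B i)) = (\<Prod>i\<in>I. if B i \<subseteq> F then exp 1 else 1)"
      by (intro prod.cong) (auto simp: Int_absorb1)
    also have "\<dots> = exp 1 ^ card {i\<in>I. B i \<subseteq> F}"
      using assms(4) by (simp add: prod.If_cases Collect_conj_eq Int_commute)
    finally show ?thesis
      by (simp add: exp_of_nat_mult[symmetric])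
  qed
  have fin: "finite (B i)" if "i \<in> I" for i
    using assms that by (auto intro: finite_subset)
  have single: "bexp q (B i) (?g i) \<le> exp (2 * q ^ b)" if "i \<in> I" for i
  proof -
    have "bexp q (B i) (\<lambda>F. of_bool (F = B i)) = q ^ b"
    proof -
      have "bexp q (B i) (\<lambda>F. of_bool (F = B i))
         = (\<Sum>F\<in>{B i}. q ^ card F * (1 - q) ^ (card (B i) - card F) * of_bool (F = B i))"
        unfolding bexp_def using fin[OF that] by (intro sum.mono_neutral_right) auto
      then show ?thesis
        using assms(7)[OF that] by simp
    qed
    then have "bexp q (B i) (?g i) = 1 + (exp 1 - 1) * q ^ b"
      using fin[OF that] by (simp add: bexp_add bexp_cmult)
    also have "\<dots> \<le> 1 + 2 * q ^ b"
      using exp_le assms(2) by (intro add_left_mono mult_right_mono) auto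
    also have "\<dots> \<le> exp (2 * q ^ b)"
      by (rule exp_ge_add_one_self)
    finally show ?thesis .
  qed
  have "bprob q E (\<lambda>F. t \<le> real (card {i\<in>I. B i \<subseteq> F}))
      \<le> bexp q E (\<lambda>F. exp (real (card {i\<in>I. B i \<subseteq> F}))) / exp t"
    using assms(2,3) by (intro bprob_markov) auto
  also have "bexp q E (\<lambda>F. exp (real (card {i\<in>I. B i \<subseteq> F}))) = (\<Prod>i\<in>I. bexp q (B i) (?g i))"
    unfolding prod_eq using assms by (intro bexp_prod) auto
  also have "\<dots> \<le> (\<Prod>i\<in>I. exp (2 * q ^ b))"
  proof (rule prod_mono)
    fix i assume "i \<in> I"
    moreover have "0 \<le> bexp q (B i) (?g i)"
    proof -
      have "0 \<le> bexp q (B i) (\<lambda>_. 0)" by (simp add: bexp_def)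
      also have "\<dots> \<le> bexp q (B i) (?g i)"
        using assms by (intro bexp_mono) auto
      finally show ?thesis .
    qed
    ultimately show "0 \<le> bexp q (B i) (?g i) \<and> bexp q (B i) (?g i) \<le> exp (2 * q ^ b)"
      using single by auto
  qed
  also have "\<dots> = exp (2 * q ^ b * card I)"
    by (simp add: exp_of_nat_mult[symmetric] mult.commute)
  finally show ?thesis
    by (simp add: exp_diff divide_right_mono)
qed

subsection \<open>Perfect matchings in bipartite graphs\<close>

text \<open>Induction on the total size of the sets N x. If every N x is a singleton, Hall's
  condition makes the choice injective. Otherwise some N x contains a \<noteq> b, and one of the two
  can be deleted from N x without destroying the condition, since two violating sets would
  contradict submodularity of the size of the neighbourhood.\<close>

lemma hall_marriage:
  assumes "finite X" "\<And>x. x \<in> X \<Longrightarrow> finite (N x)"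
    and "\<And>A. A \<subseteq> X \<Longrightarrow> card A \<le> card (\<Union>(N ` A))"
  shows "\<exists>f. inj_on f X \<and> (\<forall>x\<in>X. f x \<in> N x)"
  using assms(2,3)
proof (induction "\<Sum>x\<in>X. card (N x)" arbitrary: N rule: less_induct)
  case less
  note finN = less.prems(1) and hall = less.prems(2)
  have finU: "finite (\<Union>(N ` A))" if "A \<subseteq> X" for A
    using that finN finite_subset[OF that assms(1)] by auto
  show ?case
  proof (cases "\<forall>x\<in>X. card (N x) \<le> 1")
    case True
    have ne: "N x \<noteq> {}" if "x \<in> X" for x
      using hall[of "{x}"] that by auto
    define f where "f x = (SOME y. y \<in> N x)" for x
    have f: "f x \<in> N x" if "x \<in> X" for x
      using ne[OF that] unfolding f_def by (simp add: some_in_eq)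
    have Nf: "N x = {f x}" if "x \<in> X" for x
      using True f[OF that] finN[OF that] that card_le_Suc0_iff_eq[of "N x"] by auto
    have "inj_on f X"
    proof (rule inj_onI)
      fix x y assume "x \<in> X" "y \<in> X" "f x = f y"
      then show "x = y"
        using hall[of "{x, y}"] Nf[of x] Nf[of y] by (auto simp: card_insert_if split: if_splits)
    qed
    then show ?thesis
      using f by blast
  next
    case False
    then obtain x where x: "x \<in> X" "\<not> card (N x) \<le> 1" by blast
    then obtain a b where ab: "a \<in> N x" "b \<in> N x" "a \<noteq> b"
      using finN[OF x(1)] card_le_Suc0_iff_eq[of "N x"] by auto
    have step: ?thesis if c: "c \<in> N x" and
      ok: "\<And>A. A \<subseteq> X \<Longrightarrow> card A \<le> card (\<Union>((N(x := N x - {c})) ` A))" for c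
    proof -
      let ?N = "N(x := N x - {c})"
      have "(\<Sum>x\<in>X. card (?N x)) < (\<Sum>x\<in>X. card (N x))"
        using assms(1) x(1) c finN[OF x(1)]
        by (intro sum_strict_mono_ex1) (auto simp: card_gt_0_iff intro!: bexI[of _ x] diff_less)
      then have "\<exists>f. inj_on f X \<and> (\<forall>x\<in>X. f x \<in> ?N x)"
        using finN ok by (intro less.hyps) auto
      then obtain f where "inj_on f X" "\<And>x. x \<in> X \<Longrightarrow> f x \<in> ?N x" by blast
      moreover have "?N y \<subseteq> N y" for y
        by simp
      ultimately show ?thesis
        by (intro exI[of _ f]) blast
    qed
    \<comment> \<open>A violating set must contain x, the only point whose set has changed; x is
      then split off.\<close>
    have viol: "\<exists>A. A \<subseteq> X - {x} \<and> card (\<Union>(N ` A) \<union> (N x - {c})) \<le> card A"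
      if A: "A \<subseteq> X" "\<not> card A \<le> card (\<Union>((N(x := N x - {c})) ` A))" for A c
    proof -
      have "x \<in> A"
      proof (rule ccontr)
        assume "x \<notin> A"
        then have "(N(x := N x - {c})) ` A = N ` A" by (intro image_cong) auto
        then show False using A hall by simp
      qed
      then have A': "A = insert x (A - {x})" by blast
      have "N(x := N x - {c}) ` A = insert (N x - {c}) (N ` (A - {x}))"
        by (subst A') (auto simp del: insert_Diff_single)
      then have "\<Union>((N(x := N x - {c})) ` A) = \<Union>(N ` (A - {x})) \<union> (N x - {c})"
        by auto
      moreover have "card A = Suc (card (A - {x}))"
        using \<open>x \<in> A\<close> A(1) assms(1) by (intro card.remove) (auto intro: finite_subset)
      ultimately show ?thesis
        using A by (intro exI[of _ "A - {x}"] conjI) (simp_all add: Diff_mono)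
    qed
    show ?thesis
    proof (rule ccontr)
      assume no: "\<not> ?thesis"
      have "\<exists>A\<subseteq>X - {x}. card (\<Union>(N ` A) \<union> (N x - {c})) \<le> card A" if "c \<in> N x" for c
        using step[OF that] viol[of _ c] no by blast
      then obtain A B where A: "A \<subseteq> X - {x}" "card (\<Union>(N ` A) \<union> (N x - {a})) \<le> card A"
        and B: "B \<subseteq> X - {x}" "card (\<Union>(N ` B) \<union> (N x - {b})) \<le> card B"
        using ab(1,2) by meson
      let ?P = "\<Union>(N ` A) \<union> (N x - {a})" and ?Q = "\<Union>(N ` B) \<union> (N x - {b})"
      have fin: "finite ?P" "finite ?Q" "finite A" "finite B"
        using A B assms(1) finN x by (auto intro!: finU finite_subset[of _ X])
      \<comment> \<open>Uncrossing: since a \<noteq> b, the union of ?P and ?Q contains all of N x,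
        so Hall's condition applies to the union together with x and gains the extra 1.\<close>
      have "card (A \<union> B) + 1 + card (A \<inter> B) \<le> card (?P \<union> ?Q) + card (?P \<inter> ?Q)"
      proof (rule add_mono)
        have "card (A \<union> B) + 1 = card (insert x (A \<union> B))"
          using A(1) B(1) fin by (subst card_insert_disjoint) auto
        also have "\<dots> \<le> card (\<Union>(N ` insert x (A \<union> B)))"
          using A B x by (intro hall) auto
        also have "\<Union>(N ` insert x (A \<union> B)) = ?P \<union> ?Q"
          using ab by auto
        finally show "card (A \<union> B) + 1 \<le> card (?P \<union> ?Q)" .
        have "card (A \<inter> B) \<le> card (\<Union>(N ` (A \<inter> B)))"
          using A by (intro hall) auto
        also have "\<dots> \<le> card (?P \<inter> ?Q)"
          using fin by (intro card_mono) auto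
        finally show "card (A \<inter> B) \<le> card (?P \<inter> ?Q)" .
      qed
      also have "\<dots> = card ?P + card ?Q"
        using card_Un_Int[OF fin(1,2)] by simp
      also have "\<dots> \<le> card (A \<union> B) + card (A \<inter> B)"
        using A(2) B(2) card_Un_Int[OF fin(3,4)] by simp
      finally show False by simp
    qed
  qed
qed

text \<open>Sets of pairs over arbitrary types let matchings be nested: a matching between V1 and a
  matching of V2 with V3 is literally a set of triples (a, b, c).\<close>

definition matching :: "('a \<times> 'b) set \<Rightarrow> bool" where
  "matching M \<longleftrightarrow> inj_on fst M \<and> inj_on snd M"

lemma matching_subset: "matching M \<Longrightarrow> M' \<subseteq> M \<Longrightarrow> matching M'"
  unfolding matching_def by (auto intro: inj_on_subset)

lemma matching_Un:
  assumes "matching M" "matching M'" "fst ` M \<inter> fst ` M' = {}" "snd ` M \<inter> snd ` M' = {}"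
  shows "matching (M \<union> M')"
  using assms unfolding matching_def by (auto simp: inj_on_Un)

text \<open>Hall's condition for sets of size at most \<open>g\<close> follows from expansion on the left, for sets of
  intermediate size from the absence of holes, and for sets missing fewer than \<open>g\<close> neighbours from
  expansion on the right, applied to the missed set.\<close>
lemma expander_perfect_matching:
  fixes g :: real
  assumes "finite X" "finite Y" "card X = card Y" "E \<subseteq> X \<times> Y"
    and left: "\<And>A B. A \<subseteq> X \<Longrightarrow> B \<subseteq> Y \<Longrightarrow> E `` A \<subseteq> B \<Longrightarrow> card B < card A \<Longrightarrow> card A \<le> g \<Longrightarrow> False"
    and right: "\<And>A B. A \<subseteq> X \<Longrightarrow> B \<subseteq> Y \<Longrightarrow> E\<inverse> `` B \<subseteq> A \<Longrightarrow> card A < card B \<Longrightarrow> card B \<le> g \<Longrightarrow> False"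
    and hole: "\<And>A B. A \<subseteq> X \<Longrightarrow> B \<subseteq> Y \<Longrightarrow> g \<le> card A \<Longrightarrow> g \<le> card B \<Longrightarrow> E \<inter> A \<times> B \<noteq> {}"
  shows "\<exists>M\<subseteq>E. matching M \<and> fst ` M = X \<and> snd ` M = Y"
proof -
  have "\<exists>f. inj_on f X \<and> (\<forall>x\<in>X. f x \<in> E `` {x})"
  proof (rule hall_marriage)
    fix A assume A: "A \<subseteq> X"
    have EA: "\<Union>((\<lambda>x. E `` {x}) ` A) = E `` A" by auto
    have EY: "E `` A \<subseteq> Y" using assms(4) by auto
    have fin: "finite A" "finite (E `` A)"
      using A EY assms(1,2) by (auto intro: finite_subset)
    show "card A \<le> card (\<Union>((\<lambda>x. E `` {x}) ` A))"
    proof (rule ccontr)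
      assume "\<not> ?thesis"
      then have less: "card (E `` A) < card A" by (simp add: EA)
      let ?B = "Y - E `` A"
      have cB: "card ?B = card Y - card (E `` A)" and cA: "card (X - A) = card X - card A"
        using fin EY A assms(1) by (auto intro: card_Diff_subset)
      have leX: "card A \<le> card X"
        using A assms(1) by (auto intro: card_mono)
      have "\<not> card A \<le> g"
        using left[OF A EY order_refl less] by blast
      moreover have "\<not> card ?B \<le> g"
      proof
        assume le: "card ?B \<le> g"
        have "E\<inverse> `` ?B \<subseteq> X - A"
          using assms(4) by auto
        moreover have "card (X - A) < card ?B"
          using cA cB less leX assms(3) by linarith
        ultimately show False
          using right[of "X - A" ?B] le by blast
      qed
      ultimately show False
        using hole[of A ?B] A by auto
    qed
  qed (use assms in \<open>auto intro!: finite_subset[of _ Y]\<close>)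
  then obtain f where f: "inj_on f X" "\<And>x. x \<in> X \<Longrightarrow> (x, f x) \<in> E" by auto
  let ?M = "(\<lambda>x. (x, f x)) ` X"
  have "f ` X = Y"
    using f assms by (intro card_subset_eq) (auto simp: card_image)
  moreover have "fst ` ?M = X" "snd ` ?M = f ` X"
    by (auto simp: image_image)
  moreover have "matching ?M"
    using f(1) by (auto simp: matching_def inj_on_def)
  ultimately show ?thesis
    using f(2) by (intro exI[of _ ?M]) auto
qed

lemma maximal_matching_exists:
  assumes "finite R"
  shows "\<exists>M\<subseteq>R. matching M \<and> R \<inter> (- fst ` M) \<times> (- snd ` M) = {}"
proof -
  let ?S = "{M. M \<subseteq> R \<and> matching M}"
  have "{} \<in> ?S"
    by (simp add: matching_def)
  then have ne: "?S \<noteq> {}"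
    by blast
  have fin: "finite ?S"
    by (rule finite_subset[of _ "Pow R"]) (use assms in auto)
  obtain M where M: "M \<in> ?S" "\<forall>M'\<in>?S. M \<subseteq> M' \<longrightarrow> M = M'"
    using finite_has_maximal[OF fin ne] by (elim bexE) (rule that)
  have "R \<inter> (- fst ` M) \<times> (- snd ` M) = {}"
  proof (rule ccontr)
    assume "\<not> ?thesis"
    then obtain x y where xy: "(x, y) \<in> R" "x \<notin> fst ` M" "y \<notin> snd ` M" by auto
    have "matching (insert (x, y) M)"
      using M(1) matching_Un[of M "{(x, y)}"] xy by (auto simp: matching_def)
    then have "M = insert (x, y) M"
      using M(1) xy by (intro M(2)[rule_format]) auto
    then show False
      using xy by (metis fst_conv image_insert insertI1)
  qed
  then show ?thesis
    using M(1) by (intro exI[of _ M]) simp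
qed

subsection \<open>Isolated elements of a sparse random subset\<close>

text \<open>With \<pi> = \<open>fst\<close> or \<open>snd\<close> these are the sampled edges of A
  that share an endpoint on one side with another sampled edge, which may lie outside A. Edges
  without collisions on either side are isolated.\<close>

definition collisions :: "('e \<Rightarrow> 'c) \<Rightarrow> 'e set \<Rightarrow> 'e set \<Rightarrow> 'e set" where
  "collisions \<pi> A F = {e \<in> F \<inter> A. \<exists>e'\<in>F. e' \<noteq> e \<and> \<pi> e' = \<pi> e}"

text \<open>For a sample of k elements of one fibre, a of them in A, the right side charges each of
  the a elements with a function of the other k - 1 that vanishes when there are none. Base 4 leaves
  room for the subtracted 1.\<close>

lemma two_power_minus_one_le:
  assumes "a \<le> k" "2 \<le> k"
  shows "(2::real) ^ a - 1 \<le> real a * (4 ^ (k - 1) - 1)"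
proof (cases a)
  case (Suc b)
  have "(2::real) ^ Suc b - 1 \<le> real (Suc b) * 2 ^ b"
    by (induction b) (auto simp: algebra_simps)
  moreover have "(2::real) ^ b \<le> 4 ^ (k - 1) - 1"
  proof -
    obtain j where j: "k = Suc (Suc j)"
      using assms(2) by (metis Suc_le_D numeral_2_eq_2 Suc_le_mono)
    have "(2::real) ^ b \<le> 2 ^ Suc j"
      using assms Suc j by (intro power_increasing) auto
    also have "\<dots> \<le> 4 * 2 ^ j - 1"
      using one_le_power[of "2::real" j, OF one_le_numeral] unfolding power_Suc by linarith
    also have "\<dots> \<le> 4 * 4 ^ j - (1::real)"
      using power_mono[of "2::real" 4 j] by simp
    finally show ?thesis
      using j by simp
  qed
  then have "real (Suc b) * 2 ^ b \<le> real (Suc b) * (4 ^ (k - 1) - 1 :: real)"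
    by (intro mult_left_mono) auto
  ultimately show ?thesis
    unfolding Suc by (rule order_trans)
qed simp

text \<open>A single sampled element of a fibre does not collide. Otherwise e must be sampled, which
  costs q, together with a second element; the expected excess of 4 to the number of others is at
  most exp (3/400) - 1 \<le> 6/400. Hence the rate of collisions is small compared with the mean
  \<open>q * card (B \<inter> A)\<close>.\<close>

lemma bexp_collisions_fibre:
  fixes q :: real
  assumes "finite B" "0 \<le> q" "q \<le> 1" "q * card B \<le> 1 / 400" "\<And>e. e \<in> B \<Longrightarrow> \<pi> e = w"
  shows "bexp q B (\<lambda>F. 2 ^ card (collisions \<pi> A F)) \<le> exp (6 / 400 * (q * card (B \<inter> A)))"
proof -
  let ?h = "\<lambda>e F. of_bool (e \<in> F) * (4 ^ card (F - {e}) - 1) :: real"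
  have pointwise: "2 ^ card (collisions \<pi> A F) \<le> 1 + (\<Sum>e\<in>B \<inter> A. ?h e F)" if F: "F \<subseteq> B" for F
  proof -
    have fin: "finite F"
      using F assms(1) by (rule finite_subset)
    have sum_eq: "(\<Sum>e\<in>B \<inter> A. ?h e F) = real (card (F \<inter> A)) * (4 ^ (card F - 1) - 1)"
    proof -
      have "(\<Sum>e\<in>B \<inter> A. ?h e F) = (\<Sum>e\<in>F \<inter> A. ?h e F)"
        using F assms(1) by (intro sum.mono_neutral_right) auto
      also have "\<dots> = (\<Sum>e\<in>F \<inter> A. 4 ^ (card F - 1) - 1)"
        by (intro sum.cong) (auto simp: fin)
      finally show ?thesis by simp
    qed
    show ?thesis
    proof (cases "2 \<le> card F")
      case True
      have "card (collisions \<pi> A F) \<le> card (F \<inter> A)"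
        using fin by (intro card_mono) (auto simp: collisions_def)
      then have "2 ^ card (collisions \<pi> A F) \<le> (2::real) ^ card (F \<inter> A)"
        by (intro power_increasing) auto
      moreover have "(2::real) ^ card (F \<inter> A) - 1 \<le> real (card (F \<inter> A)) * (4 ^ (card F - 1) - 1)"
        using True fin by (intro two_power_minus_one_le) (auto intro: card_mono)
      ultimately show ?thesis
        unfolding sum_eq by linarith
    next
      case False
      then have "e' = e" if "e \<in> F" "e' \<in> F" for e e'
        using that fin card_le_Suc0_iff_eq[OF fin] by auto
      then have "collisions \<pi> A F = {}"
        by (auto simp: collisions_def)
      then show ?thesis
        unfolding sum_eq using False by simp
    qed
  qed
  have single: "bexp q B (?h e) \<le> q * (6 / 400)" if "e \<in> B \<inter> A" for e
  proof -
    have "B = insert e (B - {e})" using that by auto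
    then have "bexp q B (?h e) = bexp q (insert e (B - {e})) (?h e)"
      by simp
    also have "\<dots> = (1 - q) * bexp q (B - {e}) (?h e) + q * bexp q (B - {e}) (\<lambda>F. ?h e (insert e F))"
      using assms(1) by (intro bexp_insert) auto
    also have "bexp q (B - {e}) (?h e) = bexp q (B - {e}) (\<lambda>_. 0)"
      by (intro bexp_cong) auto
    also have "bexp q (B - {e}) (\<lambda>F. ?h e (insert e F))
        = bexp q (B - {e}) (\<lambda>F. 4 ^ card (F \<inter> (B - {e})) + (-1))"
    proof (rule bexp_cong)
      fix F assume F: "F \<subseteq> B - {e}"
      then have "insert e F - {e} = F" "F \<inter> (B - {e}) = F" by auto
      then show "?h e (insert e F) = 4 ^ card (F \<inter> (B - {e})) + (-1)" by simp
    qed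
    also have "\<dots> = bexp q (B - {e}) (\<lambda>F. 4 ^ card (F \<inter> (B - {e}))) - 1"
      using assms(1) by (subst bexp_add) simp
    also have "\<dots> \<le> 6 / 400"
    proof -
      have "bexp q (B - {e}) (\<lambda>F. 4 ^ card (F \<inter> (B - {e}))) \<le> exp ((4 - 1) * (q * card (B - {e})))"
        using assms by (intro bexp_power_card_le) auto
      also have "\<dots> \<le> exp (3 / 400)"
      proof -
        have "q * card (B - {e}) \<le> q * card B"
          using assms by (intro mult_left_mono) (auto intro: card_mono)
        then show ?thesis using assms(4) by simp
      qed
      also have "\<dots> \<le> 1 + 3 / 400 + (3 / 400)\<^sup>2"
        by (rule exp_bound) auto
      also have "\<dots> \<le> 1 + 6 / 400"
        by (simp add: power2_eq_square)
      finally show ?thesis by simp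
    qed
    finally show ?thesis
      using assms by (simp add: mult_left_mono)
  qed
  have "bexp q B (\<lambda>F. 2 ^ card (collisions \<pi> A F)) \<le> bexp q B (\<lambda>F. 1 + (\<Sum>e\<in>B \<inter> A. ?h e F))"
    using assms pointwise by (intro bexp_mono) auto
  also have "\<dots> = 1 + (\<Sum>e\<in>B \<inter> A. bexp q B (?h e))"
    using assms(1) unfolding bexp_add bexp_sum by simp
  also have "\<dots> \<le> 1 + card (B \<inter> A) * (q * (6 / 400))"
    using single by (intro add_left_mono sum_bounded_above) auto
  also have "\<dots> \<le> exp (6 / 400 * (q * card (B \<inter> A)))"
    using exp_ge_add_one_self[of "6 / 400 * (q * card (B \<inter> A))"] by (simp add: mult_ac)
  finally show ?thesis .
qed

text \<open>The fibres of \<open>\<pi>\<close> are independent, so the number of collisions, although not a sum of independent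
  indicators, has a product moment generating function.\<close>
lemma bprob_collisions_ge:
  fixes q t :: real
  assumes "finite H" "0 \<le> q" "q \<le> 1" "A \<subseteq> H" "\<And>w. q * card {e \<in> H. \<pi> e = w} \<le> 1 / 400"
  shows "bprob q H (\<lambda>F. t \<le> real (card (collisions \<pi> A F))) \<le> exp (6 / 400 * (q * card A) - t / 2)"
proof -
  let ?B = "\<lambda>w. {e \<in> H. \<pi> e = w}" and ?I = "\<pi> ` H"
  have prod_eq: "2 ^ card (collisions \<pi> A F) = (\<Prod>w\<in>?I. (2::real) ^ card (collisions \<pi> A (F \<inter> ?B w)))"
    if F: "F \<subseteq> H" for F
  proof -
    have "collisions \<pi> A F = (\<Union>w\<in>?I. collisions \<pi> A (F \<inter> ?B w))"
      using F by (auto simp: collisions_def)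
    also have "card \<dots> = (\<Sum>w\<in>?I. card (collisions \<pi> A (F \<inter> ?B w)))"
    proof (rule card_UN_disjoint)
      show "\<forall>w\<in>?I. finite (collisions \<pi> A (F \<inter> ?B w))"
        using assms(1) F by (auto simp: collisions_def intro: finite_subset)
      show "\<forall>w\<in>?I. \<forall>w'\<in>?I. w \<noteq> w' \<longrightarrow>
          collisions \<pi> A (F \<inter> ?B w) \<inter> collisions \<pi> A (F \<inter> ?B w') = {}"
        unfolding collisions_def by blast
    qed (use assms(1) in simp)
    finally show ?thesis
      by (simp add: power_sum)
  qed
  \<comment> \<open>Since 2 \<ge> exp (1/2), a moment with base 2 gives the tail factor exp
    (-t/2).\<close>
  have "exp (t / 2) \<le> 2 ^ k" if "t \<le> real k" for k :: nat
  proof -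
    have "exp (1 / 2) \<le> 1 + 1 / 2 + (1 / 2 :: real)\<^sup>2"
      by (rule exp_bound) auto
    then have "exp (1 / 2) \<le> (2::real)"
      by (simp add: power2_eq_square)
    then have "exp (1 / 2) ^ k \<le> (2::real) ^ k"
      by (intro power_mono) auto
    moreover have "exp (t / 2) \<le> exp (1 / 2) ^ k"
      using that by (simp add: exp_of_nat_mult[symmetric])
    ultimately show ?thesis by linarith
  qed
  then have "bprob q H (\<lambda>F. t \<le> real (card (collisions \<pi> A F)))
      \<le> bexp q H (\<lambda>F. 2 ^ card (collisions \<pi> A F)) / exp (t / 2)"
    using assms by (intro bprob_markov) auto
  also have "bexp q H (\<lambda>F. 2 ^ card (collisions \<pi> A F))
      = bexp q H (\<lambda>F. \<Prod>w\<in>?I. 2 ^ card (collisions \<pi> A (F \<inter> ?B w)))"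
    using prod_eq by (intro bexp_cong) auto
  also have "\<dots> = (\<Prod>w\<in>?I. bexp q (?B w) (\<lambda>F. 2 ^ card (collisions \<pi> A F)))"
    using assms(1) by (intro bexp_prod) (auto simp: disjoint_family_on_def)
  also have "\<dots> \<le> (\<Prod>w\<in>?I. exp (6 / 400 * (q * card (?B w \<inter> A))))"
  proof (rule prod_mono)
    fix w
    have "0 \<le> bexp q (?B w) (\<lambda>_. 0)" by (simp add: bexp_def)
    also have "\<dots> \<le> bexp q (?B w) (\<lambda>F. 2 ^ card (collisions \<pi> A F))"
      using assms by (intro bexp_mono) auto
    finally show "0 \<le> bexp q (?B w) (\<lambda>F. 2 ^ card (collisions \<pi> A F)) \<and>
      bexp q (?B w) (\<lambda>F. 2 ^ card (collisions \<pi> A F)) \<le> exp (6 / 400 * (q * card (?B w \<inter> A)))"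
      using assms by (intro conjI bexp_collisions_fibre[where w = w]) auto
  qed
  also have "\<dots> = exp (6 / 400 * (q * (\<Sum>w\<in>?I. card (?B w \<inter> A))))"
    using assms(1) by (simp add: exp_sum sum_distrib_left)
  also have "(\<Sum>w\<in>?I. card (?B w \<inter> A)) = card (\<Union>w\<in>?I. ?B w \<inter> A)"
    using assms(1) by (intro card_UN_disjoint[symmetric]) auto
  also have "(\<Union>w\<in>?I. ?B w \<inter> A) = A"
    using assms(4) by auto
  finally show ?thesis
    by (simp add: exp_diff divide_right_mono)
qed

text \<open>Every covered point of N uses up a sampled edge over N, and the expected number of those
  is at most \<open>card N / 400\<close>. It shows that the sparse sample leaves at least half of
  each neighbourhood free.\<close>

lemma bprob_image_ge_half:
  fixes q :: real
  assumes "finite H" "0 \<le> q" "q \<le> 1" "finite N" "\<And>w. q * card {e \<in> H. \<pi> e = w} \<le> 1 / 400"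
  shows "bprob q H (\<lambda>F. card N / 2 \<le> real (card (\<pi> ` F \<inter> N))) \<le> exp (- (card N / 4))"
proof -
  let ?A = "{e \<in> H. \<pi> e \<in> N}"
  have "?A = (\<Union>w\<in>N. {e \<in> H. \<pi> e = w})" by auto
  then have "card ?A = (\<Sum>w\<in>N. card {e \<in> H. \<pi> e = w})"
    using assms by (simp only:) (intro card_UN_disjoint, auto)
  then have "q * card ?A = (\<Sum>w\<in>N. q * card {e \<in> H. \<pi> e = w})"
    by (simp add: sum_distrib_left)
  also have "\<dots> \<le> card N * (1 / 400)"
    using assms by (intro sum_bounded_above) auto
  finally have qA: "q * card ?A \<le> card N / 400" by simp
  have "bprob q H (\<lambda>F. card N / 2 \<le> real (card (\<pi> ` F \<inter> N)))
      \<le> bprob q H (\<lambda>F. card N / 2 \<le> real (card (F \<inter> ?A)))"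
  proof (rule bprob_mono[OF assms(2,3)])
    fix F assume F: "F \<subseteq> H" and le: "card N / 2 \<le> real (card (\<pi> ` F \<inter> N))"
    have "\<pi> ` F \<inter> N \<subseteq> \<pi> ` (F \<inter> ?A)"
      using F by auto
    then have "card (\<pi> ` F \<inter> N) \<le> card (F \<inter> ?A)"
      using assms(1) by (intro surj_card_le) auto
    then show "card N / 2 \<le> real (card (F \<inter> ?A))"
      using le by linarith
  qed
  also have "\<dots> \<le> exp (2 * (q * card ?A) - card N / 2)"
    using assms by (intro bprob_ge) auto
  also have "\<dots> \<le> exp (- (card N / 4))"
    using qA by simp
  finally show ?thesis .
qed

subsection \<open>Spread perfect matchings\<close>

lemma exp_neg_le_inverse_cube:
  assumes "3 * ln (real m) \<le> x" "0 < m"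
  shows "exp (- x) \<le> 1 / real m ^ 3"
proof -
  have "real m ^ 3 = exp (3 * ln (real m))"
    using assms(2) by (simp add: exp_of_nat_mult[of 3, simplified])
  also have "\<dots> \<le> exp x"
    using assms(1) by simp
  finally show ?thesis
    using assms(2) by (simp add: exp_minus divide_simps)
qed

lemma exp_le_half_power: "exp (- real k) \<le> (1 / 2) ^ k"
proof -
  have "(2::real) \<le> exp 1"
    using exp_ge_add_one_self[of 1] by simp
  then have "(2::real) ^ k \<le> exp 1 ^ k"
    by (intro power_mono) auto
  then show ?thesis
    by (simp add: exp_of_nat_mult[symmetric] exp_minus power_one_over divide_simps)
qed

lemma half_power_le_eighth: "3 \<le> m \<Longrightarrow> (1 / 2 :: real) ^ m \<le> 1 / 8"
  using power_decreasing[of 3 m "1/2::real"] by (simp add: power3_eq_cube)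

text \<open>The budget of a union over at most m events that fail with probability 1/m^3 each. In
  \<open>sparse_matching_exists\<close> five such unions and one of cost 1/8 stay below 1.\<close>

lemma mult_inverse_cube_le:
  assumes "3 \<le> m" "k \<le> m"
  shows "real k * (1 / real m ^ 3) \<le> 1 / 9"
proof -
  have "real k * (1 / real m ^ 3) \<le> real m * (1 / real m ^ 3)"
    using assms by (intro mult_right_mono) auto
  also have "\<dots> = 1 / real m ^ 2"
    using assms by (simp add: power3_eq_cube power2_eq_square)
  also have "\<dots> \<le> 1 / 3 ^ 2"
    using assms by (intro divide_left_mono power_mono) auto
  finally show ?thesis by simp
qed

text \<open>A balanced bipartite graph that is d-regular up to a factor 2; it is instantiated with
  the good edges between V2 and V3 and d = \<open>D23 * m\<close>.\<close>

locale bipartite_graph =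
  fixes X :: "'a set" and Y :: "'b set" and H :: "('a \<times> 'b) set" and d :: real and m :: nat
  assumes finX: "finite X" and finY: "finite Y" and cardX: "card X = m" and cardY: "card Y = m"
    and H_sub: "H \<subseteq> X \<times> Y" and m3: "3 \<le> m" and d_pos: "0 < d"
    and degX_ge: "\<And>u. u \<in> X \<Longrightarrow> d / 2 \<le> card (H `` {u})"
    and degX_le: "\<And>u. u \<in> X \<Longrightarrow> card (H `` {u}) \<le> 2 * d"
    and degY_ge: "\<And>w. w \<in> Y \<Longrightarrow> d / 2 \<le> card (H\<inverse> `` {w})"
    and degY_le: "\<And>w. w \<in> Y \<Longrightarrow> card (H\<inverse> `` {w}) \<le> 2 * d"
begin

lemma finH: "finite H"
  using H_sub finX finY by (auto intro: finite_subset)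

lemma card_fibre_fst: "card {e \<in> H. fst e = u} \<le> 2 * d"
proof (cases "u \<in> X")
  case True
  have "{e \<in> H. fst e = u} = Pair u ` (H `` {u})" by force
  then have "card {e \<in> H. fst e = u} = card (H `` {u})"
    by (simp add: card_image inj_on_def)
  then show ?thesis using degX_le[OF True] by simp
next
  case False
  then have "{e \<in> H. fst e = u} = {}" using H_sub by auto
  then show ?thesis using d_pos by (simp only: card.empty)
qed

lemma card_fibre_snd: "card {e \<in> H. snd e = w} \<le> 2 * d"
proof (cases "w \<in> Y")
  case True
  have "{e \<in> H. snd e = w} = (\<lambda>u. (u, w)) ` (H\<inverse> `` {w})" by force
  then have "card {e \<in> H. snd e = w} = card (H\<inverse> `` {w})"
    by (simp add: card_image inj_on_def)
  then show ?thesis using degY_le[OF True] by simp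
next
  case False
  then have "{e \<in> H. snd e = w} = {}" using H_sub by auto
  then show ?thesis using d_pos by (simp only: card.empty)
qed

lemma d_le_2m: "d \<le> 2 * real m"
proof -
  obtain u where u: "u \<in> X"
    using cardX m3 by fastforce
  have "card (H `` {u}) \<le> card Y"
    using H_sub finY by (intro card_mono) auto
  then show ?thesis
    using degX_ge[OF u] cardY by linarith
qed

text \<open>The exponent s = 12/\<gamma> turns the deviation \<gamma> m / 4 into 3m, while the
  smallness of \<epsilon> keeps the term from the mean below m. Each set thus fails with probability
  at most exp (-2m), which beats 2^m sets. K bounds the order of the average degree
  \<open>q * d\<close> of the sample.\<close>

lemma bprob_bad_sets:
  fixes q K \<gamma> \<epsilon> :: real
  assumes q: "0 \<le> q" "q \<le> 1" "q * d \<le> K" and \<gamma>: "0 < \<gamma>" "exp (12 / \<gamma>) * (K * \<epsilon>) \<le> 1" "0 \<le> \<epsilon>"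
    and S: "finite \<S>" "card \<S> \<le> 2 ^ m"
    and Bad: "\<And>S. S \<in> \<S> \<Longrightarrow> Bad S \<subseteq> H" "\<And>S. S \<in> \<S> \<Longrightarrow> card (Bad S) \<le> \<epsilon> * d * m"
  shows "bprob q H (\<lambda>F. \<exists>S\<in>\<S>. \<gamma> * m / 4 \<le> card (F \<inter> Bad S)) \<le> 1 / 8"
proof -
  have "bprob q H (\<lambda>F. \<gamma> * m / 4 \<le> card (F \<inter> Bad S)) \<le> exp (- real (2 * m))" if "S \<in> \<S>" for S
  proof -
    have "bprob q H (\<lambda>F. \<gamma> * m / 4 \<le> card (F \<inter> Bad S))
        \<le> exp ((exp (12 / \<gamma>) - 1) * (q * card (Bad S)) - 12 / \<gamma> * (\<gamma> * m / 4))"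
      using that q \<gamma> finH Bad by (intro bprob_ge_exp) auto
    also have "(exp (12 / \<gamma>) - 1) * (q * card (Bad S)) \<le> exp (12 / \<gamma>) * (q * card (Bad S))"
      using q by (intro mult_right_mono) auto
    also have "\<dots> \<le> exp (12 / \<gamma>) * (K * \<epsilon> * m)"
    proof -
      have "q * card (Bad S) \<le> q * (\<epsilon> * d * m)"
        using q Bad(2)[OF that] by (intro mult_left_mono) auto
      also have "\<dots> = (q * d) * (\<epsilon> * m)"
        by simp
      also have "\<dots> \<le> K * (\<epsilon> * m)"
        using q \<gamma> by (intro mult_right_mono) auto
      finally show ?thesis
        by (simp add: mult.assoc)
    qed
    also have "\<dots> \<le> m"
      using mult_right_mono[OF \<gamma>(2), of "real m"] by (simp add: mult.assoc)
    also have "12 / \<gamma> * (\<gamma> * m / 4) = 3 * real m"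
      using \<gamma>(1) by simp
    finally show ?thesis
      by simp
  qed
  then have "bprob q H (\<lambda>F. \<exists>S\<in>\<S>. \<gamma> * m / 4 \<le> card (F \<inter> Bad S)) \<le> card \<S> * exp (- real (2 * m))"
    using q S by (intro bprob_ex_le_card) auto
  also have "\<dots> \<le> 2 ^ m * (1 / 2) ^ (2 * m)"
  proof (intro mult_mono exp_le_half_power)
    show "real (card \<S>) \<le> 2 ^ m"
      using S(2) by (metis of_nat_le_iff of_nat_numeral of_nat_power)
  qed auto
  also have "\<dots> = (1 / 2) ^ m"
    by (simp add: mult_2 power_add power_one_over)
  also have "\<dots> \<le> 1 / 8"
    using m3 by (rule half_power_le_eighth)
  finally show ?thesis .
qed

text \<open>M consists of the isolated edges of a random F. In expectation \<open>E v\<close>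
  contributes \<mu> v \<ge> L/800 edges to F; at least \<mu> v / 4 survive in F, and fewer than
  \<mu> v / 16 are lost to collisions on each side, so \<mu> v / 8 \<ge> L/6400 remain.\<close>

lemma sparse_matching_exists:
  fixes K L \<gamma> \<epsilon> :: real
  assumes J: "finite J" "card J \<le> m" and E: "\<And>v. v \<in> J \<Longrightarrow> E v \<subseteq> H" "\<And>v. v \<in> J \<Longrightarrow> L * d \<le> card (E v)"
    and L: "240000 * ln (real m) \<le> L" and d: "24 * ln (real m) \<le> d" "1 \<le> d"
    and \<gamma>: "0 < \<gamma>" "exp (12 / \<gamma>) * (K * \<epsilon>) \<le> 1" "0 \<le> \<epsilon>" "1 \<le> K"
    and S: "finite \<S>" "card \<S> \<le> 2 ^ m"
    and Bad: "\<And>S. S \<in> \<S> \<Longrightarrow> Bad S \<subseteq> H" "\<And>S. S \<in> \<S> \<Longrightarrow> card (Bad S) \<le> \<epsilon> * d * m"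
  obtains M where "M \<subseteq> H" "matching M" "\<And>v. v \<in> J \<Longrightarrow> L / 6400 \<le> card (M \<inter> E v)"
    "\<And>u. u \<in> X \<Longrightarrow> d / 4 \<le> card (H `` {u} - snd ` M)"
    "\<And>w. w \<in> Y \<Longrightarrow> d / 4 \<le> card (H\<inverse> `` {w} - fst ` M)"
    "\<And>S. S \<in> \<S> \<Longrightarrow> card (M \<inter> Bad S) < \<gamma> * m / 4"
proof -
  \<comment> \<open>Every vertex carries at most 2d edges, hence 1/400 sampled edges in expectation,
    as the collision bounds require.\<close>
  define q where "q = 1 / (800 * d)"
  have q: "0 \<le> q" "q \<le> 1" "q * d \<le> K"
    using d \<gamma>(4) by (auto simp: q_def divide_simps)
  have fibre_fst: "q * card {e \<in> H. fst e = w} \<le> 1 / 400" for w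
    using mult_left_mono[OF card_fibre_fst q(1)] d(2) by (simp add: q_def)
  have fibre_snd: "q * card {e \<in> H. snd e = w} \<le> 1 / 400" for w
    using mult_left_mono[OF card_fibre_snd q(1)] d(2) by (simp add: q_def)
  define \<mu> where "\<mu> v = q * card (E v)" for v
  have \<mu>: "L / 800 \<le> \<mu> v" if "v \<in> J" for v
    using mult_left_mono[OF E(2)[OF that] q(1)] d(2) by (simp add: \<mu>_def q_def)
  have small: "exp (- x) \<le> 1 / real m ^ 3" if "3 * ln (real m) \<le> x" for x
    using that m3 by (intro exp_neg_le_inverse_cube) auto
  have L0: "0 \<le> L"
    using L m3 ln_ge_zero[of "real m"] by linarith
  let ?P1 = "\<lambda>F. \<exists>v\<in>J. card (F \<inter> E v) \<le> \<mu> v / 4"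
  let ?P2 = "\<lambda>F. \<exists>v\<in>J. \<mu> v / 16 \<le> card (collisions fst (E v) F)"
  let ?P3 = "\<lambda>F. \<exists>v\<in>J. \<mu> v / 16 \<le> card (collisions snd (E v) F)"
  let ?P4 = "\<lambda>F. \<exists>u\<in>X. card (H `` {u}) / 2 \<le> card (snd ` F \<inter> H `` {u})"
  let ?P5 = "\<lambda>F. \<exists>w\<in>Y. card (H\<inverse> `` {w}) / 2 \<le> card (fst ` F \<inter> H\<inverse> `` {w})"
  let ?P6 = "\<lambda>F. \<exists>S\<in>\<S>. \<gamma> * m / 4 \<le> card (F \<inter> Bad S)"
  have p1: "bprob q H ?P1 \<le> 1 / 9"
  proof -
    have "bprob q H ?P1 \<le> card J * (1 / real m ^ 3)"
    proof (rule bprob_ex_le_card[OF q(1,2) J(1)])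
      fix v assume v: "v \<in> J"
      have "bprob q H (\<lambda>F. card (F \<inter> E v) \<le> \<mu> v / 4) \<le> exp (- (\<mu> v / 4))"
        unfolding \<mu>_def using finH E(1)[OF v] q by (intro bprob_le_quarter) auto
      also have "\<dots> \<le> 1 / real m ^ 3"
        using \<mu>[OF v] L L0 by (intro small) linarith
      finally show "bprob q H (\<lambda>F. card (F \<inter> E v) \<le> \<mu> v / 4) \<le> 1 / real m ^ 3" .
    qed
    then show ?thesis using mult_inverse_cube_le[OF m3 J(2)] by linarith
  qed
  have collide: "exp (6 / 400 * (q * card (E v)) - \<mu> v / 16 / 2) \<le> 1 / real m ^ 3" if v: "v \<in> J" for v
  proof -
    \<comment> \<open>The exponent is 6/400 - 1/32 = -13/800 times \<mu> v; with \<mu> v \<ge> L/800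
      the constant 240000 gives more than 3 ln m.\<close>
    have "exp (6 / 400 * (q * card (E v)) - \<mu> v / 16 / 2) = exp (- (\<mu> v * (13 / 800)))"
      by (simp add: \<mu>_def)
    also have "\<dots> \<le> 1 / real m ^ 3"
      using \<mu>[OF v] L L0 by (intro small) linarith
    finally show ?thesis .
  qed
  have p2: "bprob q H ?P2 \<le> 1 / 9"
  proof -
    have "bprob q H ?P2 \<le> card J * (1 / real m ^ 3)"
      by (intro bprob_ex_le_card[OF q(1,2) J(1)]
          order_trans[OF bprob_collisions_ge[OF finH q(1,2) E(1) fibre_fst] collide])
    then show ?thesis using mult_inverse_cube_le[OF m3 J(2)] by linarith
  qed
  have p3: "bprob q H ?P3 \<le> 1 / 9"
  proof -
    have "bprob q H ?P3 \<le> card J * (1 / real m ^ 3)"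
      by (intro bprob_ex_le_card[OF q(1,2) J(1)]
          order_trans[OF bprob_collisions_ge[OF finH q(1,2) E(1) fibre_snd] collide])
    then show ?thesis using mult_inverse_cube_le[OF m3 J(2)] by linarith
  qed
  have p4: "bprob q H ?P4 \<le> 1 / 9"
  proof -
    have "bprob q H ?P4 \<le> card X * (1 / real m ^ 3)"
    proof (rule bprob_ex_le_card[OF q(1,2) finX])
      fix u assume u: "u \<in> X"
      have "bprob q H (\<lambda>F. card (H `` {u}) / 2 \<le> card (snd ` F \<inter> H `` {u})) \<le> exp (- (card (H `` {u}) / 4))"
        using finH q fibre_snd by (intro bprob_image_ge_half) auto
      also have "\<dots> \<le> 1 / real m ^ 3"
        using degX_ge[OF u] d(1) by (intro small) linarith
      finally show "bprob q H (\<lambda>F. card (H `` {u}) / 2 \<le> card (snd ` F \<inter> H `` {u})) \<le> 1 / real m ^ 3" .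
    qed
    then show ?thesis using mult_inverse_cube_le[OF m3, of "card X"] cardX by linarith
  qed
  have p5: "bprob q H ?P5 \<le> 1 / 9"
  proof -
    have "bprob q H ?P5 \<le> card Y * (1 / real m ^ 3)"
    proof (rule bprob_ex_le_card[OF q(1,2) finY])
      fix w assume w: "w \<in> Y"
      have "bprob q H (\<lambda>F. card (H\<inverse> `` {w}) / 2 \<le> card (fst ` F \<inter> H\<inverse> `` {w})) \<le> exp (- (card (H\<inverse> `` {w}) / 4))"
        using finH q fibre_fst by (intro bprob_image_ge_half) auto
      also have "\<dots> \<le> 1 / real m ^ 3"
        using degY_ge[OF w] d(1) by (intro small) linarith
      finally show "bprob q H (\<lambda>F. card (H\<inverse> `` {w}) / 2 \<le> card (fst ` F \<inter> H\<inverse> `` {w})) \<le> 1 / real m ^ 3" .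
    qed
    then show ?thesis using mult_inverse_cube_le[OF m3, of "card Y"] cardY by linarith
  qed
  have p6: "bprob q H ?P6 \<le> 1 / 8"
    by (rule bprob_bad_sets[OF q \<gamma>(1-3) S Bad])
  have "bprob q H (\<lambda>F. ?P1 F \<or> ?P2 F \<or> ?P3 F \<or> ?P4 F \<or> ?P5 F \<or> ?P6 F)
      \<le> bprob q H ?P1 + (bprob q H ?P2 + (bprob q H ?P3 + (bprob q H ?P4 + (bprob q H ?P5 + bprob q H ?P6))))"
    by (intro order_trans[OF bprob_disj[OF q(1,2)] add_left_mono] order_refl)
  also have "\<dots> < 1"
    using p1 p2 p3 p4 p5 p6 by linarith
  finally obtain F where F: "F \<subseteq> H" "\<not> (?P1 F \<or> ?P2 F \<or> ?P3 F \<or> ?P4 F \<or> ?P5 F \<or> ?P6 F)"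
    by (rule bprob_less_1_obtains[OF finH])
  have finF: "finite F"
    using F(1) finH by (rule finite_subset)
  define M where "M = {e \<in> F. \<forall>e'\<in>F. e' \<noteq> e \<longrightarrow> fst e' \<noteq> fst e \<and> snd e' \<noteq> snd e}"
  have MF: "M \<subseteq> F" by (auto simp: M_def)
  have finM: "finite M" using MF finF by (rule finite_subset)
  show ?thesis
  proof
    show "M \<subseteq> H" using MF F(1) by blast
    show "matching M"
      unfolding matching_def inj_on_def M_def by blast
    show "L / 6400 \<le> card (M \<inter> E v)" if v: "v \<in> J" for v
    proof -
      have "F \<inter> E v \<subseteq> (M \<inter> E v) \<union> collisions fst (E v) F \<union> collisions snd (E v) F"
        unfolding M_def collisions_def by blast
      then have "card (F \<inter> E v) \<le> card ((M \<inter> E v) \<union> collisions fst (E v) F \<union> collisions snd (E v) F)"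
        using finF finM by (intro card_mono) (auto simp: collisions_def)
      also have "\<dots> \<le> card (M \<inter> E v) + card (collisions fst (E v) F) + card (collisions snd (E v) F)"
        by (meson card_Un_le add_right_mono order_trans)
      finally have *: "real (card (F \<inter> E v))
          \<le> card (M \<inter> E v) + card (collisions fst (E v) F) + card (collisions snd (E v) F)"
        by linarith
      have "\<mu> v / 4 < card (F \<inter> E v)" "card (collisions fst (E v) F) < \<mu> v / 16"
        "card (collisions snd (E v) F) < \<mu> v / 16"
        using F(2) v by (auto simp: not_le)
      then show ?thesis
        using * \<mu>[OF v] by linarith
    qed
    show "d / 4 \<le> card (H `` {u} - snd ` M)" if u: "u \<in> X" for u
    proof -
      have fin: "finite (H `` {u})" using finH by simp
      have "card (snd ` M \<inter> H `` {u}) \<le> card (snd ` F \<inter> H `` {u})"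
        using MF fin by (intro card_mono) auto
      moreover have "card (snd ` F \<inter> H `` {u}) < card (H `` {u}) / 2"
        using F(2) u by (auto simp: not_le)
      moreover have "card (H `` {u}) = card (H `` {u} - snd ` M) + card (snd ` M \<inter> H `` {u})"
        using card_Diff_subset_Int[of "H `` {u}" "snd ` M"] fin finM
          card_mono[OF fin, of "snd ` M \<inter> H `` {u}"] by (simp add: Int_commute)
      ultimately show ?thesis
        using degX_ge[OF u] by linarith
    qed
    show "d / 4 \<le> card (H\<inverse> `` {w} - fst ` M)" if w: "w \<in> Y" for w
    proof -
      have fin: "finite (H\<inverse> `` {w})" using finH by simp
      have "card (fst ` M \<inter> H\<inverse> `` {w}) \<le> card (fst ` F \<inter> H\<inverse> `` {w})"
        using MF fin by (intro card_mono) auto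
      moreover have "card (fst ` F \<inter> H\<inverse> `` {w}) < card (H\<inverse> `` {w}) / 2"
        using F(2) w by (auto simp: not_le)
      moreover have "card (H\<inverse> `` {w}) = card (H\<inverse> `` {w} - fst ` M) + card (fst ` M \<inter> H\<inverse> `` {w})"
        using card_Diff_subset_Int[of "H\<inverse> `` {w}" "fst ` M"] fin finM
          card_mono[OF fin, of "fst ` M \<inter> H\<inverse> `` {w}"] by (simp add: Int_commute)
      ultimately show ?thesis
        using degY_ge[OF w] by linarith
    qed
    show "card (M \<inter> Bad S) < \<gamma> * m / 4" if S: "S \<in> \<S>" for S
    proof -
      have "card (M \<inter> Bad S) \<le> card (F \<inter> Bad S)"
        using MF finF by (intro card_mono) auto
      moreover have "card (F \<inter> Bad S) < \<gamma> * m / 4"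
        using F(2) S by (auto simp: not_le)
      ultimately show ?thesis by linarith
    qed
  qed
qed

text \<open>Between two large sets the sample has mean at least K h m \<ge> 3m, so it is empty there
  with probability at most exp (-3m), against at most 4^m pairs of sets.\<close>

lemma dense_sample_exists:
  fixes K h g \<gamma> \<epsilon> :: real
  assumes K: "0 < K" "K \<le> d" "3 \<le> K * h"
    and \<gamma>: "0 < \<gamma>" "exp (12 / \<gamma>) * (K * \<epsilon>) \<le> 1" "0 \<le> \<epsilon>"
    and S: "finite \<S>" "card \<S> \<le> 2 ^ m"
    and Bad: "\<And>S. S \<in> \<S> \<Longrightarrow> Bad S \<subseteq> H" "\<And>S. S \<in> \<S> \<Longrightarrow> card (Bad S) \<le> \<epsilon> * d * m"
    and hole: "\<And>A B. A \<subseteq> X \<Longrightarrow> B \<subseteq> Y \<Longrightarrow> g \<le> card A \<Longrightarrow> g \<le> card B \<Longrightarrow> h * d * m \<le> card (H \<inter> A \<times> B)"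
  obtains R where "R \<subseteq> H" "\<And>S. S \<in> \<S> \<Longrightarrow> card (R \<inter> Bad S) < \<gamma> * m / 4"
    "\<And>A B. A \<subseteq> X \<Longrightarrow> B \<subseteq> Y \<Longrightarrow> g \<le> card A \<Longrightarrow> g \<le> card B \<Longrightarrow> R \<inter> A \<times> B \<noteq> {}"
proof -
  define q where "q = K / d"
  have q: "0 \<le> q" "q \<le> 1" "q * d \<le> K"
    using K d_pos by (auto simp: q_def)
  let ?I = "{(A, B). A \<subseteq> X \<and> B \<subseteq> Y \<and> g \<le> card A \<and> g \<le> card B}"
  let ?P1 = "\<lambda>F. \<exists>S\<in>\<S>. \<gamma> * m / 4 \<le> card (F \<inter> Bad S)"
  let ?P2 = "\<lambda>F. \<exists>i\<in>?I. F \<inter> fst i \<times> snd i = {}"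
  have p1: "bprob q H ?P1 \<le> 1 / 8"
    by (rule bprob_bad_sets[OF q \<gamma> S Bad])
  have I: "?I \<subseteq> Pow X \<times> Pow Y" "finite (Pow X \<times> Pow Y)"
    using finX finY by auto
  have finI: "finite ?I"
    using I by (rule finite_subset)
  have "bprob q H ?P2 \<le> card ?I * exp (- real (3 * m))"
  proof (rule bprob_ex_le_card[OF q(1,2) finI])
    fix i assume i: "i \<in> ?I"
    \<comment> \<open>As 0^0 = 1, the power of 0 is the indicator of an empty intersection.\<close>
    have "bprob q H (\<lambda>F. F \<inter> fst i \<times> snd i = {}) \<le> bexp q H (\<lambda>F. 0 ^ card (F \<inter> (H \<inter> fst i \<times> snd i)))"
      unfolding bprob_def using q by (intro bexp_mono) (auto simp: Int_assoc[symmetric] Int_absorb2)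
    also have "\<dots> \<le> exp ((0 - 1) * (q * card (H \<inter> fst i \<times> snd i)))"
      using q finH by (intro bexp_power_card_le) auto
    also have "\<dots> \<le> exp (- real (3 * m))"
    proof -
      have "3 * real m \<le> (K * h) * m"
        using K by (intro mult_right_mono) auto
      also have "\<dots> = q * (h * d * m)"
        using d_pos by (simp add: q_def)
      also have "\<dots> \<le> q * card (H \<inter> fst i \<times> snd i)"
        using i q hole[of "fst i" "snd i"] by (intro mult_left_mono) auto
      finally show ?thesis by simp
    qed
    finally show "bprob q H (\<lambda>F. F \<inter> fst i \<times> snd i = {}) \<le> exp (- real (3 * m))" .
  qed
  also have "\<dots> \<le> 2 ^ (2 * m) * (1 / 2) ^ (3 * m)"
  proof (intro mult_mono exp_le_half_power)
    have "card ?I \<le> card (Pow X \<times> Pow Y)"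
      using I by (intro card_mono) auto
    also have "\<dots> = 2 ^ (2 * m)"
      using finX finY cardX cardY by (simp add: card_cartesian_product card_Pow mult_2 power_add)
    finally have "real (card ?I) \<le> real (2 ^ (2 * m))"
      by (simp only: of_nat_le_iff)
    then show "real (card ?I) \<le> 2 ^ (2 * m)"
      by simp
  qed auto
  also have "\<dots> = (1 / 2) ^ m"
    by (simp only: power_mult power_mult_distrib[symmetric]) (simp add: power2_eq_square power3_eq_cube)
  also have "\<dots> \<le> 1 / 8"
    using m3 by (rule half_power_le_eighth)
  finally have p2: "bprob q H ?P2 \<le> 1 / 8" .
  have "bprob q H (\<lambda>F. ?P1 F \<or> ?P2 F) \<le> bprob q H ?P1 + bprob q H ?P2"
    using q by (intro bprob_disj) auto
  also have "\<dots> < 1"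
    using p1 p2 by linarith
  finally obtain F where F: "F \<subseteq> H" "\<not> (?P1 F \<or> ?P2 F)"
    by (rule bprob_less_1_obtains[OF finH])
  show ?thesis
  proof
    show "F \<subseteq> H" by (rule F(1))
    show "card (F \<inter> Bad S) < \<gamma> * m / 4" if "S \<in> \<S>" for S
      using F(2) that by (auto simp: not_le)
    show "F \<inter> A \<times> B \<noteq> {}" if "A \<subseteq> X" "B \<subseteq> Y" "g \<le> card A" "g \<le> card B" for A B
    proof -
      have "\<not> ?P2 F" using F(2) by blast
      then have "\<forall>i\<in>?I. F \<inter> fst i \<times> snd i \<noteq> {}" by blast
      moreover have "(A, B) \<in> ?I" using that by simp
      ultimately have "F \<inter> fst (A, B) \<times> snd (A, B) \<noteq> {}" by (rule bspec)
      then show ?thesis by simp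
    qed
  qed
qed

end

text \<open>A random set of density \<gamma>/16. Its expected size \<gamma> m / 16 leaves a factor 4
  to the allowed size, and the expected trace on \<open>N u\<close> is at least \<gamma> d / 64, a
  quarter of which is the guaranteed \<gamma> d / 256. The bound 768 = 3 * 256 pays for the union
  over U.\<close>

lemma reserve_exists:
  fixes d \<gamma> :: real
  assumes V: "finite V" "card V = m" "3 \<le> m" and U: "finite U" "card U \<le> m"
    and N: "\<And>u. u \<in> U \<Longrightarrow> N u \<subseteq> V" "\<And>u. u \<in> U \<Longrightarrow> d / 4 \<le> card (N u)"
    and \<gamma>: "0 < \<gamma>" "\<gamma> \<le> 1" and d: "768 * ln (real m) \<le> \<gamma> * d" "d \<le> 2 * m"
  obtains Q where "Q \<subseteq> V" "card Q < \<gamma> * m / 4" "\<And>u. u \<in> U \<Longrightarrow> \<gamma> * d / 256 < card (Q \<inter> N u)"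
proof -
  define q where "q = \<gamma> / 16"
  have q: "0 \<le> q" "q \<le> 1"
    using \<gamma> by (auto simp: q_def)
  have small: "exp (- x) \<le> 1 / real m ^ 3" if "3 * ln (real m) \<le> x" for x
    using that V by (intro exp_neg_le_inverse_cube) auto
  have qN: "\<gamma> * d / 64 \<le> q * card (N u)" if "u \<in> U" for u
    using mult_left_mono[OF N(2)[OF that], of "\<gamma> / 16"] \<gamma> by (simp add: q_def)
  let ?P1 = "\<lambda>F. \<exists>u\<in>U. card (F \<inter> N u) \<le> q * card (N u) / 4"
  let ?P2 = "\<lambda>F. \<gamma> * m / 4 \<le> card (F \<inter> V)"
  have "bprob q V ?P1 \<le> card U * (1 / real m ^ 3)"
  proof (rule bprob_ex_le_card[OF q U(1)])
    fix u assume u: "u \<in> U"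
    have "bprob q V (\<lambda>F. card (F \<inter> N u) \<le> q * card (N u) / 4) \<le> exp (- (q * card (N u) / 4))"
      using V N(1)[OF u] q by (intro bprob_le_quarter) auto
    also have "\<dots> \<le> 1 / real m ^ 3"
      using qN[OF u] d by (intro small) linarith
    finally show "bprob q V (\<lambda>F. card (F \<inter> N u) \<le> q * card (N u) / 4) \<le> 1 / real m ^ 3" .
  qed
  also have "\<dots> \<le> 1 / 9"
    using V U by (intro mult_inverse_cube_le) auto
  finally have p1: "bprob q V ?P1 \<le> 1 / 9" .
  have "bprob q V ?P2 \<le> exp (2 * (q * card V) - \<gamma> * m / 4)"
    using V q by (intro bprob_ge) auto
  also have "\<dots> = exp (- (\<gamma> * m / 8))"
    using V by (simp add: q_def)
  also have "\<dots> \<le> 1 / real m ^ 3"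
  proof (rule small)
    have "\<gamma> * d \<le> \<gamma> * (2 * m)"
      using d \<gamma> by (intro mult_left_mono) auto
    moreover have "0 \<le> ln (real m)"
      using V by simp
    ultimately show "3 * ln (real m) \<le> \<gamma> * m / 8"
      using d by linarith
  qed
  also have "\<dots> \<le> 1 / 9"
    using mult_inverse_cube_le[of m 1] V by simp
  finally have p2: "bprob q V ?P2 \<le> 1 / 9" .
  have "bprob q V (\<lambda>F. ?P1 F \<or> ?P2 F) \<le> bprob q V ?P1 + bprob q V ?P2"
    using q by (intro bprob_disj) auto
  also have "\<dots> < 1"
    using p1 p2 by linarith
  finally obtain F where F: "F \<subseteq> V" "\<not> (?P1 F \<or> ?P2 F)"
    by (rule bprob_less_1_obtains[OF V(1)])
  show ?thesis
  proof
    show "F \<subseteq> V" by (rule F(1))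
    show "card F < \<gamma> * m / 4"
      using F by (auto simp: not_le Int_absorb2)
    show "\<gamma> * d / 256 < card (F \<inter> N u)" if u: "u \<in> U" for u
    proof -
      have "q * card (N u) / 4 < card (F \<inter> N u)"
        using F(2) u by (auto simp: not_le)
      then show ?thesis using qN[OF u] by linarith
    qed
  qed
qed

context bipartite_graph
begin

text \<open>The matching is a union \<open>M0 \<union> M1 \<union> M2\<close>: the isolated edges \<open>M0\<close> of a very sparse random subgraph meet
  every \<open>E v\<close> often; a maximal matching \<open>M1\<close> of a random subgraph of large constant average degree,
  chosen outside of \<open>M0\<close> and of random reserve sets, leaves few vertices uncovered; these
  and the reserved vertices are matched by \<open>M2\<close>. Both random subgraphs contain few edges
  of every \<open>Bad S\<close>, and \<open>M2\<close> is small.\<close>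
lemma spread_perfect_matching:
  fixes L K \<gamma> \<epsilon> \<eta> h :: real
  assumes J: "finite J" "card J \<le> m" and E: "\<And>v. v \<in> J \<Longrightarrow> E v \<subseteq> H" "\<And>v. v \<in> J \<Longrightarrow> L * d \<le> card (E v)"
    and L: "240000 * ln (real m) \<le> L" and d: "768 * ln (real m) \<le> \<gamma> * d" "K \<le> d"
    and \<gamma>: "0 < \<gamma>" "\<gamma> \<le> 1" and \<epsilon>: "exp (12 / \<gamma>) * (K * \<epsilon>) \<le> 1" "0 \<le> \<epsilon>" and K: "1 \<le> K" "3 \<le> K * h"
    and S: "finite \<S>" "card \<S> \<le> 2 ^ m"
    and Bad: "\<And>S. S \<in> \<S> \<Longrightarrow> Bad S \<subseteq> H" "\<And>S. S \<in> \<S> \<Longrightarrow> card (Bad S) \<le> \<epsilon> * d * m"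
    and dense: "\<And>A B. A \<subseteq> X \<Longrightarrow> B \<subseteq> Y \<Longrightarrow> \<gamma> / 4 * m \<le> card A \<Longrightarrow> \<gamma> / 4 * m \<le> card B \<Longrightarrow>
      h * d * m \<le> card (H \<inter> A \<times> B)"
    and hole: "\<And>A B. A \<subseteq> X \<Longrightarrow> B \<subseteq> Y \<Longrightarrow> \<eta> * m \<le> card A \<Longrightarrow> \<eta> * m \<le> card B \<Longrightarrow> H \<inter> A \<times> B \<noteq> {}"
    and left: "\<And>A B. A \<subseteq> X \<Longrightarrow> B \<subseteq> Y \<Longrightarrow> card B < card A \<Longrightarrow> card A \<le> \<eta> * m \<Longrightarrow>
      \<exists>a\<in>A. card (H `` {a} \<inter> B) \<le> \<gamma> * d / 256"
    and right: "\<And>A B. A \<subseteq> X \<Longrightarrow> B \<subseteq> Y \<Longrightarrow> card A < card B \<Longrightarrow> card B \<le> \<eta> * m \<Longrightarrow>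
      \<exists>b\<in>B. card (H\<inverse> `` {b} \<inter> A) \<le> \<gamma> * d / 256"
  obtains M where "M \<subseteq> H" "matching M" "fst ` M = X" "snd ` M = Y"
    "\<And>v. v \<in> J \<Longrightarrow> L / 6400 \<le> card (M \<inter> E v)"
    "\<And>S. S \<in> \<S> \<Longrightarrow> card (M \<inter> Bad S) < \<gamma> * m"
proof -
  have ln0: "0 \<le> ln (real m)" using m3 by simp
  have "\<gamma> * d \<le> 1 * d" using \<gamma> d_pos by (intro mult_right_mono) auto
  then have d24: "24 * ln (real m) \<le> d" using d ln0 by linarith
  have d1: "1 \<le> d" and K0: "0 < K" using d K by linarith+
  obtain M0 where M0: "M0 \<subseteq> H" "matching M0" "\<And>v. v \<in> J \<Longrightarrow> L / 6400 \<le> card (M0 \<inter> E v)"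
    and M0X: "\<And>u. u \<in> X \<Longrightarrow> d / 4 \<le> card (H `` {u} - snd ` M0)"
    and M0Y: "\<And>w. w \<in> Y \<Longrightarrow> d / 4 \<le> card (H\<inverse> `` {w} - fst ` M0)"
    and M0Bad: "\<And>S. S \<in> \<S> \<Longrightarrow> card (M0 \<inter> Bad S) < \<gamma> * m / 4"
    by (rule sparse_matching_exists[OF J E L d24 d1 \<gamma>(1) \<epsilon> K(1) S Bad]) (assumption | rule that)+
  obtain R where R: "R \<subseteq> H" "\<And>S. S \<in> \<S> \<Longrightarrow> card (R \<inter> Bad S) < \<gamma> * m / 4"
    "\<And>A B. A \<subseteq> X \<Longrightarrow> B \<subseteq> Y \<Longrightarrow> \<gamma> / 4 * m \<le> card A \<Longrightarrow> \<gamma> / 4 * m \<le> card B \<Longrightarrow> R \<inter> A \<times> B \<noteq> {}"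
    by (rule dense_sample_exists[OF K0 d(2) K(2) \<gamma>(1) \<epsilon> S Bad dense]) (assumption | rule that)+
  have HX: "H\<inverse> `` {w} \<subseteq> X" and HY: "H `` {u} \<subseteq> Y" for u w
    using H_sub by auto
  obtain QX where QX: "QX \<subseteq> X" "card QX < \<gamma> * m / 4"
    "\<And>w. w \<in> Y \<Longrightarrow> \<gamma> * d / 256 < card (QX \<inter> (H\<inverse> `` {w} - fst ` M0))"
  proof (rule reserve_exists[OF finX cardX m3 finY _ _ M0Y \<gamma> d(1) d_le_2m])
    show "card Y \<le> m" by (simp add: cardY)
    show "H\<inverse> `` {w} - fst ` M0 \<subseteq> X" for w using HX by blast
  qed (assumption | rule that)+
  obtain QY where QY: "QY \<subseteq> Y" "card QY < \<gamma> * m / 4"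
    "\<And>u. u \<in> X \<Longrightarrow> \<gamma> * d / 256 < card (QY \<inter> (H `` {u} - snd ` M0))"
  proof (rule reserve_exists[OF finY cardY m3 finX _ _ M0X \<gamma> d(1) d_le_2m])
    show "card X \<le> m" by (simp add: cardX)
    show "H `` {u} - snd ` M0 \<subseteq> Y" for u using HY by blast
  qed (assumption | rule that)+
  \<comment> \<open>M1 has to avoid M0 and the reserves, so that the reserved neighbours outside M0
    are still free in the final step.\<close>
  define X' where "X' = X - fst ` M0 - QX"
  define Y' where "Y' = Y - snd ` M0 - QY"
  have "finite (R \<inter> X' \<times> Y')"
    using R(1) finH by (auto intro: finite_subset)
  from maximal_matching_exists[OF this] obtain M1 where M1: "M1 \<subseteq> R \<inter> X' \<times> Y'" "matching M1"
    "R \<inter> X' \<times> Y' \<inter> (- fst ` M1) \<times> (- snd ` M1) = {}"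
    by blast
  define N where "N = M0 \<union> M1"
  have sub: "M0 \<subseteq> X \<times> Y" "M1 \<subseteq> X' \<times> Y'" "M1 \<subseteq> H"
    using M0(1) M1(1) R(1) H_sub by auto
  have "fst ` M1 \<subseteq> X'" "snd ` M1 \<subseteq> Y'"
    using sub(2) by auto
  then have disj: "fst ` M0 \<inter> fst ` M1 = {}" "snd ` M0 \<inter> snd ` M1 = {}"
    by (auto simp: X'_def Y'_def)
  have N: "N \<subseteq> H" "matching N"
    unfolding N_def using M0 M1(2) sub(3) disj by (auto intro!: matching_Un)
  have finN: "finite N"
    using N(1) finH by (rule finite_subset)
  define X2 where "X2 = X - fst ` N"
  define Y2 where "Y2 = Y - snd ` N"
  have NX: "fst ` N \<subseteq> X" and NY: "snd ` N \<subseteq> Y"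
    using N(1) H_sub by auto
  have card2: "card X2 = card Y2"
  proof -
    have "card X2 = m - card N" "card Y2 = m - card N"
      using N(2) finN NX NY cardX cardY unfolding X2_def Y2_def matching_def
      by (auto simp: card_Diff_subset card_image)
    then show ?thesis by simp
  qed
  have X2X: "X2 \<subseteq> X" and Y2Y: "Y2 \<subseteq> Y"
    by (auto simp: X2_def Y2_def)
  have fin2: "finite X2" "finite Y2"
    using X2X Y2Y finX finY by (auto intro: finite_subset)
  \<comment> \<open>Each leftover vertex has more than \<gamma> d / 256 leftover neighbours, all
    reserved ones outside M0; \<open>left\<close> and \<open>right\<close> forbid small
    non-expanding sets with such degrees.\<close>
  have "\<exists>M\<subseteq>H \<inter> X2 \<times> Y2. matching M \<and> fst ` M = X2 \<and> snd ` M = Y2"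
  proof (rule expander_perfect_matching[where g = "\<eta> * m"])
    fix A B assume A: "A \<subseteq> X2" and B: "B \<subseteq> Y2" and AB: "(H \<inter> X2 \<times> Y2) `` A \<subseteq> B" "card B < card A" "card A \<le> \<eta> * m"
    obtain a where a: "a \<in> A" "card (H `` {a} \<inter> B) \<le> \<gamma> * d / 256"
      using left[OF _ _ AB(2,3)] A B X2X Y2Y by blast
    have "QY \<inter> (H `` {a} - snd ` M0) \<subseteq> H `` {a} \<inter> B"
    proof -
      have "QY \<inter> (H `` {a} - snd ` M0) \<subseteq> Y2"
        using QY(1) \<open>snd ` M1 \<subseteq> Y'\<close> by (auto simp: Y2_def N_def Y'_def)
      then show ?thesis
        using AB(1) a(1) A by blast
    qed
    then have "card (QY \<inter> (H `` {a} - snd ` M0)) \<le> card (H `` {a} \<inter> B)"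
      using finH by (intro card_mono) auto
    then show False
      using QY(3)[of a] a A X2X by force
  next
    fix A B assume A: "A \<subseteq> X2" and B: "B \<subseteq> Y2" and AB: "(H \<inter> X2 \<times> Y2)\<inverse> `` B \<subseteq> A" "card A < card B" "card B \<le> \<eta> * m"
    obtain b where b: "b \<in> B" "card (H\<inverse> `` {b} \<inter> A) \<le> \<gamma> * d / 256"
      using right[OF _ _ AB(2,3)] A B X2X Y2Y by blast
    have "QX \<inter> (H\<inverse> `` {b} - fst ` M0) \<subseteq> H\<inverse> `` {b} \<inter> A"
    proof -
      have "QX \<inter> (H\<inverse> `` {b} - fst ` M0) \<subseteq> X2"
        using QX(1) \<open>fst ` M1 \<subseteq> X'\<close> by (auto simp: X2_def N_def X'_def)
      then show ?thesis
        using AB(1) b(1) B by blast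
    qed
    then have "card (QX \<inter> (H\<inverse> `` {b} - fst ` M0)) \<le> card (H\<inverse> `` {b} \<inter> A)"
      using finH by (intro card_mono) auto
    then show False
      using QX(3)[of b] b B Y2Y by force
  next
    fix A B assume A: "A \<subseteq> X2" and B: "B \<subseteq> Y2" and AB: "\<eta> * m \<le> card A" "\<eta> * m \<le> card B"
    have "H \<inter> A \<times> B \<noteq> {}"
      using A B AB X2X Y2Y by (intro hole) auto
    then show "H \<inter> X2 \<times> Y2 \<inter> A \<times> B \<noteq> {}"
      using A B by blast
  qed (use fin2 card2 in auto)
  then obtain M2 where M2: "M2 \<subseteq> H" "matching M2" "fst ` M2 = X2" "snd ` M2 = Y2" by blast
  have cardM2: "card M2 < \<gamma> * m / 2"
  proof -
    have "card M2 = card X2"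
      using M2(2,3) by (metis card_image matching_def)
    moreover have "card X2 < \<gamma> * m / 2"
    proof (rule ccontr)
      \<comment> \<open>Even without the reserves, both leftover sides would have size at least
        \<gamma> m / 4. R then has an edge between them, contradicting maximality of M1.\<close>
      assume big: "\<not> card X2 < \<gamma> * m / 2"
      have "X2 \<subseteq> QX \<union> (X' - fst ` M1)" "Y2 \<subseteq> QY \<union> (Y' - snd ` M1)"
        by (auto simp: X2_def X'_def Y2_def Y'_def N_def)
      then have "card X2 \<le> card (QX \<union> (X' - fst ` M1))" "card Y2 \<le> card (QY \<union> (Y' - snd ` M1))"
        using finX finY QX(1) QY(1) by (auto simp: X'_def Y'_def intro!: card_mono intro: finite_subset)
      then have "card X2 \<le> card QX + card (X' - fst ` M1)" "card Y2 \<le> card QY + card (Y' - snd ` M1)"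
        using card_Un_le order_trans by blast+
      then have "\<gamma> / 4 * m \<le> card (X' - fst ` M1)" "\<gamma> / 4 * m \<le> card (Y' - snd ` M1)"
        using big QX(2) QY(2) card2 by linarith+
      then have "R \<inter> (X' - fst ` M1) \<times> (Y' - snd ` M1) \<noteq> {}"
        by (intro R(3)) (auto simp: X'_def Y'_def)
      then show False
        using M1(3) by blast
    qed
    ultimately show ?thesis by simp
  qed
  define M where "M = N \<union> M2"
  have finM: "finite M" "finite M0" "finite R" "finite M2"
    using N(1) M2(1) M0(1) R(1) finH by (auto simp: M_def intro: finite_subset)
  show ?thesis
  proof
    show "M \<subseteq> H" using N(1) M2(1) by (auto simp: M_def)
    show "matching M"
      unfolding M_def using N(2) M2 by (intro matching_Un) (auto simp: X2_def Y2_def)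
    show "fst ` M = X" "snd ` M = Y"
      using NX NY M2 by (auto simp: M_def image_Un X2_def Y2_def)
    show "L / 6400 \<le> card (M \<inter> E v)" if "v \<in> J" for v
    proof -
      have "card (M0 \<inter> E v) \<le> card (M \<inter> E v)"
        using finM by (intro card_mono) (auto simp: M_def N_def)
      then show ?thesis
        using M0(3)[OF that] by linarith
    qed
    show "card (M \<inter> Bad S) < \<gamma> * m" if "S \<in> \<S>" for S
    proof -
      \<comment> \<open>M1 is covered by R and M2 is counted in full: \<gamma>/4 + \<gamma>/4 +
        \<gamma>/2 = \<gamma>.\<close>
      have "M \<inter> Bad S \<subseteq> (M0 \<inter> Bad S) \<union> (R \<inter> Bad S) \<union> M2"
        using M1(1) by (auto simp: M_def N_def)
      then have "card (M \<inter> Bad S) \<le> card ((M0 \<inter> Bad S) \<union> (R \<inter> Bad S) \<union> M2)"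
        using finM by (intro card_mono) auto
      also have "\<dots> \<le> card (M0 \<inter> Bad S) + card (R \<inter> Bad S) + card M2"
        by (meson card_Un_le add_right_mono order_trans)
      finally show ?thesis
        using M0Bad[OF that] R(2)[OF that] cardM2 by linarith
    qed
  qed
qed

end

subsection \<open>Strong super-regular triples\<close>

lemma adj_commute: "adj G u v \<longleftrightarrow> adj G v u"
  by (auto simp: adj_def insert_commute)

lemma mem_nbhd_iff: "u \<in> nbhd G v \<longleftrightarrow> adj G u v"
  by (simp add: nbhd_def adj_commute[of G v])

lemma e_count_eq_sum:
  assumes "finite X" "finite Y"
  shows "e_count G X Y = (\<Sum>x\<in>X. card (nbhd G x \<inter> Y))"
proof -
  have "{(x, y). x \<in> X \<and> y \<in> Y \<and> adj G x y} = Sigma X (\<lambda>x. nbhd G x \<inter> Y)"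
    by (auto simp: nbhd_def)
  then show ?thesis
    using assms by (simp add: e_count_def)
qed

lemma e_count_commute: "e_count G X Y = e_count G Y X"
proof -
  have "{(x, y). x \<in> X \<and> y \<in> Y \<and> adj G x y} = prod.swap ` {(y, x). y \<in> Y \<and> x \<in> X \<and> adj G y x}"
    by (auto simp: adj_commute)
  then show ?thesis
    by (simp add: e_count_def card_image)
qed

lemma dens_commute: "dens G X Y = dens G Y X"
  by (simp add: dens_def e_count_commute[of G X] mult.commute)

lemma e_count_eq_dens:
  assumes "finite X" "finite Y"
  shows "e_count G X Y = dens G X Y * (card X * card Y)"
proof (cases "X = {} \<or> Y = {}")
  case True
  then have "e_count G X Y = 0"
    by (auto simp: e_count_def)
  then show ?thesis
    using True by auto
qed (use assms in \<open>auto simp: dens_def\<close>)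

lemma dens_nonneg: "0 \<le> dens G X Y"
  by (simp add: dens_def)

text \<open>If W had more than \<epsilon> |Y| vertices, regularity would apply to (A, W), whose
  density is too small by averaging over W.\<close>

lemma regular_few_low_degree:
  fixes \<epsilon> p :: real
  assumes reg: "regular_pair G \<epsilon> p X Y" and fin: "finite X" "finite Y"
    and A: "A \<subseteq> X" "\<epsilon> * card X \<le> card A" and \<epsilon>: "0 < \<epsilon>"
    and W: "W \<subseteq> Y" "\<And>w. w \<in> W \<Longrightarrow> card (nbhd G w \<inter> A) < (dens G X Y - \<epsilon> * p) * card A"
  shows "card W \<le> \<epsilon> * card Y"
proof (rule ccontr)
  assume "\<not> ?thesis"
  then have big: "\<epsilon> * card Y < card W" by simp
  moreover have "0 \<le> \<epsilon> * card Y" using \<epsilon> by simp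
  ultimately have "0 < card W" by linarith
  then have ne: "W \<noteq> {}" "finite W" by (auto simp: card_gt_0_iff)
  have finA: "finite A" using A fin by (auto intro: finite_subset)
  have "A \<noteq> {}"
    using W(2) ne(1) by fastforce
  then have Apos: "0 < card A" using finA by (simp add: card_gt_0_iff)
  have "real (e_count G A W) = (\<Sum>w\<in>W. real (card (nbhd G w \<inter> A)))"
    using finA ne by (simp add: e_count_commute[of G A] e_count_eq_sum)
  also have "\<dots> < (\<Sum>w\<in>W. (dens G X Y - \<epsilon> * p) * card A)"
    using ne W(2) by (intro sum_strict_mono) auto
  finally have "dens G A W < dens G X Y - \<epsilon> * p"
    using Apos \<open>0 < card W\<close> by (simp add: dens_def divide_simps mult_ac)
  moreover have "\<bar>dens G X Y - dens G A W\<bar> \<le> \<epsilon> * p"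
    using reg A W(1) big unfolding regular_pair_def by auto
  ultimately show False by linarith
qed

text \<open>\<open>regular_few_low_degree\<close> is applied inside the regular pair (A, B) that
  typicality provides in the neighbourhoods of u. Replacing \<open>nbhd G u \<inter> S\<close> by
  its part in A loses up to an \<epsilon>-fraction of \<open>nbhd G u \<inter> V\<close>, hence the
  subtracted term; the second \<epsilon> in the bound pays for neighbours outside B.\<close>

lemma typical_few_low_codegree:
  fixes \<epsilon> p :: real
  assumes typ_u: "typical G \<epsilon> p U V W u" and fin: "finite V" "finite W"
    and S: "S \<subseteq> V" "2 * \<epsilon> * card (nbhd G u \<inter> V) \<le> card (nbhd G u \<inter> S)"
    and \<epsilon>: "0 < \<epsilon>" "\<epsilon> * p \<le> (1 - \<epsilon>) * dens G V W"
  shows "card {w \<in> nbhd G u \<inter> W. card (nbhd G u \<inter> nbhd G w \<inter> S)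
      < ((1 - \<epsilon>) * dens G V W - \<epsilon> * p) * (card (nbhd G u \<inter> S) - \<epsilon> * card (nbhd G u \<inter> V))}
    \<le> 2 * \<epsilon> * card (nbhd G u \<inter> W)"
proof -
  let ?N = "nbhd G u \<inter> V" and ?N' = "nbhd G u \<inter> W"
  let ?k = "(1 - \<epsilon>) * dens G V W - \<epsilon> * p"
  let ?t = "real (card (nbhd G u \<inter> S)) - \<epsilon> * card ?N"
  let ?Bad = "{w \<in> ?N'. card (nbhd G u \<inter> nbhd G w \<inter> S) < ?k * ?t}"
  obtain A B where A: "A \<subseteq> ?N" "(1 - \<epsilon>) * card ?N \<le> card A" and B: "B \<subseteq> ?N'" "(1 - \<epsilon>) * card ?N' \<le> card B"
    and reg: "regular_pair G \<epsilon> p A B" and dens: "(1 - \<epsilon>) * dens G V W \<le> dens G A B"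
    using typ_u unfolding typical_def Let_def approx_eq_def by blast
  have finA: "finite A" "finite B" "finite S"
    using A(1) B(1) S(1) fin by (auto intro: finite_subset)
  have "card (nbhd G u \<inter> S) \<le> card ((A \<inter> S) \<union> (?N - A))"
    using S(1) fin finA by (intro card_mono) auto
  also have "\<dots> \<le> card (A \<inter> S) + card (?N - A)"
    by (rule card_Un_le)
  also have "card (?N - A) = card ?N - card A"
    using A(1) finA by (intro card_Diff_subset) auto
  finally have t: "?t \<le> card (A \<inter> S)"
    using A(2) card_mono[of ?N A] A(1) fin by (simp add: algebra_simps of_nat_diff)
  have "card (?Bad \<inter> B) \<le> \<epsilon> * card B"
  proof (rule regular_few_low_degree[OF reg])
    have "\<epsilon> * card A \<le> \<epsilon> * card ?N"
      using A(1) fin \<epsilon> by (intro mult_left_mono) (auto intro: card_mono)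
    then show "\<epsilon> * card A \<le> card (A \<inter> S)"
      using S(2) t by linarith
    fix w assume w: "w \<in> ?Bad \<inter> B"
    have "card (nbhd G w \<inter> (A \<inter> S)) \<le> card (nbhd G u \<inter> nbhd G w \<inter> S)"
      using A(1) finA by (intro card_mono) auto
    then have "card (nbhd G w \<inter> (A \<inter> S)) < ?k * ?t"
      using w by auto
    also have "\<dots> \<le> ?k * card (A \<inter> S)"
      using t \<epsilon> by (intro mult_left_mono) auto
    also have "\<dots> \<le> (dens G A B - \<epsilon> * p) * card (A \<inter> S)"
      using dens by (intro mult_right_mono) auto
    finally show "card (nbhd G w \<inter> (A \<inter> S)) < (dens G A B - \<epsilon> * p) * card (A \<inter> S)" .
  qed (use finA \<epsilon> in auto)
  moreover have "\<epsilon> * card B \<le> \<epsilon> * card ?N'"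
    using B(1) fin \<epsilon> by (intro mult_left_mono) (auto intro: card_mono)
  moreover have "card ?Bad \<le> card (?Bad \<inter> B) + card (?N' - B)"
  proof -
    have "card ?Bad \<le> card ((?Bad \<inter> B) \<union> (?N' - B))"
      using fin finA by (intro card_mono) auto
    then show ?thesis
      using card_Un_le order_trans by blast
  qed
  moreover have "card (?N' - B) = card ?N' - card B"
    using B(1) finA by (intro card_Diff_subset) auto
  moreover have "card B \<le> card ?N'"
    using B(1) fin by (intro card_mono) auto
  ultimately show ?thesis
    using B(2) by (simp add: algebra_simps of_nat_diff)
qed

text \<open>The bound \<epsilon> \<le> \<delta>/16 makes the error \<epsilon> p at most a sixteenth
  of each of the three densities, so that every estimate below loses only factors such as
  15/16.\<close>

locale strong_triple =
  fixes G :: "nat set set" and V1 V2 V3 :: "nat set" and p \<delta> \<epsilon> :: real and m :: nat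
  assumes fin: "finite V1" "finite V2" "finite V3"
    and card_eq: "card V1 = m" "card V2 = m" "card V3 = m"
    and p_pos: "0 < p" and \<delta>: "0 < \<delta>" "\<delta> \<le> 1" and \<epsilon>: "0 < \<epsilon>" "\<epsilon> \<le> \<delta> / 16"
    and strong: "strong_super_regular G \<delta> \<epsilon> p V1 V2 V3"
begin

abbreviation "D12 \<equiv> dens G V1 V2"
abbreviation "D13 \<equiv> dens G V1 V3"
abbreviation "D23 \<equiv> dens G V2 V3"

text \<open>The edges between \<open>V2\<close> and \<open>V3\<close> that are \<open>1/2\<close>-good.\<close>
definition H :: "(nat \<times> nat) set" where
  "H = {(u, w). u \<in> V2 \<and> w \<in> V3 \<and> adj G u w \<and> D12 * D13 * m / 2 \<le> card (nbhd G u \<inter> nbhd G w \<inter> V1)}"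

text \<open>These are the sets \<open>E v\<close> for \<open>spread_perfect_matching\<close>: an
  edge of the link of v closes a triangle with v.\<close>

definition link :: "nat \<Rightarrow> (nat \<times> nat) set" where
  "link v = {(u, w) \<in> H. u \<in> nbhd G v \<and> w \<in> nbhd G v}"

text \<open>These are the sets \<open>Bad S\<close> for \<open>spread_perfect_matching\<close>: the
  edges of a matching in H that no vertex of S can be joined to.\<close>

definition missed :: "nat set \<Rightarrow> (nat \<times> nat) set" where
  "missed S = {(u, w) \<in> H. nbhd G u \<inter> nbhd G w \<inter> S = {}}"

lemma regular: "regular_pair G \<epsilon> p V1 V2" "regular_pair G \<epsilon> p V2 V3"
  using strong by (auto simp: strong_super_regular_def super_regular_def)

lemma dens_ge: "\<delta> * p \<le> D12" "\<delta> * p \<le> D13" "\<delta> * p \<le> D23"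
  using strong by (auto simp: strong_super_regular_def super_regular_def)

lemma dens_pos: "0 < D12" "0 < D13" "0 < D23"
  using dens_ge p_pos \<delta>(1) by (auto intro: less_le_trans[OF mult_pos_pos])

lemma eps_p_le: "\<epsilon> * p \<le> D12 / 16" "\<epsilon> * p \<le> D13 / 16" "\<epsilon> * p \<le> D23 / 16"
proof -
  have "\<epsilon> * p \<le> \<delta> / 16 * p"
    using \<epsilon> p_pos by (intro mult_right_mono) auto
  then show "\<epsilon> * p \<le> D12 / 16" "\<epsilon> * p \<le> D13 / 16" "\<epsilon> * p \<le> D23 / 16"
    using dens_ge by linarith+
qed

lemma eps_le: "\<epsilon> \<le> 1 / 16"
  using \<epsilon> \<delta> by linarith

lemma low_dens: "15 / 16 * x \<le> (1 - \<epsilon>) * x" if "0 \<le> x"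
  using eps_le that by (intro mult_right_mono) auto

lemma high_dens: "(1 + \<epsilon>) * x \<le> 2 * x" if "0 \<le> x"
  using eps_le that by (intro mult_right_mono) auto

lemma typical:
  "v \<in> V1 \<Longrightarrow> typical G \<epsilon> p V1 V2 V3 v" "v \<in> V2 \<Longrightarrow> typical G \<epsilon> p V2 V1 V3 v"
  "v \<in> V3 \<Longrightarrow> typical G \<epsilon> p V3 V1 V2 v"
  using strong by (auto simp: strong_super_regular_def super_regular_def)

lemma nbhd_card:
  assumes "typical G \<epsilon> p U V W u" "card V = m"
  shows "15 / 16 * (dens G U V * m) \<le> card (nbhd G u \<inter> V)" "card (nbhd G u \<inter> V) \<le> 2 * (dens G U V * m)"
proof -
  have "approx_eq (card (nbhd G u \<inter> V)) \<epsilon> (dens G U V * m)"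
    using assms by (auto simp: typical_def Let_def)
  then show "15 / 16 * (dens G U V * m) \<le> card (nbhd G u \<inter> V)" "card (nbhd G u \<inter> V) \<le> 2 * (dens G U V * m)"
    using low_dens[of "dens G U V * m"] high_dens[of "dens G U V * m"] dens_nonneg[of G U V]
    unfolding approx_eq_def by auto
qed

lemma nbhd_card_snd:
  assumes "typical G \<epsilon> p U V W u" "card W = m"
  shows "15 / 16 * (dens G U W * m) \<le> card (nbhd G u \<inter> W)" "card (nbhd G u \<inter> W) \<le> 2 * (dens G U W * m)"
proof -
  have "approx_eq (card (nbhd G u \<inter> W)) \<epsilon> (dens G U W * m)"
    using assms by (auto simp: typical_def Let_def)
  then show "15 / 16 * (dens G U W * m) \<le> card (nbhd G u \<inter> W)" "card (nbhd G u \<inter> W) \<le> 2 * (dens G U W * m)"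
    using low_dens[of "dens G U W * m"] high_dens[of "dens G U W * m"] dens_nonneg[of G U W]
    unfolding approx_eq_def by auto
qed

text \<open>The case S = V1 of the codegree lemma; its threshold is at least 7/8 * (15/16)^2 > 1/2
  of the expected codegree. With u on either side it shows that passing to H costs each vertex at
  most a 2\<epsilon>-fraction of its degree.\<close>

lemma few_non_good:
  assumes typ_u: "typical G \<epsilon> p U V1 W u" and W: "card W = m" "finite W"
    and dens: "\<epsilon> * p \<le> dens G V1 W / 16"
  shows "card {w \<in> nbhd G u \<inter> W. card (nbhd G u \<inter> nbhd G w \<inter> V1) < dens G U V1 * dens G V1 W * m / 2}
    \<le> 2 * \<epsilon> * card (nbhd G u \<inter> W)" (is "real (card ?L) \<le> _")
proof -
  let ?R = "{w \<in> nbhd G u \<inter> W. card (nbhd G u \<inter> nbhd G w \<inter> V1)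
      < ((1 - \<epsilon>) * dens G V1 W - \<epsilon> * p) * (card (nbhd G u \<inter> V1) - \<epsilon> * card (nbhd G u \<inter> V1))}"
  let ?N = "real (card (nbhd G u \<inter> V1))"
  have low: "15 / 16 * dens G V1 W \<le> (1 - \<epsilon>) * dens G V1 W"
    by (intro low_dens dens_nonneg)
  have d0: "0 \<le> dens G V1 W" "0 \<le> dens G U V1 * m"
    by (simp_all add: dens_nonneg)
  have "card ?R \<le> 2 * \<epsilon> * card (nbhd G u \<inter> W)"
  proof (rule typical_few_low_codegree[OF typ_u fin(1) W(2) order_refl])
    show "2 * \<epsilon> * card (nbhd G u \<inter> V1) \<le> card (nbhd G u \<inter> V1)"
      using eps_le mult_right_mono[of "2 * \<epsilon>" 1 ?N] by simp
    show "0 < \<epsilon>" by (rule \<epsilon>(1))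
    show "\<epsilon> * p \<le> (1 - \<epsilon>) * dens G V1 W"
      using low dens d0 by linarith
  qed
  moreover have "?L \<subseteq> ?R"
  proof -
    have "dens G U V1 * dens G V1 W * m / 2 \<le> (7 / 8 * dens G V1 W) * (15 / 16 * (15 / 16 * (dens G U V1 * m)))"
      using mult_nonneg_nonneg[OF d0] by (simp add: mult_ac)
    also have "\<dots> \<le> ((1 - \<epsilon>) * dens G V1 W - \<epsilon> * p) * (15 / 16 * ?N)"
      using low dens d0 nbhd_card(1)[OF typ_u card_eq(1)] by (intro mult_mono) auto
    also have "\<dots> \<le> ((1 - \<epsilon>) * dens G V1 W - \<epsilon> * p) * ((1 - \<epsilon>) * ?N)"
      using low dens d0 by (intro mult_left_mono low_dens) auto
    finally show ?thesis
      by (auto simp: algebra_simps)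
  qed
  then have "card ?L \<le> card ?R"
    using W(2) by (intro card_mono) auto
  ultimately show ?thesis by linarith
qed

lemma H_sub: "H \<subseteq> V2 \<times> V3"
  by (auto simp: H_def)

lemma finH: "finite H"
  using H_sub fin by (auto intro: finite_subset)

lemma H_Image: "u \<in> V2 \<Longrightarrow> H `` {u} = {w \<in> nbhd G u \<inter> V3. \<not> card (nbhd G u \<inter> nbhd G w \<inter> V1) < D12 * D13 * m / 2}"
  by (auto simp: H_def nbhd_def not_less)

lemma H_converse_Image: "w \<in> V3 \<Longrightarrow> H\<inverse> `` {w} = {u \<in> nbhd G w \<inter> V2. \<not> card (nbhd G w \<inter> nbhd G u \<inter> V1) < D13 * D12 * m / 2}"
  by (auto simp: H_def mem_nbhd_iff not_less Int_commute[of "nbhd G w"] mult.commute[of D13])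

lemma non_good_at_V2:
  assumes "u \<in> V2"
  shows "card (nbhd G u \<inter> V3 - H `` {u}) \<le> 2 * \<epsilon> * card (nbhd G u \<inter> V3)"
proof -
  have "nbhd G u \<inter> V3 - H `` {u} = {w \<in> nbhd G u \<inter> V3. card (nbhd G u \<inter> nbhd G w \<inter> V1) < D12 * D13 * m / 2}"
    unfolding H_Image[OF assms] by auto
  then show ?thesis
    using few_non_good[OF typical(2)[OF assms] card_eq(3) fin(3) eps_p_le(2)] by (simp add: dens_commute[of G V2])
qed

lemma non_good_at_V3:
  assumes "w \<in> V3"
  shows "card (nbhd G w \<inter> V2 - H\<inverse> `` {w}) \<le> 2 * \<epsilon> * card (nbhd G w \<inter> V2)"
proof -
  have "nbhd G w \<inter> V2 - H\<inverse> `` {w} = {u \<in> nbhd G w \<inter> V2. card (nbhd G w \<inter> nbhd G u \<inter> V1) < D13 * D12 * m / 2}"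
    unfolding H_converse_Image[OF assms] by auto
  then show ?thesis
    using few_non_good[OF typical(3)[OF assms] card_eq(2) fin(2) eps_p_le(1)] by (simp add: dens_commute[of G V3])
qed

lemma degree_bounds:
  fixes x :: real
  assumes "finite N" "A \<subseteq> N" "card (N - A) \<le> 2 * \<epsilon> * card N" "15 / 16 * x \<le> card N" "card N \<le> 2 * x" "0 \<le> x"
  shows "x / 2 \<le> card A" "card A \<le> 2 * x"
proof -
  have "2 * \<epsilon> * card N \<le> 1 / 8 * card N"
    using eps_le by (intro mult_right_mono) auto
  moreover have "card (N - A) = card N - card A" "card A \<le> card N"
    using assms by (auto intro: card_Diff_subset card_mono finite_subset)
  ultimately show "x / 2 \<le> card A" "card A \<le> 2 * x"
    using assms by linarith+
qed

lemma bipartite_graph_H: "3 \<le> m \<Longrightarrow> bipartite_graph V2 V3 H (D23 * m) m"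
proof
  show "D23 * m / 2 \<le> card (H `` {u})" "card (H `` {u}) \<le> 2 * (D23 * m)" if u: "u \<in> V2" for u
    using degree_bounds[OF _ _ non_good_at_V2[OF u] nbhd_card_snd[OF typical(2)[OF u] card_eq(3)]] fin dens_pos u
    by (auto simp: H_Image)
  show "D23 * m / 2 \<le> card (H\<inverse> `` {w})" "card (H\<inverse> `` {w}) \<le> 2 * (D23 * m)" if w: "w \<in> V3" for w
    using degree_bounds[OF _ _ non_good_at_V3[OF w] nbhd_card_snd[OF typical(3)[OF w] card_eq(2)]] fin dens_pos w
    by (auto simp: H_converse_Image dens_commute[of G V3])
qed (use fin card_eq H_sub dens_pos in auto)

text \<open>Regularity gives at least 15/16 of \<eta>^2 \<open>D23\<close> m^2 edges between A and
  B, and at most 4 \<epsilon> \<open>D23\<close> m^2 edges in all are not in H. The latter is at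
  most a quarter of the main term because 16 \<epsilon> \<le> \<eta>^2.\<close>

lemma card_H_Int_ge:
  fixes \<eta> :: real
  assumes AB: "A \<subseteq> V2" "B \<subseteq> V3" and \<eta>: "0 < \<eta>" "16 * \<epsilon> \<le> \<eta>\<^sup>2" "\<epsilon> \<le> \<eta>" "\<eta> * m \<le> card A" "\<eta> * m \<le> card B"
  shows "\<eta>\<^sup>2 / 2 * (D23 * m) * m \<le> card (H \<inter> A \<times> B)"
proof -
  have finAB: "finite A" "finite B"
    using AB fin by (auto intro: finite_subset)
  have "\<epsilon> * m \<le> \<eta> * m"
    using \<eta> by (intro mult_right_mono) auto
  then have "\<bar>D23 - dens G A B\<bar> \<le> \<epsilon> * p"
    using regular(2) AB \<eta> card_eq unfolding regular_pair_def by auto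
  then have dAB: "15 / 16 * D23 \<le> dens G A B"
    using eps_p_le(3) by linarith
  have e: "15 / 16 * D23 * (\<eta> * m * (\<eta> * m)) \<le> e_count G A B"
  proof -
    have "15 / 16 * D23 * (\<eta> * m * (\<eta> * m)) \<le> dens G A B * (card A * card B)"
      using dAB \<eta> dens_pos by (simp only: of_nat_mult) (intro mult_mono, auto)
    then show ?thesis
      using e_count_eq_dens[OF finAB] by simp
  qed
  let ?bad = "Sigma V2 (\<lambda>u. nbhd G u \<inter> V3 - H `` {u})"
  have "{(x, y). x \<in> A \<and> y \<in> B \<and> adj G x y} \<subseteq> (H \<inter> A \<times> B) \<union> ?bad"
    using AB by (auto simp: nbhd_def)
  then have "e_count G A B \<le> card ((H \<inter> A \<times> B) \<union> ?bad)"
    unfolding e_count_def using fin finH by (intro card_mono) auto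
  also have "\<dots> \<le> card (H \<inter> A \<times> B) + card ?bad"
    by (rule card_Un_le)
  finally have "real (e_count G A B) \<le> card (H \<inter> A \<times> B) + real (card ?bad)"
    by linarith
  moreover have "card ?bad \<le> 4 * \<epsilon> * (D23 * m) * m"
  proof -
    have "real (card ?bad) = (\<Sum>u\<in>V2. real (card (nbhd G u \<inter> V3 - H `` {u})))"
      using fin by simp
    also have "\<dots> \<le> (\<Sum>u\<in>V2. 2 * \<epsilon> * (2 * (D23 * m)))"
    proof (rule sum_mono)
      fix u assume u: "u \<in> V2"
      have "2 * \<epsilon> * card (nbhd G u \<inter> V3) \<le> 2 * \<epsilon> * (2 * (D23 * m))"
        using nbhd_card_snd(2)[OF typical(2)[OF u] card_eq(3)] \<epsilon> by (intro mult_left_mono) auto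
      then show "card (nbhd G u \<inter> V3 - H `` {u}) \<le> 2 * \<epsilon> * (2 * (D23 * m))"
        using non_good_at_V2[OF u] by linarith
    qed
    finally show ?thesis
      using card_eq by (simp add: mult_ac)
  qed
  moreover have "4 * \<epsilon> * (D23 * m) * m \<le> \<eta>\<^sup>2 / 4 * (D23 * m) * m"
    using \<eta> dens_pos by (intro mult_right_mono) auto
  moreover have "(15 / 16 - 1 / 4 - 1 / 2) * (D23 * (\<eta> * m * (\<eta> * m))) \<ge> 0"
    using \<eta> dens_pos by (intro mult_nonneg_nonneg) auto
  ultimately show ?thesis
    using e by (simp add: power2_eq_square mult_ac)
qed

text \<open>At most \<epsilon> m vertices u have few neighbours in S, and they carry at most 2
  \<epsilon> \<open>D23\<close> m^2 edges. Any other u has so many neighbours in S that, by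
  typicality, a common neighbour there is absent for only 4 \<epsilon> \<open>D23\<close> m vertices
  w.\<close>

lemma card_missed_le:
  fixes \<gamma> :: real
  assumes S: "S \<subseteq> V1" "\<gamma> * m \<le> card S" and \<gamma>: "0 < \<gamma>" "8 * \<epsilon> \<le> \<gamma>" and m: "0 < m"
  shows "card (missed S) \<le> 6 * \<epsilon> * (D23 * m) * m"
proof -
  let ?U = "{u \<in> V2. card (nbhd G u \<inter> S) < (D12 - \<epsilon> * p) * card S}"
  let ?f = "\<lambda>u. {w \<in> nbhd G u \<inter> V3. nbhd G u \<inter> nbhd G w \<inter> S = {}}"
  have finU: "finite ?U" "?U \<subseteq> V2" using fin by auto
  have "\<epsilon> * m \<le> \<gamma> * m"
    using \<gamma> \<epsilon> by (intro mult_right_mono) auto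
  then have "\<epsilon> * card V1 \<le> card S"
    using S(2) card_eq(1) by simp
  then have cU: "card ?U \<le> \<epsilon> * m"
    using regular_few_low_degree[OF regular(1) fin(1,2) S(1) _ \<epsilon>(1) finU(2)] card_eq(2) by simp
  have f_le: "card (?f u) \<le> 4 * \<epsilon> * (D23 * m)" if u: "u \<in> V2" "u \<notin> ?U" for u
  proof -
    let ?N = "nbhd G u \<inter> V1"
    have N: "card ?N \<le> 2 * (D12 * m)"
      using nbhd_card(2)[OF typical(2)[OF u(1)] card_eq(1)] by (simp add: dens_commute[of G V2])
    have pos: "0 < D12 * m" using dens_pos m by simp
    have "15 / 16 * D12 * (\<gamma> * m) \<le> (D12 - \<epsilon> * p) * card S"
      using S eps_p_le(1) \<gamma> dens_pos by (intro mult_mono) auto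
    also have "\<dots> \<le> card (nbhd G u \<inter> S)"
      using u by (simp add: not_less)
    finally have NS: "15 / 16 * \<gamma> * (D12 * m) \<le> card (nbhd G u \<inter> S)"
      by (simp add: mult_ac)
    have eN: "2 * \<epsilon> * card ?N \<le> 2 * \<epsilon> * (2 * (D12 * m))"
      using N \<epsilon> by (intro mult_left_mono) auto
    have "4 * \<epsilon> * (D12 * m) \<le> \<gamma> / 2 * (D12 * m)"
      using \<gamma> pos by (intro mult_right_mono) auto
    moreover have gpos: "0 < \<gamma> * (D12 * m)" using \<gamma> pos by simp
    ultimately have le: "2 * \<epsilon> * card ?N \<le> card (nbhd G u \<inter> S)" and lt: "2 * \<epsilon> * card ?N < card (nbhd G u \<inter> S)"
      using NS eN by linarith+
    have low: "15 / 16 * D13 \<le> (1 - \<epsilon>) * D13"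
      by (intro low_dens dens_nonneg)
    have k: "0 < (1 - \<epsilon>) * D13 - \<epsilon> * p"
      using low eps_p_le(2) dens_pos by linarith
    have "0 \<le> \<epsilon> * card ?N"
      using \<epsilon> by simp
    then have "0 < ((1 - \<epsilon>) * D13 - \<epsilon> * p) * (card (nbhd G u \<inter> S) - \<epsilon> * card ?N)"
      using lt k by (intro mult_pos_pos) auto
    then have "?f u \<subseteq> {w \<in> nbhd G u \<inter> V3. card (nbhd G u \<inter> nbhd G w \<inter> S)
      < ((1 - \<epsilon>) * D13 - \<epsilon> * p) * (card (nbhd G u \<inter> S) - \<epsilon> * card ?N)}"
      by (intro Collect_mono) simp
    then have "card (?f u) \<le> card {w \<in> nbhd G u \<inter> V3. card (nbhd G u \<inter> nbhd G w \<inter> S)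
      < ((1 - \<epsilon>) * D13 - \<epsilon> * p) * (card (nbhd G u \<inter> S) - \<epsilon> * card ?N)}"
      using fin by (intro card_mono) auto
    also have "real \<dots> \<le> 2 * \<epsilon> * card (nbhd G u \<inter> V3)"
      using k by (intro typical_few_low_codegree[OF typical(2)[OF u(1)] fin(1,3) S(1) le \<epsilon>(1)]) simp
    also have "\<dots> \<le> 2 * \<epsilon> * (2 * (D23 * m))"
      using nbhd_card_snd(2)[OF typical(2)[OF u(1)] card_eq(3)] \<epsilon> by (intro mult_left_mono) auto
    finally show ?thesis by simp
  qed
  have "missed S \<subseteq> Sigma ?U (\<lambda>u. nbhd G u \<inter> V3) \<union> Sigma (V2 - ?U) ?f"
    by (auto simp: missed_def H_def nbhd_def)
  then have "card (missed S) \<le> card (Sigma ?U (\<lambda>u. nbhd G u \<inter> V3) \<union> Sigma (V2 - ?U) ?f)"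
    using fin by (intro card_mono) auto
  also have "\<dots> \<le> card (Sigma ?U (\<lambda>u. nbhd G u \<inter> V3)) + card (Sigma (V2 - ?U) ?f)"
    by (rule card_Un_le)
  also have "\<dots> = (\<Sum>u\<in>?U. card (nbhd G u \<inter> V3)) + (\<Sum>u\<in>V2 - ?U. card (?f u))"
    using fin by simp
  finally have "real (card (missed S))
      \<le> real ((\<Sum>u\<in>?U. card (nbhd G u \<inter> V3)) + (\<Sum>u\<in>V2 - ?U. card (?f u)))"
    by (simp only: of_nat_le_iff)
  also have "\<dots> = (\<Sum>u\<in>?U. real (card (nbhd G u \<inter> V3))) + (\<Sum>u\<in>V2 - ?U. real (card (?f u)))"
    by simp
  also have "(\<Sum>u\<in>?U. real (card (nbhd G u \<inter> V3))) \<le> card ?U * (2 * (D23 * m))"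
    using nbhd_card_snd(2)[OF typical(2) card_eq(3)] by (intro sum_bounded_above) auto
  also have "\<dots> \<le> \<epsilon> * m * (2 * (D23 * m))"
    using cU dens_pos by (intro mult_right_mono) auto
  also have "(\<Sum>u\<in>V2 - ?U. real (card (?f u))) \<le> card (V2 - ?U) * (4 * \<epsilon> * (D23 * m))"
    using f_le by (intro sum_bounded_above) auto
  also have "\<dots> \<le> m * (4 * \<epsilon> * (D23 * m))"
    using fin card_eq \<epsilon> dens_pos card_mono[of V2 "V2 - ?U"] by (intro mult_right_mono) auto
  finally show ?thesis
    by (simp add: algebra_simps)
qed

text \<open>Goodness of the vertex v enters here. Typicality gives N(v) at least (15/16)^5 of the
  expected number of edges, goodness says that at most an \<epsilon>-fraction of that number is not
  \<epsilon>-good, and every \<epsilon>-good edge is 1/2-good, hence in H.\<close>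

lemma card_link_ge:
  assumes v: "v \<in> V1"
  shows "(D12 * D13 * m / 2) * (D23 * m) \<le> card (link v)"
proof -
  let ?P = "D12 * D13 * D23 * m * m"
  obtain A B where A: "A \<subseteq> nbhd G v \<inter> V2" "(1 - \<epsilon>) * card (nbhd G v \<inter> V2) \<le> card A"
    and B: "B \<subseteq> nbhd G v \<inter> V3" "(1 - \<epsilon>) * card (nbhd G v \<inter> V3) \<le> card B"
    and dens: "(1 - \<epsilon>) * D23 \<le> dens G A B"
    using typical(1)[OF v] unfolding typical_def Let_def approx_eq_def by blast
  have finAB: "finite A" "finite B"
    using A B fin by (auto intro: finite_subset)
  have lA: "15 / 16 * (15 / 16 * (D12 * m)) \<le> card A"
    using A(2) nbhd_card(1)[OF typical(1)[OF v] card_eq(2)] low_dens[of "card (nbhd G v \<inter> V2)"]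
    by (auto intro: order_trans)
  have lB: "15 / 16 * (15 / 16 * (D13 * m)) \<le> card B"
    using B(2) nbhd_card_snd(1)[OF typical(1)[OF v] card_eq(3)] low_dens[of "card (nbhd G v \<inter> V3)"]
    by (auto intro: order_trans)
  have lD: "15 / 16 * D23 \<le> dens G A B"
    using dens low_dens[of D23] dens_pos(3) by linarith
  have "(15 / 16) ^ 5 * ?P = (15 / 16 * D23) * ((15 / 16 * (15 / 16 * (D12 * m))) * (15 / 16 * (15 / 16 * (D13 * m))))"
    by (simp add: power_numeral_reduce)
  also have "\<dots> \<le> dens G A B * (card A * card B)"
    using lA lB lD dens_pos by (simp only: of_nat_mult) (intro mult_mono, auto simp: dens_nonneg)
  also have "\<dots> = e_count G A B"
    using e_count_eq_dens[OF finAB] by simp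
  finally have e: "(15 / 16) ^ 5 * ?P \<le> e_count G A B" .
  let ?bad = "{(u, w). u \<in> nbhd G v \<inter> V2 \<and> w \<in> nbhd G v \<inter> V3 \<and> adj G u w \<and> \<not> good_edge G \<epsilon> V1 V2 V3 u w}"
  have bad: "card ?bad \<le> \<epsilon> * ?P"
    using strong v card_eq unfolding strong_super_regular_def good_vertex_def by (auto simp: mult_ac)
  have "?bad \<subseteq> V2 \<times> V3" by auto
  then have finbad: "finite ?bad"
    using fin by (auto intro: finite_subset)
  have "{(x, y). x \<in> A \<and> y \<in> B \<and> adj G x y} \<subseteq> link v \<union> ?bad"
  proof (rule subsetI, rule UnCI)
    fix e assume e: "e \<in> {(x, y). x \<in> A \<and> y \<in> B \<and> adj G x y}" "e \<notin> ?bad"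
    obtain u w where uw: "e = (u, w)" "u \<in> A" "w \<in> B" "adj G u w"
      using e(1) by blast
    then have ge: "(1 - \<epsilon>) * D12 * D13 * m \<le> card (nbhd G u \<inter> nbhd G w \<inter> V1)"
      using e(2) A B card_eq by (auto simp: good_edge_def)
    have "1 / 2 * (D12 * D13 * m) \<le> (1 - \<epsilon>) * (D12 * D13 * m)"
      using eps_le dens_pos by (intro mult_right_mono) auto
    then have "D12 * D13 * m / 2 \<le> card (nbhd G u \<inter> nbhd G w \<inter> V1)"
      using ge by (simp add: mult_ac)
    then show "e \<in> link v"
      using uw A B by (auto simp: link_def H_def)
  qed
  then have "e_count G A B \<le> card (link v \<union> ?bad)"
    unfolding e_count_def using finH finbad by (intro card_mono) (auto simp: link_def intro: finite_subset)
  also have "\<dots> \<le> card (link v) + card ?bad"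
    by (rule card_Un_le)
  finally have "real (e_count G A B) \<le> card (link v) + real (card ?bad)"
    by linarith
  moreover have "\<epsilon> * ?P \<le> 1 / 16 * ?P"
    using eps_le dens_pos by (intro mult_right_mono) auto
  moreover have "((15 / 16) ^ 5 - 1 / 16 - 1 / 2) * ?P \<ge> 0"
    using dens_pos by (intro mult_nonneg_nonneg) (auto simp: power_numeral_reduce)
  ultimately have "?P / 2 \<le> card (link v)"
    using e bad by (simp add: algebra_simps)
  then show ?thesis
    by (simp add: mult_ac)
qed

end

subsection \<open>Sparseness of the binomial random graph\<close>

text \<open>For sets of sizes at most x the mean is at most q x^2, and the second entry of the
  maximum makes the threshold at least 4 q x^2. The first entry keeps it at least c q s x, enough
  for the union bound. If s \<le> m and x \<le> c m / 4, it amounts to an average degree of at most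
  c q m (\<open>threshold_le\<close>).\<close>

definition threshold :: "real \<Rightarrow> real \<Rightarrow> real \<Rightarrow> real \<Rightarrow> real" where
  "threshold c q s x = c * q * x * max s (x / (c / 4))"

definition edges_sparse :: "real \<Rightarrow> real \<Rightarrow> real \<Rightarrow> nat \<Rightarrow> nat set set \<Rightarrow> bool" where
  "edges_sparse c p s n F \<longleftrightarrow> (\<forall>A B. A \<subseteq> {..<n} \<longrightarrow> B \<subseteq> {..<n} \<longrightarrow> A \<inter> B = {} \<longrightarrow> A \<union> B \<noteq> {} \<longrightarrow>
     card {(a, b). a \<in> A \<and> b \<in> B \<and> {a, b} \<in> F} < threshold c p s (real (max (card A) (card B))))"

text \<open>T is a matching with its two sides disjoint from each other and from S, so that
  different pairs (v, e) use disjoint pairs of graph edges and the events counted are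
  independent.\<close>

definition triangles_sparse :: "real \<Rightarrow> real \<Rightarrow> real \<Rightarrow> nat \<Rightarrow> nat set set \<Rightarrow> bool" where
  "triangles_sparse c p s n F \<longleftrightarrow> (\<forall>S T. S \<subseteq> {..<n} \<longrightarrow> T \<subseteq> {..<n} \<times> {..<n} \<longrightarrow> matching T \<longrightarrow>
     fst ` T \<inter> snd ` T = {} \<longrightarrow> S \<inter> (fst ` T \<union> snd ` T) = {} \<longrightarrow> S \<noteq> {} \<or> T \<noteq> {} \<longrightarrow>
     card {(v, e). v \<in> S \<and> e \<in> T \<and> {v, fst e} \<in> F \<and> {v, snd e} \<in> F}
       < threshold c (p\<^sup>2) s (real (max (card S) (card T))))"

lemma threshold_le:
  assumes "0 < c" "0 \<le> q" "0 \<le> x" "s \<le> m" "x \<le> c / 4 * m"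
  shows "threshold c q s x \<le> x * (c * q * m)"
proof -
  have "c * q * x * max s (x / (c / 4)) \<le> c * q * x * m"
    using assms by (intro mult_left_mono) (auto simp: field_simps)
  then show ?thesis
    by (simp add: threshold_def mult_ac)
qed

text \<open>The term from the mean takes at most half of the threshold. The other half is at least
  7x ln n, which covers (1 + 2k + 4l) ln n because x \<ge> 1. The bound factorises in k and l, as
  the union over pairs of sets needs: a vertex pays n^(-2) against n choices, a pair of vertices
  n^(-4) against n^2 choices.\<close>

lemma bprob_blocks_threshold:
  fixes c s :: real
  assumes E: "finite E" "0 \<le> p" "p \<le> 1" "finite I" "disjoint_family_on B I"
    "\<And>i. i \<in> I \<Longrightarrow> B i \<subseteq> E" "\<And>i. i \<in> I \<Longrightarrow> card (B i) = b"
    and I: "card I \<le> k * l" "0 < max k l" and c: "0 < c" "14 * ln (real n) \<le> c * p ^ b * s" and n: "0 < n"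
  shows "bprob p E (\<lambda>F. threshold c (p ^ b) s (real (max k l)) \<le> card {i\<in>I. B i \<subseteq> F})
    \<le> (1 / real n) * (1 / real n ^ 2) ^ k * (1 / real n ^ 4) ^ l"
proof -
  let ?x = "real (max k l)" and ?t = "threshold c (p ^ b) s (real (max k l))"
  have x: "1 \<le> ?x" "real k \<le> ?x" "real l \<le> ?x" using I(2) by auto
  have "2 * p ^ b * card I \<le> 2 * p ^ b * (?x * ?x)"
  proof (intro mult_left_mono)
    have "real (card I) \<le> real k * real l"
      using I(1) by (metis of_nat_le_iff of_nat_mult)
    also have "\<dots> \<le> ?x * ?x"
      using x by (intro mult_mono) auto
    finally show "real (card I) \<le> ?x * ?x" .
  qed (use E in auto)
  also have "\<dots> = c / 2 * p ^ b * ?x * (?x / (c / 4))"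
    using c by (simp add: field_simps)
  also have "\<dots> \<le> c / 2 * p ^ b * ?x * max s (?x / (c / 4))"
    using c E x by (intro mult_left_mono) auto
  also have "\<dots> = ?t / 2"
    by (simp add: threshold_def)
  finally have mean: "2 * p ^ b * card I - ?t \<le> - (?t / 2)" by linarith
  have ln0: "0 \<le> ln (real n)" using n by simp
  have "ln n * real (1 + 2 * k + 4 * l) \<le> ln n * (7 * ?x)"
    using x ln0 by (intro mult_left_mono) auto
  also have "\<dots> = (14 * ln n) * (?x / 2)"
    by simp
  also have "\<dots> \<le> (c * p ^ b * s) * (?x / 2)"
    using c x by (intro mult_right_mono) auto
  also have "\<dots> = c * p ^ b * ?x / 2 * s"
    by simp
  also have "\<dots> \<le> c * p ^ b * ?x / 2 * max s (?x / (c / 4))"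
    using c E x by (intro mult_left_mono) auto
  also have "\<dots> = ?t / 2"
    by (simp add: threshold_def)
  finally have t: "real (1 + 2 * k + 4 * l) * ln n \<le> ?t / 2"
    by (simp only: mult.commute)
  have "bprob p E (\<lambda>F. ?t \<le> card {i\<in>I. B i \<subseteq> F}) \<le> exp (2 * p ^ b * card I - ?t)"
    using E by (intro bprob_blocks_ge) auto
  also have "\<dots> \<le> exp (- (real (1 + 2 * k + 4 * l) * ln n))"
    using mean t by simp
  also have "\<dots> = 1 / n ^ (1 + 2 * k + 4 * l)"
    using n unfolding exp_minus exp_of_nat_mult by (simp add: inverse_eq_divide)
  also have "\<dots> = (1 / real n) * (1 / real n ^ 2) ^ k * (1 / real n ^ 4) ^ l"
    by (simp add: power_add power_mult power_one_over)
  finally show ?thesis .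
qed

lemma sum_Pow_power_card:
  fixes y :: "'a :: comm_semiring_1"
  assumes "finite U"
  shows "(\<Sum>A\<in>Pow U. y ^ card A) = (1 + y) ^ card U"
  using assms
proof (induction U rule: finite_induct)
  case (insert u U)
  have inj: "inj_on (insert u) (Pow U)"
    using insert.hyps by (auto intro!: inj_onI)
  have "Pow U \<inter> insert u ` Pow U = {}"
    using insert.hyps by auto
  then have "(\<Sum>A\<in>Pow (insert u U). y ^ card A) = (\<Sum>A\<in>Pow U. y ^ card A) + (\<Sum>A\<in>Pow U. y ^ card (insert u A))"
    using insert.hyps unfolding Pow_insert by (subst sum.union_disjoint) (auto simp: sum.reindex[OF inj])
  also have "(\<Sum>A\<in>Pow U. y ^ card (insert u A)) = (\<Sum>A\<in>Pow U. y * y ^ card A)"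
    using insert.hyps by (intro sum.cong refl) (auto simp: card_insert_if finite_subset)
  finally show ?case
    using insert by (simp add: sum_distrib_left[symmetric] algebra_simps)
qed simp

lemma one_plus_inverse_power_le:
  assumes "k \<le> n ^ 2" "2 \<le> j" "0 < n"
  shows "(1 + 1 / real n ^ j) ^ k \<le> 3"
proof -
  have "real k \<le> real (n ^ 2)"
    using assms(1) by (simp only: of_nat_le_iff)
  also have "\<dots> \<le> real n ^ j"
    unfolding of_nat_power using assms by (intro power_increasing) auto
  finally have le: "k * (1 / real n ^ j) \<le> 1"
    using assms by (simp add: divide_simps)
  have "(1 + 1 / real n ^ j) ^ k \<le> exp (1 / real n ^ j) ^ k"
    by (intro power_mono exp_ge_add_one_self) auto
  also have "\<dots> = exp (k * (1 / real n ^ j))"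
    by (simp only: exp_of_nat_mult)
  also have "\<dots> \<le> exp 1"
    using le by simp
  also have "\<dots> \<le> 3"
    by (rule exp_le)
  finally show ?thesis .
qed

text \<open>Summing the weights over all subsets factorises into (1 + n^(-2))^|U| and (1 +
  n^(-4))^|W|, each at most 3.\<close>

lemma bprob_union_pairs:
  assumes p: "0 \<le> p" "p \<le> 1" and UW: "finite U" "finite W" "card U \<le> n ^ 2" "card W \<le> n ^ 2" and n: "0 < n"
    and I: "I \<subseteq> Pow U \<times> Pow W"
    and P: "\<And>A B. (A, B) \<in> I \<Longrightarrow> bprob p E (P (A, B)) \<le> (1 / real n) * (1 / real n ^ 2) ^ card A * (1 / real n ^ 4) ^ card B"
  shows "bprob p E (\<lambda>F. \<exists>i\<in>I. P i F) \<le> 9 / n"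
proof -
  let ?b = "\<lambda>(A, B). (1 / real n) * (1 / real n ^ 2) ^ card A * (1 / real n ^ 4) ^ card B"
  have fin: "finite (Pow U \<times> Pow W)" using UW by simp
  then have finI: "finite I" using I by (rule finite_subset[rotated])
  have "bprob p E (\<lambda>F. \<exists>i\<in>I. P i F) \<le> (\<Sum>i\<in>I. bprob p E (P i))"
    using p finI by (rule bprob_ex_le)
  also have "\<dots> \<le> (\<Sum>i\<in>I. ?b i)"
    using P by (intro sum_mono) auto
  also have "\<dots> \<le> (\<Sum>i\<in>Pow U \<times> Pow W. ?b i)"
    using fin I by (intro sum_mono2) auto
  also have "\<dots> = (\<Sum>i\<in>Pow U \<times> Pow W.
      (1 / real n) * (case i of (A, B) \<Rightarrow> (1 / real n ^ 2) ^ card A * (1 / real n ^ 4) ^ card B))"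
    by (intro sum.cong) auto
  also have "\<dots> = (1 / n) * ((\<Sum>A\<in>Pow U. (1 / real n ^ 2) ^ card A) * (\<Sum>B\<in>Pow W. (1 / real n ^ 4) ^ card B))"
    by (simp only: sum_distrib_left[symmetric] sum.cartesian_product[symmetric] sum_product)
  also have "\<dots> = (1 / n) * ((1 + 1 / real n ^ 2) ^ card U * (1 + 1 / real n ^ 4) ^ card W)"
    using UW by (simp only: sum_Pow_power_card)
  also have "\<dots> \<le> (1 / n) * (3 * 3)"
    using UW n by (intro mult_left_mono mult_mono one_plus_inverse_power_le) auto
  finally show ?thesis by simp
qed

lemma finite_all_edges: "finite (all_edges n)"
proof -
  have "all_edges n \<subseteq> Pow {..<n}"
    by (auto simp: all_edges_def)
  then show ?thesis
    by (rule finite_subset) simp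
qed

lemma doubleton_in_all_edges: "u < n \<Longrightarrow> v < n \<Longrightarrow> u \<noteq> v \<Longrightarrow> {u, v} \<in> all_edges n"
  unfolding all_edges_def by blast

lemma bprob_not_edges_sparse:
  assumes p: "0 \<le> p" "p \<le> 1" and c: "0 < c" "14 * ln (real n) \<le> c * p * s" and n: "0 < n"
  shows "bprob p (all_edges n) (\<lambda>F. \<not> edges_sparse c p s n F) \<le> 9 / n"
proof -
  let ?I = "{(A, B). A \<subseteq> {..<n} \<and> B \<subseteq> {..<n} \<and> A \<inter> B = {} \<and> A \<union> B \<noteq> {}}"
  \<comment> \<open>Blocks consist of a single graph edge, so b = 1; \<open>p ^ 1\<close> matches
    the form of \<open>bprob_blocks_threshold\<close>.\<close>
  let ?P = "\<lambda>(A, B) F. threshold c (p ^ 1) s (real (max (card A) (card B)))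
    \<le> card {i \<in> A \<times> B. {{fst i, snd i}} \<subseteq> F}"
  have main: "bprob p (all_edges n) (\<lambda>F. \<exists>i\<in>?I. ?P i F) \<le> 9 / n"
  proof (rule bprob_union_pairs[where U = "{..<n}" and W = "{..<n}"])
    fix A B assume AB: "(A, B) \<in> ?I"
    then have fin: "finite A" "finite B" by (auto intro: finite_subset)
    have "bprob p (all_edges n) (\<lambda>F. threshold c (p ^ 1) s (real (max (card A) (card B)))
        \<le> card {i \<in> A \<times> B. {{fst i, snd i}} \<subseteq> F}) \<le> (1 / real n) * (1 / real n ^ 2) ^ card A * (1 / real n ^ 4) ^ card B"
    proof (rule bprob_blocks_threshold)
      show "disjoint_family_on (\<lambda>i. {{fst i, snd i}}) (A \<times> B)"
        using AB by (auto simp: disjoint_family_on_def doubleton_eq_iff)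
      show "{{fst i, snd i}} \<subseteq> all_edges n" if i: "i \<in> A \<times> B" for i
      proof -
        have "fst i < n" "snd i < n" "fst i \<noteq> snd i"
          using AB i by auto
        then show ?thesis
          by (simp add: doubleton_in_all_edges)
      qed
      show "0 < max (card A) (card B)"
        using AB fin by (auto simp: less_max_iff_disj card_gt_0_iff)
    qed (use p c n fin finite_all_edges in \<open>auto simp: card_cartesian_product\<close>)
    then show "bprob p (all_edges n) (?P (A, B)) \<le> (1 / real n) * (1 / real n ^ 2) ^ card A * (1 / real n ^ 4) ^ card B"
      by simp
  qed (use p n in \<open>auto simp: power2_eq_square\<close>)
  have imp: "\<exists>i\<in>?I. ?P i F" if not: "\<not> edges_sparse c p s n F" for F
  proof -
    obtain A B where AB: "A \<subseteq> {..<n}" "B \<subseteq> {..<n}" "A \<inter> B = {}" "A \<union> B \<noteq> {}"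
      "\<not> card {(a, b). a \<in> A \<and> b \<in> B \<and> {a, b} \<in> F} < threshold c p s (real (max (card A) (card B)))"
      using not unfolding edges_sparse_def by blast
    moreover have "{(a, b). a \<in> A \<and> b \<in> B \<and> {a, b} \<in> F} = {i \<in> A \<times> B. {{fst i, snd i}} \<subseteq> F}"
      by auto
    ultimately show ?thesis
      by (intro bexI[of _ "(A, B)"]) auto
  qed
  show ?thesis
    by (rule order_trans[OF bprob_mono[OF p] main]) (erule imp)
qed

lemma bprob_not_triangles_sparse:
  assumes p: "0 \<le> p" "p \<le> 1" and c: "0 < c" "14 * ln (real n) \<le> c * p\<^sup>2 * s" and n: "0 < n"
  shows "bprob p (all_edges n) (\<lambda>F. \<not> triangles_sparse c p s n F) \<le> 9 / n"
proof -
  let ?I = "{(S, T). S \<subseteq> {..<n} \<and> T \<subseteq> {..<n} \<times> {..<n} \<and> matching T \<and> fst ` T \<inter> snd ` T = {} \<and>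
    S \<inter> (fst ` T \<union> snd ` T) = {} \<and> (S \<noteq> {} \<or> T \<noteq> {})}"
  let ?B = "\<lambda>(v, e). {{v, fst e}, {v, snd e}}"
  let ?P = "\<lambda>(S, T) F. threshold c (p\<^sup>2) s (real (max (card S) (card T))) \<le> card {i \<in> S \<times> T. ?B i \<subseteq> F}"
  have main: "bprob p (all_edges n) (\<lambda>F. \<exists>i\<in>?I. ?P i F) \<le> 9 / n"
  proof (rule bprob_union_pairs[where U = "{..<n}" and W = "{..<n} \<times> {..<n}"])
    fix S T assume ST: "(S, T) \<in> ?I"
    then have fin: "finite S" "finite T" by (auto intro: finite_subset)
    have inj: "inj_on fst T" "inj_on snd T" and dis: "fst ` T \<inter> snd ` T = {}" "S \<inter> (fst ` T \<union> snd ` T) = {}"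
      using ST by (auto simp: matching_def)
    have out: "fst e \<notin> S" "snd e \<notin> S" "fst e \<noteq> snd e'" if "e \<in> T" "e' \<in> T" for e e'
      using that dis by auto
    have "bprob p (all_edges n) (\<lambda>F. threshold c (p\<^sup>2) s (real (max (card S) (card T)))
        \<le> card {i \<in> S \<times> T. ?B i \<subseteq> F}) \<le> (1 / real n) * (1 / real n ^ 2) ^ card S * (1 / real n ^ 4) ^ card T"
    proof (rule bprob_blocks_threshold)
      show "disjoint_family_on ?B (S \<times> T)"
        unfolding disjoint_family_on_def
      proof (intro ballI impI)
        fix i j assume ij: "i \<in> S \<times> T" "j \<in> S \<times> T" "i \<noteq> j"
        obtain v e v' e' where eq: "i = (v, e)" "j = (v', e')"
          using surj_pair[of i] surj_pair[of j] by blast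
        \<comment> \<open>A graph edge shared by two blocks determines its endpoint in S, as the
          other endpoint lies outside S. That other endpoint determines e, because T is a matching
          with disjoint sides.\<close>
        have "v = v' \<and> e = e'" if "x = fst e \<or> x = snd e" "x' = fst e' \<or> x' = snd e'" "{v, x} = {v', x'}" for x x'
        proof -
          have v: "v \<in> S" "v' \<in> S" and e: "e \<in> T" "e' \<in> T" using ij eq by auto
          have "x \<notin> S" "x' \<notin> S"
            using that(1,2) e out(1,2) by metis+
          then have "v = v'" "x = x'"
            using that(3) v by (auto simp: doubleton_eq_iff)
          then show ?thesis
            using that(1,2) e out[of e e'] out[of e' e] inj_onD[OF inj(1), of e e'] inj_onD[OF inj(2), of e e'] by metis
        qed
        then show "?B i \<inter> ?B j = {}"
          using ij(3) unfolding eq by auto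
      qed
      show "\<And>i. i \<in> S \<times> T \<Longrightarrow> ?B i \<subseteq> all_edges n"
      proof -
        fix i assume i: "i \<in> S \<times> T"
        obtain v a b where eq: "i = (v, (a, b))" by (metis prod.exhaust)
        have "v < n" "a < n" "b < n" "v \<noteq> a" "v \<noteq> b"
          using i ST out[of "(a, b)" "(a, b)"] unfolding eq by auto
        then show "?B i \<subseteq> all_edges n"
          unfolding eq by (simp add: doubleton_in_all_edges)
      qed
      show "\<And>i. i \<in> S \<times> T \<Longrightarrow> card (?B i) = 2"
        using out by (auto simp: card_insert_if doubleton_eq_iff)
      show "0 < max (card S) (card T)"
        using ST fin by (auto simp: less_max_iff_disj card_gt_0_iff)
    qed (use p c n fin finite_all_edges in \<open>auto simp: card_cartesian_product\<close>)
    then show "bprob p (all_edges n) (?P (S, T)) \<le> (1 / real n) * (1 / real n ^ 2) ^ card S * (1 / real n ^ 4) ^ card T"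
      by simp
  qed (use p n in \<open>auto simp: power2_eq_square card_cartesian_product\<close>)
  have imp: "\<exists>i\<in>?I. ?P i F" if not: "\<not> triangles_sparse c p s n F" for F
  proof -
    obtain S T where ST: "S \<subseteq> {..<n}" "T \<subseteq> {..<n} \<times> {..<n}" "matching T" "fst ` T \<inter> snd ` T = {}"
      "S \<inter> (fst ` T \<union> snd ` T) = {}" "S \<noteq> {} \<or> T \<noteq> {}"
      "\<not> card {(v, e). v \<in> S \<and> e \<in> T \<and> {v, fst e} \<in> F \<and> {v, snd e} \<in> F}
        < threshold c (p\<^sup>2) s (real (max (card S) (card T)))"
      using not unfolding triangles_sparse_def by (simp only: not_all not_imp) (elim exE conjE, rule that)
    have eq: "{(v, e). v \<in> S \<and> e \<in> T \<and> {v, fst e} \<in> F \<and> {v, snd e} \<in> F} = {i \<in> S \<times> T. ?B i \<subseteq> F}"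
      by auto
    have "(S, T) \<in> ?I" using ST by simp
    moreover have "?P (S, T) F" using ST(7) unfolding eq by simp
    ultimately show ?thesis by (rule bexI[rotated])
  qed
  show ?thesis
    by (rule order_trans[OF bprob_mono[OF p] main]) (erule imp)
qed

subsection \<open>From the spread matching to the triangle factor\<close>

lemma card_pairs_ge:
  fixes t :: real
  assumes "finite A" "finite B" "\<And>a. a \<in> A \<Longrightarrow> t \<le> real (card {b \<in> B. R a b})"
  shows "card A * t \<le> card {(a, b). a \<in> A \<and> b \<in> B \<and> R a b}"
proof -
  have "{(a, b). a \<in> A \<and> b \<in> B \<and> R a b} = Sigma A (\<lambda>a. {b \<in> B. R a b})" by auto
  then have "real (card {(a, b). a \<in> A \<and> b \<in> B \<and> R a b}) = (\<Sum>a\<in>A. real (card {b \<in> B. R a b}))"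
    using assms(1,2) by simp
  then show ?thesis
    using sum_bounded_below[of A t "\<lambda>a. real (card {b \<in> B. R a b})"] assms(3) by simp
qed

lemma card_pairs_ge':
  fixes t :: real
  assumes "finite A" "finite B" "\<And>b. b \<in> B \<Longrightarrow> t \<le> real (card {a \<in> A. R a b})"
  shows "card B * t \<le> card {(a, b). a \<in> A \<and> b \<in> B \<and> R a b}"
proof -
  have "{(a, b). a \<in> A \<and> b \<in> B \<and> R a b} = prod.swap ` {(b, a). b \<in> B \<and> a \<in> A \<and> R a b}" by auto
  then have "card {(a, b). a \<in> A \<and> b \<in> B \<and> R a b} = card {(b, a). b \<in> B \<and> a \<in> A \<and> R a b}"
    by (simp add: card_image)
  then show ?thesis
    using card_pairs_ge[of B A t "\<lambda>b a. R a b"] assms by simp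
qed

lemma edges_sparseD:
  assumes "edges_sparse c p s n F" "A \<subseteq> {..<n}" "B \<subseteq> {..<n}" "A \<inter> B = {}" "A \<union> B \<noteq> {}"
  shows "card {(a, b). a \<in> A \<and> b \<in> B \<and> {a, b} \<in> F} < threshold c p s (real (max (card A) (card B)))"
  using assms(1)[unfolded edges_sparse_def, rule_format, OF assms(2-5)] .

lemma triangles_sparseD:
  assumes "triangles_sparse c p s n F" "S \<subseteq> {..<n}" "T \<subseteq> {..<n} \<times> {..<n}" "matching T"
    "fst ` T \<inter> snd ` T = {}" "S \<inter> (fst ` T \<union> snd ` T) = {}" "S \<noteq> {} \<or> T \<noteq> {}"
  shows "card {(v, e). v \<in> S \<and> e \<in> T \<and> {v, fst e} \<in> F \<and> {v, snd e} \<in> F}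
    < threshold c (p\<^sup>2) s (real (max (card S) (card T)))"
  using assms(1)[unfolded triangles_sparse_def, rule_format, OF assms(2-7)] .

context strong_triple
begin

lemma link_in_matching:
  assumes "M \<subseteq> H"
  shows "M \<inter> link v = {e \<in> M. adj G v (fst e) \<and> adj G v (snd e)}"
  using assms by (auto simp: link_def nbhd_def)

text \<open>The constants are chosen backwards. A vertex of V1 sees at least L/6400 \<ge> c p^2 m
  edges of M; \<gamma> = c/4 is the relative size up to which \<open>triangles_sparse\<close>
  contradicts that many triangles; c' is such that c' p m is at most the reserve degree \<gamma> d /
  256; and c'/4 is the corresponding size for \<open>edges_sparse\<close>.\<close>

lemma triangle_factor_exists:
  fixes c \<gamma> c' s :: real
  assumes GF: "G \<subseteq> F" and p1: "p \<le> 1" and m3: "3 \<le> m" and s: "s \<le> m"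
    and V: "V1 \<subseteq> {..<n}" "V2 \<subseteq> {..<n}" "V3 \<subseteq> {..<n}" "V1 \<inter> V2 = {}" "V1 \<inter> V3 = {}" "V2 \<inter> V3 = {}"
    and c: "c = \<delta>\<^sup>2 / 12800" "\<gamma> = c / 4" "c' = \<gamma> * \<delta> / 256"
    and edges: "edges_sparse c' p s n F" and triangles: "triangles_sparse c p s n F"
    and eps: "16 * \<epsilon> \<le> (c' / 4)\<^sup>2" "exp (12 / \<gamma>) * (96 / \<gamma>\<^sup>2 * (6 * \<epsilon>)) \<le> 1"
    and large: "480000 * ln (real m) \<le> \<delta>\<^sup>2 * (p\<^sup>2 * m)" "768 * ln (real m) \<le> \<gamma> * \<delta> * (p\<^sup>2 * m)"
      "96 / \<gamma>\<^sup>2 \<le> \<delta> * (p\<^sup>2 * m)"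
  shows "\<exists>T. triangle_factor G V1 V2 V3 T"
proof -
  let ?L = "D12 * D13 * m / 2" and ?d = "D23 * m" and ?\<eta> = "c' / 4"
  let ?\<S> = "{S. S \<subseteq> V1 \<and> \<gamma> * m \<le> card S}"
  have mpos: "0 < real m" using m3 by simp
  have "\<delta>\<^sup>2 \<le> 1" using \<delta> by (simp add: power_le_one)
  then have pos: "0 < c" "0 < \<gamma>" "0 < c'" "\<gamma> \<le> 1"
    using \<delta> by (auto simp: c)
  have "\<gamma> * \<delta> \<le> \<gamma> * 1" using pos \<delta> by (intro mult_left_mono) auto
  then have c'\<gamma>: "c' \<le> \<gamma>" using pos by (simp add: c(3))
  have p2: "p\<^sup>2 * m \<le> p * m"
    using p1 p_pos by (intro mult_right_mono) (auto simp: power2_eq_square mult_left_le)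
  have d_ge: "\<delta> * (p * m) \<le> ?d"
    using mult_right_mono[OF dens_ge(3), of "real m"] by (simp add: mult_ac)
  have "\<delta> * (p\<^sup>2 * m) \<le> \<delta> * (p * m)"
    using p2 \<delta> by (intro mult_left_mono) auto
  then have d_ge2: "\<delta> * (p\<^sup>2 * m) \<le> ?d" using d_ge by linarith
  have L_ge: "\<delta>\<^sup>2 * (p\<^sup>2 * m) / 2 \<le> ?L"
  proof -
    have "(\<delta> * p) * (\<delta> * p) \<le> D12 * D13"
      using dens_ge dens_pos \<delta> p_pos by (intro mult_mono) auto
    then have "(\<delta> * p) * (\<delta> * p) * m \<le> D12 * D13 * m"
      by (intro mult_right_mono) auto
    then show ?thesis by (simp add: power2_eq_square mult_ac)
  qed
  have "(c' / 4)\<^sup>2 \<le> (\<gamma> / 4)\<^sup>2"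
    using c'\<gamma> pos by (intro power_mono) auto
  then have eps_\<gamma>: "16 * \<epsilon> \<le> (\<gamma> / 4)\<^sup>2"
    using eps(1) by linarith
  have sq: "x\<^sup>2 \<le> x" if "0 \<le> x" "x \<le> 1" for x :: real
    using that by (simp add: power2_eq_square mult_left_le)
  have eps_le': "\<epsilon> \<le> ?\<eta>" "\<epsilon> \<le> \<gamma> / 4" "8 * \<epsilon> \<le> \<gamma>"
    using eps(1) eps_\<gamma> sq[of ?\<eta>] sq[of "\<gamma> / 4"] pos c'\<gamma> \<epsilon>(1) by auto
  have adjF: "{x, y} \<in> F" if "adj G x y" for x y
    using that GF by (auto simp: adj_def)
  interpret B: bipartite_graph V2 V3 H ?d m
    using m3 by (rule bipartite_graph_H)
  have edge_bound: "\<not> x * (c' * p * m) \<le> card {(a, b). a \<in> A \<and> b \<in> B \<and> {a, b} \<in> F}"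
    if "A \<subseteq> V2" "B \<subseteq> V3" "x = real (max (card A) (card B))" "0 < max (card A) (card B)" "x \<le> ?\<eta> * m" for A B x
  proof -
    have "A \<union> B \<noteq> {}" using that(4) by auto
    then have "card {(a, b). a \<in> A \<and> b \<in> B \<and> {a, b} \<in> F} < threshold c' p s x"
      unfolding that(3) using that(1,2) V by (intro edges_sparseD[OF edges]) auto
    also have "\<dots> \<le> x * (c' * p * m)"
      using that pos p_pos s by (intro threshold_le) auto
    finally show ?thesis by simp
  qed
  have deg_bound: "c' * p * m \<le> \<gamma> * ?d / 256"
    using mult_left_mono[OF d_ge, of "\<gamma>"] pos by (simp add: c(3) mult_ac)
  obtain M where M: "M \<subseteq> H" "matching M" "fst ` M = V2" "snd ` M = V3"
    and M_link: "\<And>v. v \<in> V1 \<Longrightarrow> ?L / 6400 \<le> card (M \<inter> link v)"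
    and M_missed: "\<And>S. S \<in> ?\<S> \<Longrightarrow> card (M \<inter> missed S) < \<gamma> * m"
  \<comment> \<open>\<open>card_H_Int_ge\<close> for sets of size \<gamma> m / 4 gives h =
    (\<gamma>/4)^2 / 2, and K is then 3/h; the factor 6 in 6 \<epsilon> comes from
    \<open>card_missed_le\<close>.\<close>
  proof (rule B.spread_perfect_matching[where J = V1 and E = link and L = ?L and K = "96 / \<gamma>\<^sup>2"
        and h = "\<gamma>\<^sup>2 / 32" and \<eta> = ?\<eta> and \<S> = ?\<S> and Bad = missed and \<epsilon> = "6 * \<epsilon>" and \<gamma> = \<gamma>])
    show "finite V1" "card V1 \<le> m" using fin card_eq by auto
    show "link v \<subseteq> H" for v by (auto simp: link_def)
    show "?L * ?d \<le> card (link v)" if "v \<in> V1" for v by (rule card_link_ge[OF that])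
    show "240000 * ln (real m) \<le> ?L" using large(1) L_ge by linarith
    have "\<gamma> * \<delta> * (p\<^sup>2 * m) \<le> \<gamma> * ?d"
      using mult_left_mono[OF d_ge2, of \<gamma>] pos by (simp add: mult_ac)
    then show "768 * ln (real m) \<le> \<gamma> * ?d" using large(2) by linarith
    show "96 / \<gamma>\<^sup>2 \<le> ?d" using large(3) d_ge2 by linarith
    show "0 < \<gamma>" "\<gamma> \<le> 1" by fact+
    show "exp (12 / \<gamma>) * (96 / \<gamma>\<^sup>2 * (6 * \<epsilon>)) \<le> 1" by fact
    show "0 \<le> 6 * \<epsilon>" using \<epsilon> by simp
    have "\<gamma>\<^sup>2 \<le> 1" using pos by (simp add: power_le_one)
    then show "1 \<le> 96 / \<gamma>\<^sup>2" using pos by (simp add: divide_simps)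
    show "3 \<le> 96 / \<gamma>\<^sup>2 * (\<gamma>\<^sup>2 / 32)" using pos by simp
    have "?\<S> \<subseteq> Pow V1" by auto
    moreover have "finite (Pow V1)" "card (Pow V1) = 2 ^ m"
      using fin card_eq by (simp_all add: card_Pow)
    ultimately show "finite ?\<S>" "card ?\<S> \<le> 2 ^ m"
      using card_mono finite_subset by metis+
    show "missed S \<subseteq> H" for S by (auto simp: missed_def)
    show "card (missed S) \<le> 6 * \<epsilon> * ?d * m" if "S \<in> ?\<S>" for S
      using that pos eps_le' m3 by (intro card_missed_le[where \<gamma> = \<gamma>]) auto
    show "\<gamma>\<^sup>2 / 32 * ?d * m \<le> card (H \<inter> A \<times> B)"
      if "A \<subseteq> V2" "B \<subseteq> V3" "\<gamma> / 4 * m \<le> card A" "\<gamma> / 4 * m \<le> card B" for A B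
      using card_H_Int_ge[OF that(1,2) _ eps_\<gamma> eps_le'(2) that(3,4)] pos by (simp add: power_divide)
    show "H \<inter> A \<times> B \<noteq> {}" if "A \<subseteq> V2" "B \<subseteq> V3" "?\<eta> * m \<le> card A" "?\<eta> * m \<le> card B" for A B
    proof -
      have "?\<eta>\<^sup>2 / 2 * ?d * m \<le> card (H \<inter> A \<times> B)"
        using pos eps eps_le' that by (intro card_H_Int_ge) auto
      moreover have "0 < ?\<eta>\<^sup>2 / 2 * ?d * m"
        using pos dens_pos mpos by simp
      ultimately show ?thesis by fastforce
    qed
    show "\<exists>a\<in>A. card (H `` {a} \<inter> B) \<le> \<gamma> * ?d / 256"
      if AB: "A \<subseteq> V2" "B \<subseteq> V3" "card B < card A" "card A \<le> ?\<eta> * m" for A B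
    proof (rule ccontr)
      assume "\<not> ?thesis"
      then have big: "\<gamma> * ?d / 256 < card (H `` {a} \<inter> B)" if "a \<in> A" for a
        using that by (auto simp: not_le)
      have finAB: "finite A" "finite B" using AB fin by (auto intro: finite_subset)
      have "card A * (c' * p * m) \<le> card {(a, b). a \<in> A \<and> b \<in> B \<and> {a, b} \<in> F}"
      proof (rule card_pairs_ge[OF finAB])
        fix a assume a: "a \<in> A"
        have "card (H `` {a} \<inter> B) \<le> card {b \<in> B. {a, b} \<in> F}"
          using finAB adjF by (intro card_mono) (auto simp: H_def)
        then show "c' * p * m \<le> card {b \<in> B. {a, b} \<in> F}"
          using big[OF a] deg_bound by linarith
      qed
      then show False
        using edge_bound[of A B "card A"] AB by (simp add: max_def)
    qed
    show "\<exists>b\<in>B. card (H\<inverse> `` {b} \<inter> A) \<le> \<gamma> * ?d / 256"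
      if AB: "A \<subseteq> V2" "B \<subseteq> V3" "card A < card B" "card B \<le> ?\<eta> * m" for A B
    proof (rule ccontr)
      assume "\<not> ?thesis"
      then have big: "\<gamma> * ?d / 256 < card (H\<inverse> `` {b} \<inter> A)" if "b \<in> B" for b
        using that by (auto simp: not_le)
      have finAB: "finite A" "finite B" using AB fin by (auto intro: finite_subset)
      have "card B * (c' * p * m) \<le> card {(a, b). a \<in> A \<and> b \<in> B \<and> {a, b} \<in> F}"
      proof (rule card_pairs_ge'[OF finAB])
        fix b assume b: "b \<in> B"
        have "card (H\<inverse> `` {b} \<inter> A) \<le> card {a \<in> A. {a, b} \<in> F}"
          using finAB adjF by (intro card_mono) (auto simp: H_def)
        then show "c' * p * m \<le> card {a \<in> A. {a, b} \<in> F}"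
          using big[OF b] deg_bound by linarith
      qed
      then show False
        using edge_bound[of A B "card B"] AB by (simp add: max_def)
    qed
  qed (rule that)
  have finM: "finite M" using M(1) finH by (rule finite_subset)
  have cardM: "card M = m"
    using M(2,3) card_eq(2) by (metis card_image matching_def)
  have cL: "c * p\<^sup>2 * m \<le> ?L / 6400" "c * p\<^sup>2 * m \<le> ?L"
  proof -
    have "c * p\<^sup>2 * m = \<delta>\<^sup>2 * (p\<^sup>2 * m) / 12800" "0 \<le> \<delta>\<^sup>2 * (p\<^sup>2 * m)"
      by (simp_all add: c(1))
    then show "c * p\<^sup>2 * m \<le> ?L / 6400" "c * p\<^sup>2 * m \<le> ?L"
      using L_ge by linarith+
  qed
  have triangle_bound: "\<not> x * (c * p\<^sup>2 * m) \<le> card {(v, e). v \<in> S \<and> e \<in> T \<and> adj G v (fst e) \<and> adj G v (snd e)}"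
    if ST: "S \<subseteq> V1" "T \<subseteq> M" "x = real (max (card S) (card T))" "0 < max (card S) (card T)" "x \<le> \<gamma> * m" for S T x
  proof -
    let ?P = "{(v, e). v \<in> S \<and> e \<in> T \<and> {v, fst e} \<in> F \<and> {v, snd e} \<in> F}"
    have finST: "finite S" "finite T" using ST fin finM by (auto intro: finite_subset)
    have T: "T \<subseteq> V2 \<times> V3" using ST(2) M(1) H_sub by blast
    then have img: "fst ` T \<subseteq> V2" "snd ` T \<subseteq> V3" by auto
    have le: "card {(v, e). v \<in> S \<and> e \<in> T \<and> adj G v (fst e) \<and> adj G v (snd e)} \<le> card ?P"
      using finST adjF by (intro card_mono finite_subset[of ?P "S \<times> T"]) auto
    have lt: "real (card ?P) < threshold c (p\<^sup>2) s x"
    proof -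
      have "S \<subseteq> {..<n}" "T \<subseteq> {..<n} \<times> {..<n}" using ST(1) T V by auto
      moreover have "matching T" using M(2) ST(2) by (rule matching_subset)
      moreover have "fst ` T \<inter> snd ` T = {}" using img V(6) by blast
      moreover have "S \<inter> (fst ` T \<union> snd ` T) = {}" using img ST(1) V(4,5) by blast
      moreover have "S \<noteq> {} \<or> T \<noteq> {}" using ST(4) by auto
      ultimately show ?thesis
        unfolding ST(3) by (rule triangles_sparseD[OF triangles])
    qed
    have "threshold c (p\<^sup>2) s x \<le> x * (c * p\<^sup>2 * m)"
      using ST pos s by (intro threshold_le) (auto simp: c(2))
    then show ?thesis using le lt by linarith
  qed
  \<comment> \<open>The auxiliary graph between V1 and M. Small sets expand from the left by
    \<open>M_link\<close>, from the right because edges of M have many common neighbours in V1;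
    large sets are joined by \<open>M_missed\<close>.\<close>
  let ?E = "{(v, e). v \<in> V1 \<and> e \<in> M \<and> adj G v (fst e) \<and> adj G v (snd e)}"
  have "\<exists>N\<subseteq>?E. matching N \<and> fst ` N = V1 \<and> snd ` N = M"
  proof (rule expander_perfect_matching[where g = "\<gamma> * m"])
    fix A B assume AB: "A \<subseteq> V1" "B \<subseteq> M" "?E `` A \<subseteq> B" "card B < card A" "card A \<le> \<gamma> * m"
    have finAB: "finite A" "finite B" using AB fin finM by (auto intro: finite_subset)
    have "card A * (c * p\<^sup>2 * m) \<le> card {(v, e). v \<in> A \<and> e \<in> B \<and> adj G v (fst e) \<and> adj G v (snd e)}"
    proof (rule card_pairs_ge[OF finAB])
      fix v assume v: "v \<in> A"
      have "M \<inter> link v \<subseteq> {e \<in> B. adj G v (fst e) \<and> adj G v (snd e)}"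
        unfolding link_in_matching[OF M(1)] using AB(1,3) v by blast
      then have "card (M \<inter> link v) \<le> card {e \<in> B. adj G v (fst e) \<and> adj G v (snd e)}"
        using finAB by (intro card_mono) auto
      then show "c * p\<^sup>2 * m \<le> card {e \<in> B. adj G v (fst e) \<and> adj G v (snd e)}"
        using M_link[of v] v AB(1) cL by fastforce
    qed
    then show False
      using triangle_bound[of A B "card A"] AB by (simp add: max_def)
  next
    fix A B assume AB: "A \<subseteq> V1" "B \<subseteq> M" "?E\<inverse> `` B \<subseteq> A" "card A < card B" "card B \<le> \<gamma> * m"
    have finAB: "finite A" "finite B" using AB fin finM by (auto intro: finite_subset)
    have "card B * (c * p\<^sup>2 * m) \<le> card {(v, e). v \<in> A \<and> e \<in> B \<and> adj G v (fst e) \<and> adj G v (snd e)}"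
    proof (rule card_pairs_ge'[OF finAB])
      fix e assume e: "e \<in> B"
      have "nbhd G (fst e) \<inter> nbhd G (snd e) \<inter> V1 \<subseteq> {v \<in> A. adj G v (fst e) \<and> adj G v (snd e)}"
      proof
        fix v assume "v \<in> nbhd G (fst e) \<inter> nbhd G (snd e) \<inter> V1"
        then have v: "v \<in> V1" "adj G v (fst e)" "adj G v (snd e)"
          by (auto simp: mem_nbhd_iff)
        then have "v \<in> ?E\<inverse> `` B"
          using e AB(2) by (intro ImageI[of e]) auto
        then show "v \<in> {v \<in> A. adj G v (fst e) \<and> adj G v (snd e)}"
          using v AB(3) by auto
      qed
      then have "card (nbhd G (fst e) \<inter> nbhd G (snd e) \<inter> V1) \<le> card {v \<in> A. adj G v (fst e) \<and> adj G v (snd e)}"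
        using finAB by (intro card_mono) auto
      moreover have "?L \<le> card (nbhd G (fst e) \<inter> nbhd G (snd e) \<inter> V1)"
        using e AB(2) M(1) by (auto simp: H_def)
      ultimately show "c * p\<^sup>2 * m \<le> card {v \<in> A. adj G v (fst e) \<and> adj G v (snd e)}"
        using cL(2) by linarith
    qed
    then show False
      using triangle_bound[of A B "card B"] AB by (simp add: max_def)
  next
    fix A B assume AB: "A \<subseteq> V1" "B \<subseteq> M" "\<gamma> * m \<le> card A" "\<gamma> * m \<le> card B"
    show "?E \<inter> A \<times> B \<noteq> {}"
    proof
      assume empty: "?E \<inter> A \<times> B = {}"
      \<comment> \<open>If nothing joins A to B, all of B is missed by A, but fewer than \<gamma> m
        edges of M are.\<close>
      have "B \<subseteq> M \<inter> missed A"
      proof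
        fix e assume e: "e \<in> B"
        have "nbhd G (fst e) \<inter> nbhd G (snd e) \<inter> A = {}"
        proof (rule ccontr)
          assume "\<not> ?thesis"
          then obtain v where v: "v \<in> A" "adj G v (fst e)" "adj G v (snd e)"
            by (auto simp: mem_nbhd_iff)
          then have "(v, e) \<in> ?E \<inter> A \<times> B"
            using AB(1,2) e by auto
          then show False using empty by blast
        qed
        then show "e \<in> M \<inter> missed A"
          using e AB(2) M(1) by (cases e) (auto simp: missed_def)
      qed
      then have "card B \<le> card (M \<inter> missed A)"
        using finM by (intro card_mono) auto
      then show False
        using M_missed[of A] AB by simp
    qed
  qed (use fin finM cardM card_eq in auto)
  then obtain N where N: "N \<subseteq> ?E" "matching N" "fst ` N = V1" "snd ` N = M" by blast
  have "triangle_factor G V1 V2 V3 N"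
    unfolding triangle_factor_def
  proof (intro conjI ballI impI)
    fix t assume "t \<in> N"
    then show "case t of (a, b, c) \<Rightarrow> a \<in> V1 \<and> b \<in> V2 \<and> c \<in> V3 \<and> adj G a b \<and> adj G b c \<and> adj G a c"
      using N(1) M(1) by (auto simp: H_def)
  next
    fix t t' assume tt: "t \<in> N" "t' \<in> N" "t \<noteq> t'"
    obtain a b c a' b' c' where eq: "t = (a, b, c)" "t' = (a', b', c')"
      using surj_pair by metis
    have "inj_on fst N" "inj_on snd N" "inj_on fst M" "inj_on snd M"
      using N(2) M(2) by (auto simp: matching_def)
    have inM: "(b, c) \<in> M" "(b', c') \<in> M"
      using tt(1,2) N(4) unfolding eq by force+
    have "a \<noteq> a'"
      using inj_onD[OF \<open>inj_on fst N\<close>, of t t'] tt unfolding eq by auto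
    moreover have ne: "(b, c) \<noteq> (b', c')"
      using inj_onD[OF \<open>inj_on snd N\<close>, of t t'] tt unfolding eq by auto
    moreover have "b \<noteq> b'"
      using inj_onD[OF \<open>inj_on fst M\<close> _ inM] ne by auto
    moreover have "c \<noteq> c'"
      using inj_onD[OF \<open>inj_on snd M\<close> _ inM] ne by auto
    moreover have "a \<in> V1" "a' \<in> V1" "b \<in> V2" "b' \<in> V2" "c \<in> V3" "c' \<in> V3"
      using tt(1,2) N(1) inM M(1) H_sub unfolding eq by auto
    ultimately show "tri_verts t \<inter> tri_verts t' = {}"
      using V(4-6) unfolding eq tri_verts_def by auto
  next
    have "V1 \<subseteq> \<Union> (tri_verts ` N)"
      unfolding N(3)[symmetric] by (force simp: tri_verts_def)
    moreover have "V2 \<subseteq> \<Union> (tri_verts ` N)"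
      unfolding M(3)[symmetric] N(4)[symmetric] by (force simp: tri_verts_def)
    moreover have "V3 \<subseteq> \<Union> (tri_verts ` N)"
      unfolding M(4)[symmetric] N(4)[symmetric] by (force simp: tri_verts_def)
    ultimately show "V1 \<union> V2 \<union> V3 \<subseteq> \<Union> (tri_verts ` N)" by simp
  qed
  then show ?thesis by blast
qed

end

section \<open>The choice of constants and the asymptotic statement\<close>

lemma prob_Gnp_eq_bprob: "prob_Gnp n p P = bprob p (all_edges n) P"
  unfolding prob_Gnp_def bprob_def bexp_def by (rule sum.cong) auto

text \<open>It permits replacing \<delta> by \<open>min \<delta> 1\<close>, since the constants are
  set up for densities with \<delta> \<le> 1.\<close>

lemma strong_super_regular_mono:
  assumes "strong_super_regular G \<delta> \<epsilon> p V1 V2 V3" "\<delta>' \<le> \<delta>" "0 \<le> p"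
  shows "strong_super_regular G \<delta>' \<epsilon> p V1 V2 V3"
proof -
  have "\<delta>' * p \<le> \<delta> * p"
    using assms by (intro mult_right_mono) auto
  then show ?thesis
    using assms(1) unfolding strong_super_regular_def super_regular_def by (meson order_trans)
qed

lemma tri_property_if_sparse:
  fixes \<delta> \<delta>' \<xi> \<epsilon> A c \<gamma> c' :: real
  assumes \<delta>': "0 < \<delta>'" "\<delta>' \<le> 1" "\<delta>' \<le> \<delta>"
    and c: "c = \<delta>'\<^sup>2 / 12800" "\<gamma> = c / 4" "c' = \<gamma> * \<delta>' / 256"
    and \<epsilon>: "0 < \<epsilon>" "\<epsilon> \<le> \<delta>' / 16" "16 * \<epsilon> \<le> (c' / 4)\<^sup>2" "exp (12 / \<gamma>) * (96 / \<gamma>\<^sup>2 * (6 * \<epsilon>)) \<le> 1"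
    and A: "480000 / \<delta>'\<^sup>2 \<le> A" "768 / (\<gamma> * \<delta>') \<le> A" "96 / (\<gamma>\<^sup>2 * \<delta>') \<le> A"
    and p: "0 \<le> p" "p \<le> 1" "A * ln (real n) \<le> p\<^sup>2 * (\<xi> * n)" and n: "1 \<le> ln (real n)" "0 < n"
    and F: "edges_sparse c' p (\<xi> * n) n F" "triangles_sparse c p (\<xi> * n) n F"
  shows "tri_property \<xi> \<delta> \<epsilon> n p F"
  unfolding tri_property_def
proof (intro allI impI, elim conjE)
  fix G V1 V2 V3
  assume GF: "G \<subseteq> F" and V: "V1 \<subseteq> {..<n}" "V2 \<subseteq> {..<n}" "V3 \<subseteq> {..<n}"
    "V1 \<inter> V2 = {}" "V1 \<inter> V3 = {}" "V2 \<inter> V3 = {}"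
    and card: "card V1 = card V2" "card V2 = card V3" "\<xi> * real n \<le> real (card V1)"
    and strong: "strong_super_regular G \<delta> \<epsilon> p V1 V2 V3"
  define m where "m = card V1"
  have pos: "0 < c" "0 < \<gamma>" "0 < c'"
    using \<delta>' by (auto simp: c)
  have "\<delta>'\<^sup>2 \<le> 1" using \<delta>' by (simp add: power_le_one)
  have "480000 / 1 \<le> 480000 / \<delta>'\<^sup>2"
    using \<delta>' \<open>\<delta>'\<^sup>2 \<le> 1\<close> by (intro divide_left_mono) auto
  then have A480: "480000 \<le> A" using A(1) by linarith
  have "p\<^sup>2 * (\<xi> * n) \<le> p\<^sup>2 * m"
    using card(3) by (intro mult_left_mono) (auto simp: m_def)
  then have pm: "A * ln (real n) \<le> p\<^sup>2 * m"
    using p(3) by linarith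
  have "A * 1 \<le> A * ln (real n)"
    using A480 n by (intro mult_left_mono) auto
  then have Apm: "A \<le> p\<^sup>2 * m" using pm by linarith
  have "p\<^sup>2 * m \<le> 1 * real m"
    using p by (intro mult_right_mono) (auto simp: power_le_one)
  \<comment> \<open>With p \<le> 1 and ln n \<ge> 1 the bound on p^2 m forces m \<ge> A; hence m is
    large and p is positive.\<close>
  then have m3: "3 \<le> m" using Apm A480 by linarith
  have p0: "0 < p"
    using Apm A480 p(1) by (cases "p = 0") auto
  have "m \<le> n"
    unfolding m_def using card_mono[OF finite_lessThan V(1)] by simp
  then have ln_le: "ln (real m) \<le> ln (real n)" using m3 by simp
  \<comment> \<open>Each largeness condition of the form k ln m \<le> r p^2 m reduces to k / r \<le>
    A.\<close>
  have large: "k * ln (real m) \<le> r * (p\<^sup>2 * m)" if "0 < r" "k / r \<le> A" for k r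
  proof -
    have "k \<le> r * A" using that by (simp add: divide_simps mult_ac)
    then have "k * ln (real m) \<le> (r * A) * ln (real m)"
      using m3 by (intro mult_right_mono) auto
    also have "\<dots> = r * (A * ln (real m))" by simp
    also have "\<dots> \<le> r * (A * ln (real n))"
      using that A480 ln_le by (intro mult_left_mono) auto
    also have "\<dots> \<le> r * (p\<^sup>2 * m)"
      using that pm by (intro mult_left_mono) auto
    finally show ?thesis .
  qed
  note eps_small = \<epsilon>(3,4)
  interpret strong_triple G V1 V2 V3 p \<delta>' \<epsilon> m
  proof
    show "finite V1" "finite V2" "finite V3"
      using V by (auto intro: finite_subset)
    show "strong_super_regular G \<delta>' \<epsilon> p V1 V2 V3"
      using strong \<delta>'(3) p(1) by (rule strong_super_regular_mono)
  qed (use card \<delta>' \<epsilon> p0 in \<open>auto simp: m_def\<close>)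
  show "\<exists>T. triangle_factor G V1 V2 V3 T"
  proof (rule triangle_factor_exists[OF GF p(2) m3 _ V c F eps_small])
    show "\<xi> * n \<le> m" using card(3) by (simp add: m_def)
    show "480000 * ln (real m) \<le> \<delta>'\<^sup>2 * (p\<^sup>2 * m)" using A(1) \<delta>' by (intro large) auto
    show "768 * ln (real m) \<le> \<gamma> * \<delta>' * (p\<^sup>2 * m)" using A(2) \<delta>' pos by (intro large) auto
    have "96 / \<gamma>\<^sup>2 = \<delta>' * (96 / (\<gamma>\<^sup>2 * \<delta>'))" using \<delta>' by simp
    also have "\<dots> \<le> \<delta>' * (p\<^sup>2 * m)"
      using A(3) Apm \<delta>' by (intro mult_left_mono) auto
    finally show "96 / \<gamma>\<^sup>2 \<le> \<delta>' * (p\<^sup>2 * m)" .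
  qed
qed

theorem theorem1p4:
  shows "\<forall>\<delta>>0. \<exists>eps>0. \<forall>\<xi>>0. \<exists>C>0. \<forall>p :: nat \<Rightarrow> real.
           (\<forall>n. 0 \<le> p n \<and> p n \<le> 1) \<and>
           (\<forall>\<^sub>F n in sequentially. p n \<ge> C * sqrt (ln (real n) / real n))
           \<longrightarrow> aas p (tri_property \<xi> \<delta> eps)"
proof (intro allI impI)
  fix \<delta> :: real assume \<delta>: "0 < \<delta>"
  define \<delta>' where "\<delta>' = min \<delta> 1"
  define c where "c = \<delta>'\<^sup>2 / 12800"
  define \<gamma> where "\<gamma> = c / 4"
  define c' where "c' = \<gamma> * \<delta>' / 256"
  \<comment> \<open>The three entries serve the locale \<open>strong_triple\<close>, the edge counts
    in H, and the Chernoff bound over 2^m sets, where 576 = 96 * 6. None depends on \<xi>.\<close>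
  define eps where "eps = min (\<delta>' / 16) (min ((c' / 4)\<^sup>2 / 16) (\<gamma>\<^sup>2 / (576 * exp (12 / \<gamma>))))"
  define A where "A = 480000 / \<delta>'\<^sup>2 + 768 / (\<gamma> * \<delta>') + 96 / (\<gamma>\<^sup>2 * \<delta>') + 14 / c + 14 / c'"
  have \<delta>': "0 < \<delta>'" "\<delta>' \<le> 1" "\<delta>' \<le> \<delta>"
    using \<delta> by (auto simp: \<delta>'_def)
  then have pos: "0 < c" "0 < \<gamma>" "0 < c'"
    by (auto simp: c_def \<gamma>_def c'_def)
  have eps: "0 < eps" "eps \<le> \<delta>' / 16" "16 * eps \<le> (c' / 4)\<^sup>2"
    using \<delta>' pos by (auto simp: eps_def)
  have "exp (12 / \<gamma>) * (96 / \<gamma>\<^sup>2 * (6 * eps)) \<le> exp (12 / \<gamma>) * (96 / \<gamma>\<^sup>2 * (6 * (\<gamma>\<^sup>2 / (576 * exp (12 / \<gamma>)))))"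
    using pos by (intro mult_left_mono) (auto simp: eps_def)
  also have "\<dots> = 1"
    using pos by simp
  finally have eps4: "exp (12 / \<gamma>) * (96 / \<gamma>\<^sup>2 * (6 * eps)) \<le> 1" .
  have A_terms: "0 < 480000 / \<delta>'\<^sup>2" "0 < 768 / (\<gamma> * \<delta>')" "0 < 96 / (\<gamma>\<^sup>2 * \<delta>')" "0 < 14 / c" "0 < 14 / c'"
    using \<delta>' pos by auto
  then have A: "480000 / \<delta>'\<^sup>2 \<le> A" "768 / (\<gamma> * \<delta>') \<le> A" "96 / (\<gamma>\<^sup>2 * \<delta>') \<le> A" "14 / c \<le> A" "14 / c' \<le> A" "0 < A"
    unfolding A_def by linarith+
  have "\<exists>C>0. \<forall>p. (\<forall>n. 0 \<le> p n \<and> p n \<le> 1) \<and> (\<forall>\<^sub>F n in sequentially. p n \<ge> C * sqrt (ln (real n) / real n))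
      \<longrightarrow> aas p (tri_property \<xi> \<delta> eps)" if \<xi>: "0 < \<xi>" for \<xi> :: real
  \<comment> \<open>Squaring the lower bound on p turns this C into A ln n \<le> p^2 \<xi> n, the
    form in which the condition is used.\<close>
  proof (intro exI[of _ "sqrt (A / \<xi>)"] conjI allI impI)
    show "0 < sqrt (A / \<xi>)"
      using A \<xi> by simp
    fix p :: "nat \<Rightarrow> real"
    assume "(\<forall>n. 0 \<le> p n \<and> p n \<le> 1) \<and>
      (\<forall>\<^sub>F n in sequentially. p n \<ge> sqrt (A / \<xi>) * sqrt (ln (real n) / real n))"
    then have p: "\<And>n. 0 \<le> p n" "\<And>n. p n \<le> 1"
      and ev: "\<forall>\<^sub>F n in sequentially. p n \<ge> sqrt (A / \<xi>) * sqrt (ln (real n) / real n)" by auto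
    have lower: "1 - 18 / real n \<le> prob_Gnp n (p n) (tri_property \<xi> \<delta> eps n (p n))"
      if n: "3 \<le> n" and pn: "sqrt (A / \<xi>) * sqrt (ln (real n) / real n) \<le> p n" for n
    proof -
      let ?p = "p n" and ?E = "all_edges n"
      have ln1: "1 \<le> ln (real n)"
        using exp_le n by (subst ln_ge_iff) auto
      have "(sqrt (A / \<xi>) * sqrt (ln (real n) / real n))\<^sup>2 \<le> ?p\<^sup>2"
        using pn A \<xi> n ln1 by (intro power_mono) auto
      then have "A / \<xi> * (ln (real n) / real n) \<le> ?p\<^sup>2"
        using A \<xi> n ln1 by (simp add: power_mult_distrib)
      then have "A / \<xi> * (ln (real n) / real n) * (\<xi> * n) \<le> ?p\<^sup>2 * (\<xi> * n)"
        using \<xi> by (intro mult_right_mono) auto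
      then have Aln: "A * ln (real n) \<le> ?p\<^sup>2 * (\<xi> * n)"
        using \<xi> n by simp
      have large: "14 * ln (real n) \<le> r * ?p\<^sup>2 * (\<xi> * n)" if "0 < r" "14 / r \<le> A" for r
      proof -
        have "14 \<le> r * A" using that by (simp add: divide_simps mult_ac)
        then have "14 * ln (real n) \<le> r * A * ln (real n)"
          using ln1 by (intro mult_right_mono) auto
        also have "\<dots> \<le> r * (?p\<^sup>2 * (\<xi> * n))"
          using Aln that by (simp add: mult.assoc mult_left_mono)
        finally show ?thesis by (simp add: mult.assoc)
      qed
      \<comment> \<open>As \<open>p\<^sup>2\<close> \<le> p, the condition for single edges follows
        from the form needed for pairs of edges.\<close>
      have "c' * ?p\<^sup>2 * (\<xi> * n) \<le> c' * ?p * (\<xi> * n)"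
        using pos p[of n] \<xi> by (intro mult_right_mono mult_left_mono) (auto simp: power2_eq_square mult_left_le)
      then have "14 * ln (real n) \<le> c' * ?p * (\<xi> * n)"
        using large[of c'] pos A by linarith
      then have e: "bprob ?p ?E (\<lambda>F. \<not> edges_sparse c' ?p (\<xi> * n) n F) \<le> 9 / n"
        using p pos n by (intro bprob_not_edges_sparse) auto
      have t: "bprob ?p ?E (\<lambda>F. \<not> triangles_sparse c ?p (\<xi> * n) n F) \<le> 9 / n"
        using p pos n large[of c] A by (intro bprob_not_triangles_sparse) auto
      have "bprob ?p ?E (\<lambda>F. \<not> tri_property \<xi> \<delta> eps n ?p F)
          \<le> bprob ?p ?E (\<lambda>F. \<not> edges_sparse c' ?p (\<xi> * n) n F \<or> \<not> triangles_sparse c ?p (\<xi> * n) n F)"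
      proof (rule bprob_mono[OF p])
        fix F assume not: "\<not> tri_property \<xi> \<delta> eps n ?p F"
        show "\<not> edges_sparse c' ?p (\<xi> * n) n F \<or> \<not> triangles_sparse c ?p (\<xi> * n) n F"
        proof (rule ccontr)
          assume "\<not> ?thesis"
          then have "tri_property \<xi> \<delta> eps n ?p F"
            using n by (intro tri_property_if_sparse[OF \<delta>' c_def \<gamma>_def c'_def eps eps4 A(1-3) p Aln ln1]) auto
          then show False using not by blast
        qed
      qed
      also have "\<dots> \<le> 9 / n + 9 / n"
        by (rule order_trans[OF bprob_disj[OF p] add_mono[OF e t]])
      finally show ?thesis
        unfolding prob_Gnp_eq_bprob by (simp add: bprob_not[OF finite_all_edges])
    qed
    have upper: "prob_Gnp n (p n) P \<le> 1" for n P
      using bprob_not[OF finite_all_edges, of "p n" n P] bprob_nonneg[OF p, of n "all_edges n" "\<lambda>F. \<not> P F"]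
      unfolding prob_Gnp_eq_bprob by linarith
    show "aas p (tri_property \<xi> \<delta> eps)"
      unfolding aas_def
    proof (rule tendsto_sandwich)
      show "\<forall>\<^sub>F n in sequentially. 1 - 18 / real n \<le> prob_Gnp n (p n) (tri_property \<xi> \<delta> eps n (p n))"
        using ev eventually_ge_at_top[of 3] by eventually_elim (rule lower)
      show "\<forall>\<^sub>F n in sequentially. prob_Gnp n (p n) (tri_property \<xi> \<delta> eps n (p n)) \<le> 1"
        using upper by simp
      have "(\<lambda>n. 18 / real n) \<longlonglongrightarrow> 0"
        by (rule lim_const_over_n)
      then show "(\<lambda>n. 1 - 18 / real n) \<longlonglongrightarrow> 1"
        using tendsto_diff[OF tendsto_const[of "1::real"]] by fastforce
      show "(\<lambda>n. 1) \<longlonglongrightarrow> (1::real)" by simp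
    qed
  qed
  then show "\<exists>eps>0. \<forall>\<xi>>0. \<exists>C>0. \<forall>p :: nat \<Rightarrow> real.
      (\<forall>n. 0 \<le> p n \<and> p n \<le> 1) \<and> (\<forall>\<^sub>F n in sequentially. p n \<ge> C * sqrt (ln (real n) / real n))
      \<longrightarrow> aas p (tri_property \<xi> \<delta> eps)"
    using eps(1) by blast
qed

end
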